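(* Let $d\ge1$, $0<\beta\le1$, $L>0$, $\alpha\in(0,1)$. Let $T_1\equiv T(Y,\psi_1)$ be the multiscale statistic with kernel $\psi_1$, and let $\kappa_\alpha=\inf\{c\in\mathbb R:\mathbb P(T(W,\psi_1)>c)\le\alpha\}$ be the $(1-\alpha)$ quantile of $T(Y,\psi_1)$ under the null hypothesis $f=0$. Define $$\rho_n=\Big(\frac{\log n}{n}\Big)^{\frac{\beta}{2\beta+d}}$$ and let $M$ be any constant such that $$M>\Big(\frac{2dL^{d/\beta}\|\psi_1\|^2}{(2\beta+d)\langle\psi_1,\psi_\beta\rangle^2}\Big)^{\frac{\beta}{2\beta+d}}.$$ Let $J_n=[(M\rho_n/L)^{1/\beta},\,1-(M\rho_n/L)^{1/\beta}]^d$ and $\|g\|_{J_n,\infty}=\sup_{t\in J_n}|g(t)|$. Then $$\lim_{n\to\infty}\ \inf_{g\in\mathbb H_{\beta,L}:\ \|g\|_{J_n,\infty}\ge M\rho_n}\mathbb P_g(T_1>\kappa_\alpha)=1.$$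
   Context: Model: for each $n$ one observes $Y=\{Y(t):t\in[0,1]^d\}$ with $Y(t_1,\dots,t_d)=\sqrt n\int_0^{t_1}\cdots\int_0^{t_d}f(s_1,\dots,s_d)\,ds_d\cdots ds_1+W(t_1,\dots,t_d)$, where $f\in L_1([0,1]^d)$ is unknown and $W$ is the standard Brownian sheet (mean-zero Gaussian, $\mathrm{Cov}(W(t),W(s))=\prod_i\min(t_i,s_i)$). $\mathbb P_g$ denotes probability when $f=g$. The testing problem is $H_0:f=0$ versus $H_1:f\ne0$, $f\in\mathbb H_{\beta,L}$, with $\beta\le1$ unknown (the statistic $T_1$ and $\kappa_\alpha$ do not depend on $\beta$ or $L$). For bounded measurable $\varphi$ and $f$ integrable, $\int\varphi\,dY=\sqrt n\int\varphi f\,dx+\int\varphi\,dW$ (Wiener integral). Hölder class: $\mathbb H_{\beta,L}=\{f\in L_1([0,1]^d):|f(x)-f(y)|\le L\|x-y\|^\beta\ \forall x,y\in[0,1]^d\}$, $\|\cdot\|$ on $\mathbb R^d$ the Euclidean norm. For $0<\beta\le1$, $\psi_\beta(x)=(1-\|x\|^\beta)\mathbb I(\|x\|\le1)$, $x\in\mathbb R^d$; it is the unique minimizer of $\|\psi\|$ over functions $\psi:\mathbb R^d\to\mathbb R$ with $|\psi(x)-\psi(y)|\le\|x-y\|^\beta$ for all $x,y$ and $\psi(0)\ge1$. For functions on $\mathbb R^d$, $\langle g_1,g_2\rangle=\int_{\mathbb R^d}g_1g_2$ and $\|g\|^2=\langle g,g\rangle$. Multiscale statistic: for $\psi\in L_2(\mathbb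 R^d)$ vanishing outside $[-1,1]^d$, $h\in(0,1/2]^d$, $t\in A_h=\{t\in\mathbb{R}^d:h_i\le t_i\le1-h_i\ \forall i\}$, let $\psi_{t,h}(x)=\psi\big(\frac{x_1-t_1}{h_1},\dots,\frac{x_d-t_d}{h_d}\big)$ for $x\in[0,1]^d$, and $\hat\Psi(t,h)=(\prod_ih_i)^{-1/2}\|\psi\|^{-1}\int_{[0,1]^d}\psi_{t,h}\,dY$ (with $Y$ replaced by $W$ for $T(W,\psi)$). Then $$T(Y,\psi)=\sup_{h\in(0,1/2]^d}\sup_{t\in A_h}\frac{|\hat\Psi(t,h)|-\Gamma(2^dh_1\cdots h_d)}{D(2^dh_1\cdots h_d)},$$ with $\Gamma(r)=(2\log(1/r))^{1/2}$, $D(r)=(\log(e/r))^{-1/2}\log\log(e^e/r)$, $r\in(0,1]$. The process $(t,h)\mapsto\int\psi_{t,h}\,dW$ is taken in a version with continuous sample paths. *)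

theory Defs
  imports "HOL-Probability.Probability"
begin

abbreviation unit_cube :: "(real ^ 'n) set"
  where "unit_cube \<equiv> cbox 0 1"

text \<open>Almost surely constant variables count as (degenerate) Gaussian ones.\<close>

definition gaussian_rv :: "'w measure \<Rightarrow> ('w \<Rightarrow> real) \<Rightarrow> bool"
  where "gaussian_rv \<Omega> X \<longleftrightarrow>
    X \<in> borel_measurable \<Omega> \<and>
    ((\<exists>\<mu>. AE \<omega> in \<Omega>. X \<omega> = \<mu>) \<or>
     (\<exists>\<mu> \<sigma>. 0 < \<sigma> \<and> distributed \<Omega> lborel X (normal_density \<mu> \<sigma>)))"

definition gaussian_process :: "'w measure \<Rightarrow> 'i set \<Rightarrow> ('i \<Rightarrow> 'w \<Rightarrow> real) \<Rightarrow> bool"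
  where "gaussian_process \<Omega> I X \<longleftrightarrow>
    (\<forall>S c. finite S \<and> S \<subseteq> I \<longrightarrow> gaussian_rv \<Omega> (\<lambda>\<omega>. \<Sum>i\<in>S. c i * X i \<omega>))"

definition brownian_sheet :: "'w measure \<Rightarrow> (real ^ 'n \<Rightarrow> 'w \<Rightarrow> real) \<Rightarrow> bool"
  where "brownian_sheet \<Omega> W \<longleftrightarrow>
    prob_space \<Omega> \<and>
    gaussian_process \<Omega> unit_cube W \<and>
    (\<forall>t\<in>unit_cube. integral\<^sup>L \<Omega> (W t) = 0) \<and>
    (\<forall>s\<in>unit_cube. \<forall>t\<in>unit_cube.
      integral\<^sup>L \<Omega> (\<lambda>\<omega>. W s \<omega> * W t \<omega>) = (\<Prod>i\<in>UNIV. min (s $ i) (t $ i)))"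

text \<open>
  \<open>is_wiener_integral \<Omega> W \<phi> X\<close> says that \<open>X\<close> is a version of the integral of \<open>\<phi>\<close> with respect to
  \<open>W\<close> over the unit cube: the \<open>L\<^sub>2\<close> extension of the map sending the indicator function of the
  box from \<open>0\<close> to \<open>t\<close> to \<open>W t\<close>. The linear span of these indicator functions contains, up to null
  sets, all step functions over boxes, and the increments of \<open>W\<close> over boxes are the
  corresponding linear combinations of values of \<open>W\<close>. By the isometry property, \<open>X\<close> is determined
  up to null sets by \<open>W\<close> and \<open>\<phi>\<close>.
\<close>

definition is_wiener_integral ::
    "'w measure \<Rightarrow> (real ^ 'n \<Rightarrow> 'w \<Rightarrow> real) \<Rightarrow> (real ^ 'n \<Rightarrow> real) \<Rightarrow> ('w \<Rightarrow> real) \<Rightarrow> bool"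
  where "is_wiener_integral \<Omega> W \<phi> X \<longleftrightarrow>
    set_borel_measurable lborel unit_cube \<phi> \<and>
    set_integrable lborel unit_cube (\<lambda>x. (\<phi> x)\<^sup>2) \<and>
    X \<in> borel_measurable \<Omega> \<and>
    integrable \<Omega> (\<lambda>\<omega>. (X \<omega>)\<^sup>2) \<and>
    (\<exists>(S :: nat \<Rightarrow> (real ^ 'n) set) (c :: nat \<Rightarrow> real ^ 'n \<Rightarrow> real).
      (\<forall>k. finite (S k) \<and> S k \<subseteq> unit_cube) \<and>
      (\<lambda>k. LINT x:unit_cube|lborel.
        (\<phi> x - (\<Sum>t\<in>S k. c k t * indicator (cbox 0 t) x))\<^sup>2) \<longlonglongrightarrow> 0 \<and>
      (\<lambda>k. LINT \<omega>|\<Omega>. (X \<omega> - (\<Sum>t\<in>S k. c k t * W t \<omega>))\<^sup>2) \<longlonglongrightarrow> 0)"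

definition observation ::
    "nat \<Rightarrow> (real ^ 'n \<Rightarrow> real) \<Rightarrow> (real ^ 'n \<Rightarrow> 'w \<Rightarrow> real) \<Rightarrow> real ^ 'n \<Rightarrow> 'w \<Rightarrow> real"
  where "observation n f W t \<omega> = sqrt (real n) * (LINT s:cbox 0 t|lborel. f s) + W t \<omega>"

text \<open>
  The integral of \<open>\<phi>\<close> with respect to the observation with signal \<open>f\<close>; the argument \<open>w\<close> is the
  value of the Wiener integral of \<open>\<phi>\<close>.
\<close>

definition observation_integral ::
    "nat \<Rightarrow> (real ^ 'n \<Rightarrow> real) \<Rightarrow> (real ^ 'n \<Rightarrow> real) \<Rightarrow> real \<Rightarrow> real"
  where "observation_integral n f \<phi> w =
    sqrt (real n) * (LINT x:unit_cube|lborel. \<phi> x * f x) + w"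

lemma observation_integral_indicator:
  assumes "t \<in> unit_cube"
  shows "observation_integral n f (indicator (cbox 0 t)) (W t \<omega>) = observation n f W t \<omega>"
proof -
  have "cbox 0 t \<subseteq> unit_cube"
    using assms by (auto simp: mem_box_cart) (meson order_trans)
  then have "indicator unit_cube x * (indicator (cbox 0 t) x * f x) = indicator (cbox 0 t) x * f x"
    for x
    by (auto simp: indicator_def)
  then show ?thesis
    unfolding observation_integral_def observation_def set_lebesgue_integral_def real_scaleR_def
    by presburger
qed

definition holder_class :: "real \<Rightarrow> real \<Rightarrow> (real ^ 'n \<Rightarrow> real) set"
  where "holder_class \<beta> L = {f. set_integrable lborel unit_cube f \<and>
    (\<forall>x\<in>unit_cube. \<forall>y\<in>unit_cube. \<bar>f x - f y\<bar> \<le> L * norm (x - y) powr \<beta>)}"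

definition psi :: "real \<Rightarrow> real ^ 'n \<Rightarrow> real"
  where "psi \<beta> x = (1 - norm x powr \<beta>) * indicator {x. norm x \<le> 1} x"

definition l2_inner :: "(real ^ 'n \<Rightarrow> real) \<Rightarrow> (real ^ 'n \<Rightarrow> real) \<Rightarrow> real"
  where "l2_inner g1 g2 = (LINT x|lborel. g1 x * g2 x)"

definition l2_norm :: "(real ^ 'n \<Rightarrow> real) \<Rightarrow> real"
  where "l2_norm g = sqrt (l2_inner g g)"

definition bandwidths :: "(real ^ 'n) set"
  where "bandwidths = {h. \<forall>i. 0 < h $ i \<and> h $ i \<le> 1/2}"

definition locations :: "real ^ 'n \<Rightarrow> (real ^ 'n) set"
  where "locations h = {t. \<forall>i. h $ i \<le> t $ i \<and> t $ i \<le> 1 - h $ i}"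

definition rescale :: "(real ^ 'n \<Rightarrow> real) \<Rightarrow> real ^ 'n \<Rightarrow> real ^ 'n \<Rightarrow> real ^ 'n \<Rightarrow> real"
  where "rescale \<psi> t h x = \<psi> (\<chi> i. (x $ i - t $ i) / h $ i)"

definition Gamma_corr :: "real \<Rightarrow> real"
  where "Gamma_corr r = sqrt (2 * ln (1 / r))"

definition D_corr :: "real \<Rightarrow> real"
  where "D_corr r = ln (exp 1 / r) powr (- 1 / 2) * ln (ln (exp (exp 1) / r))"

text \<open>
  The argument \<open>\<Phi>\<close> is a sample path: \<open>\<Phi> t h\<close> is the value of the integral of \<open>rescale \<psi> t h\<close> with
  respect to the data. The statistic takes values in the extended reals, so that the supremum
  always exists.
\<close>

definition multiscale_stat ::
    "(real ^ 'n \<Rightarrow> real) \<Rightarrow> (real ^ 'n \<Rightarrow> real ^ 'n \<Rightarrow> real) \<Rightarrow> ereal"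
  where "multiscale_stat \<psi> \<Phi> =
    (SUP h\<in>bandwidths. SUP t\<in>locations h.
      let r = 2 ^ CARD('n) * (\<Prod>i\<in>UNIV. h $ i);
          \<Psi> = (\<Prod>i\<in>UNIV. h $ i) powr (- 1 / 2) * inverse (l2_norm \<psi>) * \<Phi> t h
      in ereal ((\<bar>\<Psi>\<bar> - Gamma_corr r) / D_corr r))"

definition continuous_wiener_version ::
    "'w measure \<Rightarrow> (real ^ 'n \<Rightarrow> 'w \<Rightarrow> real) \<Rightarrow> (real ^ 'n \<Rightarrow> real) \<Rightarrow>
     (real ^ 'n \<Rightarrow> real ^ 'n \<Rightarrow> 'w \<Rightarrow> real) \<Rightarrow> bool"
  where "continuous_wiener_version \<Omega> W \<psi> Z \<longleftrightarrow>
    (\<forall>h\<in>bandwidths. \<forall>t\<in>locations h. is_wiener_integral \<Omega> W (rescale \<psi> t h) (Z t h)) \<and>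
    (\<forall>\<omega>\<in>space \<Omega>. continuous_on {(t, h). h \<in> bandwidths \<and> t \<in> locations h} (\<lambda>(t, h). Z t h \<omega>))"

text \<open>
  In the following, \<open>Z t h\<close> stands for the Wiener integral of \<open>rescale \<psi> t h\<close>; the first statistic
  is \<open>T(W, \<psi>)\<close>, the second one is \<open>T(Y, \<psi>)\<close> for sample size \<open>n\<close> and signal \<open>f\<close>.
\<close>

definition noise_stat ::
    "(real ^ 'n \<Rightarrow> real) \<Rightarrow> (real ^ 'n \<Rightarrow> real ^ 'n \<Rightarrow> 'w \<Rightarrow> real) \<Rightarrow> 'w \<Rightarrow> ereal"
  where "noise_stat \<psi> Z \<omega> = multiscale_stat \<psi> (\<lambda>t h. Z t h \<omega>)"

definition data_stat ::
    "(real ^ 'n \<Rightarrow> real) \<Rightarrow> nat \<Rightarrow> (real ^ 'n \<Rightarrow> real) \<Rightarrow>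
     (real ^ 'n \<Rightarrow> real ^ 'n \<Rightarrow> 'w \<Rightarrow> real) \<Rightarrow> 'w \<Rightarrow> ereal"
  where "data_stat \<psi> n f Z \<omega> =
    multiscale_stat \<psi> (\<lambda>t h. observation_integral n f (rescale \<psi> t h) (Z t h \<omega>))"

definition critical_value ::
    "'w measure \<Rightarrow> (real ^ 'n \<Rightarrow> real) \<Rightarrow> (real ^ 'n \<Rightarrow> real ^ 'n \<Rightarrow> 'w \<Rightarrow> real) \<Rightarrow> real \<Rightarrow> ereal"
  where "critical_value \<Omega> \<psi> Z \<alpha> =
    Inf (ereal ` {c. measure \<Omega> {\<omega> \<in> space \<Omega>. noise_stat \<psi> Z \<omega> > ereal c} \<le> \<alpha>})"

definition rate :: "nat \<Rightarrow> real \<Rightarrow> nat \<Rightarrow> real"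
  where "rate d \<beta> n = (ln (real n) / real n) powr (\<beta> / (2 * \<beta> + real d))"

definition inner_cube :: "real \<Rightarrow> (real ^ 'n) set"
  where "inner_cube \<delta> = {t. \<forall>i. \<delta> \<le> t $ i \<and> t $ i \<le> 1 - \<delta>}"

definition sup_norm_on :: "(real ^ 'n) set \<Rightarrow> (real ^ 'n \<Rightarrow> real) \<Rightarrow> real"
  where "sup_norm_on J g = (SUP t\<in>J. \<bar>g t\<bar>)"

end

theory Submission
  imports Defs
begin

text \<open>
  At a maximiser \<open>t\<close> of \<open>\<bar>g\<bar>\<close> over the inner cube, the Hoelder condition makes \<open>\<bar>g\<bar>\<close> dominate the bump
  \<open>L * \<delta> powr \<beta> * psi \<beta> ((x - t) / \<delta>)\<close> with \<open>\<delta> = (M * rate / L) powr (1 / \<beta>)\<close>. Hence the normalised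
  statistic at \<open>t\<close> with all bandwidths \<open>\<delta>\<close> has mean at least \<open>A * sqrt (ln n)\<close>, the condition on \<open>M\<close> says that
  \<open>A\<close> exceeds the constant in \<open>Gamma_corr \<approx> B * sqrt (ln n)\<close>, and the noise has unit variance.

  The critical value stays bounded because the noise statistic is almost surely finite: the noise
  field is sub-Gaussian with Lipschitz increments on dyadic cells of scales and locations, so
  chaining with the sharp exponent \<open>exp (- x\<^sup>2 / 2)\<close> in each cell gives a union bound over
  the about \<open>m ^ d * 2 ^ m\<close> cells of volume \<open>(1/2) ^ m\<close>.
\<close>

section \<open>The rescaled kernel\<close>

text \<open>The union bound has no slack at leading order: a shape of volume about
  \<open>(1/2) ^ m\<close> has \<open>2 ^ m\<close> positions, and \<open>Gamma_corr\<close> grants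
  just the level at which a Gaussian tail equals \<open>(1/2) ^ m\<close>. A constant lost in the
  exponent would be fatal, while factors polynomial in m are affordable: they raise the level by an
  amount of order \<open>ln m / sqrt m\<close>, which is the size of \<open>D_corr\<close>. This is
  why the tail bounds, the passage to L2 limits and the chaining all keep the exponent
  \<open>- x^2 / 2\<close> exactly. The noise field is given only through L2 limits of finite
  Gaussian combinations, so tails are proved for these and carried to the limit. For the critical
  value a bound outside a set of probability at most \<alpha> is enough; it does not depend on n and
  is absorbed by the growth of \<open>sqrt (ln n)\<close>. For the power, measurability of the
  rejection event is essential, since \<open>measure\<close> is 0 on non-measurable sets.\<close>

lemma prod_Basis_cart:
  fixes f :: "real ^ 'n \<Rightarrow> 'a::comm_monoid_mult"
  shows "(\<Prod>j\<in>Basis. f j) = (\<Prod>i\<in>UNIV. f (axis i 1))"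
proof -
  have eq: "(Basis :: (real ^ 'n) set) = range (\<lambda>i. axis i 1)" by (auto simp: Basis_vec_def)
  have inj: "inj (\<lambda>i. axis i 1 :: real ^ 'n)" by (auto simp: inj_def axis_eq_axis)
  show ?thesis unfolding eq prod.reindex[OF inj] by simp
qed

lemma lborel_cart_affine:
  fixes h t :: "real ^ 'n"
  assumes "\<And>i. 0 < h $ i"
  shows "lborel = density (distr lborel borel (\<lambda>x. \<chi> i. t $ i + h $ i * x $ i)) (\<lambda>_. ennreal (\<Prod>i\<in>UNIV. h $ i))"
proof -
  have "t + (\<Sum>j\<in>Basis. ((h \<bullet> j) * (x \<bullet> j)) *\<^sub>R j) = (\<chi> i. t $ i + h $ i * x $ i)" for x
  proof -
    have "(\<Sum>j\<in>Basis. ((h \<bullet> j) * (x \<bullet> j)) *\<^sub>R j) = (\<Sum>j\<in>Basis. ((\<chi> i. h $ i * x $ i) \<bullet> j) *\<^sub>R j)"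
      by (intro sum.cong) (auto simp: Basis_vec_def cart_eq_inner_axis[symmetric])
    then show ?thesis by (simp add: euclidean_representation vec_eq_iff)
  qed
  moreover have "lborel = density (distr lborel borel (\<lambda>x. t + (\<Sum>j\<in>Basis. ((h \<bullet> j) * (x \<bullet> j)) *\<^sub>R j))) (\<lambda>_. ennreal (\<Prod>j\<in>Basis. \<bar>h \<bullet> j\<bar>))"
    using assms by (intro lborel_affine_euclidean) (auto simp: Basis_vec_def cart_eq_inner_axis[symmetric] less_imp_neq[symmetric])
  moreover have "(\<Prod>j\<in>Basis. \<bar>h \<bullet> j\<bar>) = (\<Prod>i\<in>UNIV. h $ i)"
    using assms unfolding prod_Basis_cart cart_eq_inner_axis[symmetric] by (simp add: less_imp_le)
  ultimately show ?thesis by simp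
qed

lemma
  fixes F :: "real ^ 'n \<Rightarrow> real"
  assumes [measurable]: "F \<in> borel_measurable borel" and h: "\<And>i. 0 < h $ i"
  shows measurable_rescale: "rescale F t h \<in> borel_measurable borel"
    and integral_rescale: "(\<integral>x. rescale F t h x \<partial>lborel) = (\<Prod>i\<in>UNIV. h $ i) * (\<integral>x. F x \<partial>lborel)"
proof -
  have [measurable]: "(\<lambda>x. \<chi> i. (x $ i - t $ i) / h $ i) \<in> borel_measurable borel"
    by (intro borel_measurable_continuous_onI continuous_intros) (use h in \<open>auto simp: less_imp_neq[symmetric]\<close>)
  show [measurable]: "rescale F t h \<in> borel_measurable borel"
    unfolding rescale_def by measurable
  let ?T = "\<lambda>x :: real ^ 'n. \<chi> i. t $ i + h $ i * x $ i"
  have [measurable]: "?T \<in> borel_measurable borel"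
    by (intro borel_measurable_continuous_onI continuous_intros)
  have eq: "rescale F t h (?T x) = F x" for x
    unfolding rescale_def using h by (simp add: less_imp_neq[symmetric] vec_lambda_eta)
  have "(\<integral>x. rescale F t h x \<partial>lborel) =
      (\<integral>x. rescale F t h x \<partial>density (distr lborel borel ?T) (\<lambda>_. ennreal (\<Prod>i\<in>UNIV. h $ i)))"
    by (subst lborel_cart_affine[OF h, of t]) simp
  also have "\<dots> = (\<integral>x. (\<Prod>i\<in>UNIV. h $ i) *\<^sub>R rescale F t h x \<partial>distr lborel borel ?T)"
    using h by (intro integral_density) (auto intro!: AE_I2 prod_nonneg simp: less_imp_le)
  also have "\<dots> = (\<integral>x. (\<Prod>i\<in>UNIV. h $ i) *\<^sub>R rescale F t h (?T x) \<partial>lborel)"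
    by (intro integral_distr) auto
  finally show "(\<integral>x. rescale F t h x \<partial>lborel) = (\<Prod>i\<in>UNIV. h $ i) * (\<integral>x. F x \<partial>lborel)"
    by (simp add: eq)
qed

section \<open>Elementary properties of the kernels \<open>psi \<beta>\<close>\<close>

lemma measurable_psi [measurable]: "psi \<beta> \<in> borel_measurable borel"
  unfolding psi_def by measurable

lemma psi_1_eq: "psi 1 x = max 0 (1 - norm x)"
  by (auto simp: psi_def indicator_def)

lemma psi_nonneg: "0 < \<beta> \<Longrightarrow> 0 \<le> psi \<beta> x"
  by (auto simp: psi_def indicator_def intro!: powr_le1)

lemma psi_le_1: "psi \<beta> x \<le> 1"
  by (auto simp: psi_def indicator_def)

lemma abs_psi_1_le_1: "\<bar>psi 1 x\<bar> \<le> 1"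
  by (simp add: psi_1_eq)

text \<open>The unit sphere is included because \<open>1 powr \<beta> = 1\<close>, so a rescaled
  kernel vanishes also on the faces of its window.\<close>

lemma psi_eq_0: "1 \<le> norm x \<Longrightarrow> psi \<beta> x = 0"
  by (auto simp: psi_def indicator_def powr_def)

lemma psi_1_lipschitz: "\<bar>psi 1 x - psi 1 y\<bar> \<le> norm (x - y)"
  unfolding psi_1_eq using norm_triangle_ineq3[of x y] by linarith

lemma continuous_psi_1: "continuous_on UNIV (psi 1)"
  unfolding psi_1_eq[abs_def] by (intro continuous_intros)

lemma integrable_psi_mult:
  assumes "0 < \<beta>"
  shows "integrable lborel (\<lambda>x :: real ^ 'n. psi 1 x * psi \<beta> x)"
proof (rule Bochner_Integration.integrable_bound)
  show "integrable lborel (indicator (cball (0 :: real ^ 'n) 1) :: _ \<Rightarrow> real)"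
    by (intro integrable_real_indicator) (auto simp: emeasure_bounded_finite[unfolded infinity_ennreal_def])
  have "\<bar>psi 1 x * psi \<beta> x\<bar> \<le> indicator (cball 0 1) x" for x :: "real ^ 'n"
  proof (cases "norm x \<le> 1")
    case True
    then show ?thesis
      using psi_nonneg[of 1 x] psi_nonneg[OF assms, of x] psi_le_1[of 1 x] psi_le_1[of \<beta> x]
      by (auto simp: abs_mult intro!: mult_le_one)
  qed (simp add: psi_eq_0)
  then show "AE x in lborel. norm (psi 1 x * psi \<beta> x) \<le> norm (indicator (cball (0 :: real ^ 'n) 1) x :: real)"
    by simp
qed measurable

lemma l2_inner_psi_pos:
  assumes "0 < \<beta>"
  shows "0 < l2_inner (psi 1) (psi \<beta> :: real ^ 'n \<Rightarrow> real)"
proof -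
  \<comment> \<open>On the ball of radius \<open>1/2\<close> the two kernels are at least
    \<open>1/2\<close> and \<open>1 - (1/2) powr \<beta>\<close>; \<open>?c\<close> is the product
    of these bounds.\<close>
  let ?c = "1/2 * (1 - (1/2) powr \<beta>)" and ?B = "ball (0 :: real ^ 'n) (1/2)"
  have b: "(1/2::real) powr \<beta> < 1" using powr_less_mono2[of \<beta> "1/2" 1] assms by simp
  have "0 < ?c * measure lborel ?B"
    using b content_ball_pos[of "1/2" "0 :: real ^ 'n"] by (intro mult_pos_pos) auto
  also have "\<dots> = (\<integral>x. ?c * indicator ?B x \<partial>lborel)" by simp
  also have "\<dots> \<le> l2_inner (psi 1) (psi \<beta> :: real ^ 'n \<Rightarrow> real)"
    unfolding l2_inner_def
  proof (intro integral_mono integrable_psi_mult[OF assms])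
    show "integrable lborel (\<lambda>x. ?c * indicator ?B x)"
      by (intro integrable_mult_right integrable_real_indicator) (auto simp: emeasure_bounded_finite[unfolded infinity_ennreal_def])
    fix x :: "real ^ 'n"
    show "?c * indicator ?B x \<le> psi 1 x * psi \<beta> x"
    proof (cases "x \<in> ?B")
      case True
      then have "norm x powr \<beta> \<le> (1/2) powr \<beta>" using assms by (intro powr_mono2) auto
      then have "?c \<le> psi 1 x * psi \<beta> x"
        using True b by (intro mult_mono) (auto simp: psi_def)
      then show ?thesis using True by simp
    qed (use psi_nonneg[of 1 x] psi_nonneg[OF assms, of x] in simp)
  qed
  finally show ?thesis .
qed

lemma l2_norm_psi_1:
  shows "0 < l2_norm (psi 1 :: real ^ 'n \<Rightarrow> real)"
    and "(l2_norm (psi 1 :: real ^ 'n \<Rightarrow> real))\<^sup>2 = l2_inner (psi 1) (psi 1 :: real ^ 'n \<Rightarrow> real)"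
  using l2_inner_psi_pos[of 1, where 'n='n] unfolding l2_norm_def by auto

section \<open>Windows of the rescaled kernels and their normalisation\<close>

lemma rescale_psi_eq_0:
  fixes x t h :: "real ^ 'n"
  assumes "\<And>i. 0 < h $ i" "h $ i \<le> \<bar>x $ i - t $ i\<bar>"
  shows "rescale (psi \<beta>) t h x = 0"
proof -
  have "1 \<le> \<bar>(x $ i - t $ i) / h $ i\<bar>" using assms(1)[of i] assms(2) by (simp add: abs_divide)
  also have "\<dots> \<le> norm (\<chi> i. (x $ i - t $ i) / h $ i)"
    using component_le_norm_cart[of "\<chi> i. (x $ i - t $ i) / h $ i" i] by simp
  finally show ?thesis unfolding rescale_def by (rule psi_eq_0)
qed

lemma rescale_psi_outside_cube:
  fixes x t h :: "real ^ 'n"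
  assumes "h \<in> bandwidths" "t \<in> locations h" "x \<notin> unit_cube"
  shows "rescale (psi \<beta>) t h x = 0"
proof -
  obtain i where "x $ i < 0 \<or> 1 < x $ i" using assms(3) by (auto simp: mem_box_cart not_le)
  moreover have "h $ i \<le> t $ i" "t $ i \<le> 1 - h $ i" using assms(2) by (auto simp: locations_def)
  ultimately have "h $ i \<le> \<bar>x $ i - t $ i\<bar>" by auto
  then show ?thesis using assms(1) by (intro rescale_psi_eq_0) (auto simp: bandwidths_def)
qed

lemma bandwidths_pos: "h \<in> bandwidths \<Longrightarrow> 0 < h $ i"
  by (simp add: bandwidths_def)

lemma set_lebesgue_integral_rescale_square:
  fixes t h :: "real ^ 'n"
  assumes "h \<in> bandwidths" "t \<in> locations h"
  shows "(LINT x:unit_cube|lborel. (rescale (psi 1) t h x)\<^sup>2) = (\<Prod>i\<in>UNIV. h $ i) * (l2_norm (psi 1 :: real ^ 'n \<Rightarrow> real))\<^sup>2"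
proof -
  have "(LINT x:unit_cube|lborel. (rescale (psi 1) t h x)\<^sup>2) = (\<integral>x. rescale (\<lambda>x. psi 1 x * psi 1 x) t h x \<partial>lborel)"
    unfolding set_lebesgue_integral_def
    using rescale_psi_outside_cube[OF assms, of _ 1]
    by (intro Bochner_Integration.integral_cong) (auto simp: indicator_def rescale_def power2_eq_square)
  also have "\<dots> = (\<Prod>i\<in>UNIV. h $ i) * l2_inner (psi 1) (psi 1 :: real ^ 'n \<Rightarrow> real)"
    unfolding l2_inner_def using assms by (intro integral_rescale) (auto simp: bandwidths_pos)
  finally show ?thesis by (simp add: l2_norm_psi_1)
qed

text \<open>The factor that \<open>multiscale_stat\<close> applies for the kernel
  \<open>psi 1\<close>. For admissible bandwidths and locations it is the inverse of the L2 norm of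
  the rescaled kernel, so the normalised kernels are unit vectors.\<close>

definition scale_norm :: "real ^ 'n \<Rightarrow> real"
  where "scale_norm h = (\<Prod>i\<in>UNIV. h $ i) powr (- 1 / 2) * inverse (l2_norm (psi 1 :: real ^ 'n \<Rightarrow> real))"

lemma scale_norm:
  fixes h :: "real ^ 'n"
  assumes "h \<in> bandwidths"
  shows scale_norm_pos: "0 < scale_norm h"
    and scale_norm_square: "(scale_norm h)\<^sup>2 * ((\<Prod>i\<in>UNIV. h $ i) * (l2_norm (psi 1 :: real ^ 'n \<Rightarrow> real))\<^sup>2) = 1"
proof -
  define P where "P = (\<Prod>i\<in>UNIV. h $ i)"
  have p: "0 < P" unfolding P_def using assms by (intro prod_pos) (auto simp: bandwidths_pos)
  then show "0 < scale_norm h"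
    unfolding scale_norm_def P_def[symmetric] using l2_norm_psi_1(1)[where 'n='n] by (simp add: zero_less_mult_iff)
  have "(P powr (- 1 / 2))\<^sup>2 = P powr (- 1)"
    unfolding power2_eq_square powr_add[symmetric] by simp
  then show "(scale_norm h)\<^sup>2 * ((\<Prod>i\<in>UNIV. h $ i) * (l2_norm (psi 1 :: real ^ 'n \<Rightarrow> real))\<^sup>2) = 1"
    unfolding scale_norm_def P_def[symmetric] power_mult_distrib using p l2_norm_psi_1(1)[where 'n='n]
    by (simp add: powr_minus power_inverse; simp add: field_simps)
qed

text \<open>Inside the window of \<open>(t, h)\<close> each \<open>z = (x - t) / h\<close> has
  modulus at most 1, and the rescaled coordinates differ by
  \<open>((t - t') + z * (h - h')) / h'\<close>. The scale \<open>\<eta>\<close> is a common order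
  of magnitude of both bandwidths; the constant 6 is 5 from the location plus 1 from the
  bandwidth.\<close>

lemma rescale_psi_diff:
  fixes t h t' h' x :: "real ^ 'n"
  assumes h: "\<And>i. 0 < h $ i" "\<And>i. \<eta> i \<le> h' $ i" "\<And>i. 0 < \<eta> i"
    and dh: "\<And>i. \<bar>h $ i - h' $ i\<bar> \<le> \<delta> * \<eta> i" and dt: "\<And>i. \<bar>t $ i - t' $ i\<bar> \<le> 5 * \<delta> * \<eta> i"
    and x: "\<And>i. \<bar>x $ i - t $ i\<bar> \<le> h $ i"
  shows "\<bar>rescale (psi 1) t h x - rescale (psi 1) t' h' x\<bar> \<le> 6 * real CARD('n) * \<delta>"
proof -
  let ?y = "\<chi> i. (x $ i - t $ i) / h $ i" and ?y' = "\<chi> i. (x $ i - t' $ i) / h' $ i"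
  have h'pos: "0 < h' $ i" for i using h(2)[of i] h(3)[of i] by linarith
  have "0 \<le> \<delta> * \<eta> i" for i using dh[of i] by linarith
  then have d0: "0 \<le> \<delta>" using h(3) by (metis mult_less_0_iff not_le order.asym)
  have comp: "\<bar>(?y - ?y') $ i\<bar> \<le> 6 * \<delta>" for i
  proof -
    let ?z = "(x $ i - t $ i) / h $ i"
    have z: "\<bar>?z\<bar> \<le> 1" using x[of i] h(1)[of i] by (simp add: abs_divide)
    have "(?y - ?y') $ i = - ((t $ i - t' $ i) + ?z * (h $ i - h' $ i)) / h' $ i"
      using h(1)[of i] h'pos[of i] by (simp add: field_simps)
    then have "\<bar>(?y - ?y') $ i\<bar> = \<bar>(t $ i - t' $ i) + ?z * (h $ i - h' $ i)\<bar> / h' $ i"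
      using h'pos[of i] by (simp add: abs_divide)
    also have "\<dots> \<le> (5 * \<delta> * \<eta> i + \<delta> * \<eta> i) / h' $ i"
    proof (intro divide_right_mono order_trans[OF abs_triangle_ineq] add_mono dt)
      have "\<bar>?z * (h $ i - h' $ i)\<bar> \<le> 1 * \<bar>h $ i - h' $ i\<bar>"
        unfolding abs_mult using z by (intro mult_right_mono) auto
      then show "\<bar>?z * (h $ i - h' $ i)\<bar> \<le> \<delta> * \<eta> i" using dh[of i] by simp
    qed (use h'pos[of i] in simp)
    also have "\<dots> \<le> (6 * \<delta> * h' $ i) / h' $ i"
      using h(2)[of i] d0 h'pos[of i] by (intro divide_right_mono) (auto simp: mult_left_mono)
    finally show ?thesis using h'pos[of i] by simp
  qed
  have "\<bar>rescale (psi 1) t h x - rescale (psi 1) t' h' x\<bar> \<le> norm (?y - ?y')"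
    unfolding rescale_def by (rule psi_1_lipschitz)
  also have "\<dots> \<le> (\<Sum>i\<in>UNIV. \<bar>(?y - ?y') $ i\<bar>)" by (rule norm_le_l1_cart)
  also have "\<dots> \<le> (\<Sum>i\<in>(UNIV :: 'n set). 6 * \<delta>)" by (intro sum_mono comp)
  finally show ?thesis by simp
qed

text \<open>The difference vanishes off the union of the two windows, and
  \<open>rescale_psi_diff\<close> applies on each of them after exchanging the roles. The constant
  is \<open>36 * d^2\<close> from the squared pointwise bound, times two windows of volume at most
  \<open>4 ^ d\<close> times the product of the \<open>\<eta> i\<close>.\<close>

lemma rescale_psi_L2_diff:
  fixes t h t' h' :: "real ^ 'n"
  assumes h: "h \<in> bandwidths" "h' \<in> bandwidths" "\<And>i. \<eta> i \<le> h $ i" "\<And>i. h $ i \<le> 2 * \<eta> i" "\<And>i. \<eta> i \<le> h' $ i" "\<And>i. h' $ i \<le> 2 * \<eta> i"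
    and eta: "\<And>i. 0 < \<eta> i"
    and dh: "\<And>i. \<bar>h $ i - h' $ i\<bar> \<le> \<delta> * \<eta> i" and dt: "\<And>i. \<bar>t $ i - t' $ i\<bar> \<le> 5 * \<delta> * \<eta> i"
  shows "(\<integral>x. (rescale (psi 1) t h x - rescale (psi 1) t' h' x)\<^sup>2 \<partial>lborel)
    \<le> 72 * (real CARD('n))\<^sup>2 * 4 ^ CARD('n) * (\<Prod>i\<in>UNIV. \<eta> i) * \<delta>\<^sup>2"
proof -
  let ?b = "\<lambda>t h :: real ^ 'n. cbox (t - h) (t + h)"
  let ?c = "(6 * real CARD('n) * \<delta>)\<^sup>2"
  have pt: "(rescale (psi 1) t h x - rescale (psi 1) t' h' x)\<^sup>2 \<le> ?c * (indicator (?b t h) x + indicator (?b t' h') x)" for x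
  proof -
    have "\<bar>rescale (psi 1) t h x - rescale (psi 1) t' h' x\<bar> \<le> 6 * real CARD('n) * \<delta>" if "x \<in> ?b t h"
      using that h eta dh dt by (intro rescale_psi_diff[where \<eta>=\<eta>]) (auto simp: bandwidths_pos mem_box_cart abs_le_iff algebra_simps)
    moreover have "\<bar>rescale (psi 1) t' h' x - rescale (psi 1) t h x\<bar> \<le> 6 * real CARD('n) * \<delta>" if "x \<in> ?b t' h'"
      using that h eta dh dt by (intro rescale_psi_diff[where \<eta>=\<eta>]) (auto simp: bandwidths_pos mem_box_cart abs_le_iff algebra_simps abs_minus_commute)
    moreover have "rescale (psi 1) t h x = 0" if xb: "x \<notin> ?b t h" and "h \<in> bandwidths" for t h
    proof -
      obtain i where "x $ i < t $ i - h $ i \<or> t $ i + h $ i < x $ i" using xb by (auto simp: mem_box_cart not_le)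
      then have "h $ i \<le> \<bar>x $ i - t $ i\<bar>" by linarith
      then show ?thesis using that by (intro rescale_psi_eq_0) (auto simp: bandwidths_pos)
    qed
    moreover have "u\<^sup>2 \<le> ?c" if "\<bar>u\<bar> \<le> 6 * real CARD('n) * \<delta>" for u
      using that by (simp add: abs_le_square_iff[symmetric])
    ultimately show ?thesis
      using h(1,2) by (auto simp: indicator_def abs_minus_commute)
         (smt (verit) zero_le_power2 abs_minus_commute)+
  qed
  have vol: "measure lborel (?b t h) \<le> 4 ^ CARD('n) * (\<Prod>i\<in>UNIV. \<eta> i)" if "h \<in> bandwidths" "\<And>i. h $ i \<le> 2 * \<eta> i" for t h
  proof -
    have "measure lborel (?b t h) = (\<Prod>i\<in>UNIV. 2 * h $ i)"
      using that(1) by (subst content_cbox_cart) (auto simp: interval_ne_empty_cart bandwidths_def less_imp_le)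
    also have "\<dots> \<le> (\<Prod>i\<in>UNIV. 4 * \<eta> i)"
      using that by (intro prod_mono) (auto simp: bandwidths_def less_imp_le)
    finally show ?thesis by (simp add: prod.distrib)
  qed
  have int: "integrable lborel (indicator (?b t h) :: _ \<Rightarrow> real)" for t h
    by (intro integrable_real_indicator) (auto simp: emeasure_bounded_finite[unfolded infinity_ennreal_def])
  have [measurable]: "rescale (psi 1) t h \<in> borel_measurable borel" "rescale (psi 1) t' h' \<in> borel_measurable borel"
    using h by (auto intro!: measurable_rescale simp: bandwidths_pos)
  have int2: "integrable lborel (\<lambda>x. ?c * (indicator (?b t h) x + indicator (?b t' h') x))"
    using int by (intro integrable_mult_right Bochner_Integration.integrable_add)
  have "(\<integral>x. (rescale (psi 1) t h x - rescale (psi 1) t' h' x)\<^sup>2 \<partial>lborel)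
    \<le> (\<integral>x. ?c * (indicator (?b t h) x + indicator (?b t' h') x) \<partial>lborel)"
  proof (rule integral_mono[OF _ int2 pt])
    show "integrable lborel (\<lambda>x. (rescale (psi 1) t h x - rescale (psi 1) t' h' x)\<^sup>2)"
      by (rule Bochner_Integration.integrable_bound[OF int2]) (auto intro!: AE_I2 order_trans[OF pt])
  qed
  also have "\<dots> = ?c * (measure lborel (?b t h) + measure lborel (?b t' h'))"
    using int by simp
  also have "\<dots> \<le> ?c * (4 ^ CARD('n) * (\<Prod>i\<in>UNIV. \<eta> i) + 4 ^ CARD('n) * (\<Prod>i\<in>UNIV. \<eta> i))"
    using h by (intro mult_left_mono add_mono vol) auto
  also have "\<dots> = 72 * (real CARD('n))\<^sup>2 * 4 ^ CARD('n) * (\<Prod>i\<in>UNIV. \<eta> i) * \<delta>\<^sup>2"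
    by (simp add: power_mult_distrib)
  finally show ?thesis .
qed

text \<open>The L2 Lipschitz constant of the normalised kernels at comparable scales: the square
  root of the constant in \<open>rescale_psi_L2_diff\<close>, divided by the norm of the
  kernel.\<close>

definition chaining_const :: "'n::finite itself \<Rightarrow> real"
  where "chaining_const _ = sqrt (72 * (real CARD('n))\<^sup>2 * 4 ^ CARD('n)) / l2_norm (psi 1 :: real ^ 'n \<Rightarrow> real)"

lemma chaining_const_pos: "0 < chaining_const TYPE('n::finite)"
  unfolding chaining_const_def using l2_norm_psi_1(1)[where 'n='n] by (simp add: zero_less_card_finite)

text \<open>
  With \<open>a = 1 / \<parallel>f\<parallel>\<close> and \<open>a' = 1 / \<parallel>f'\<parallel>\<close> one has
  \<open>\<parallel>a f - a' f'\<parallel>\<^sup>2 \<le> a a' \<parallel>f - f'\<parallel>\<^sup>2\<close>, so the normalising factors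
  need not be compared.
\<close>

lemma rescale_psi_normalized_L2_diff:
  fixes t h t' h' :: "real ^ 'n"
  assumes h: "h \<in> bandwidths" "h' \<in> bandwidths" "\<And>i. \<eta> i \<le> h $ i" "\<And>i. h $ i \<le> 2 * \<eta> i" "\<And>i. \<eta> i \<le> h' $ i" "\<And>i. h' $ i \<le> 2 * \<eta> i"
    and t: "t \<in> locations h" "t' \<in> locations h'"
    and eta: "\<And>i. 0 < \<eta> i"
    and dh: "\<And>i. \<bar>h $ i - h' $ i\<bar> \<le> \<delta> * \<eta> i" and dt: "\<And>i. \<bar>t $ i - t' $ i\<bar> \<le> 5 * \<delta> * \<eta> i"
  shows "(LINT x:unit_cube|lborel. (scale_norm h * rescale (psi 1) t h x - scale_norm h' * rescale (psi 1) t' h' x)\<^sup>2)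
    \<le> (chaining_const TYPE('n) * \<delta>)\<^sup>2"
proof -
  define a a' f f' where "a = scale_norm h" and "a' = scale_norm h'"
    and "f = rescale (psi 1) t h" and "f' = rescale (psi 1) t' h'"
  let ?q = "(l2_norm (psi 1 :: real ^ 'n \<Rightarrow> real))\<^sup>2"
  have [measurable]: "f \<in> borel_measurable borel" "f' \<in> borel_measurable borel"
    unfolding f_def f'_def using h by (auto intro!: measurable_rescale simp: bandwidths_pos)
  have a: "0 < a" "0 < a'" unfolding a_def a'_def by (intro scale_norm_pos h)+
  have out: "f x = 0" "f' x = 0" if "x \<notin> unit_cube" for x
    using that h t unfolding f_def f'_def by (auto intro!: rescale_psi_outside_cube)
  have cube: "(LINT x:unit_cube|lborel. g x) = (\<integral>x. g x \<partial>lborel)" if "\<And>x. x \<notin> unit_cube \<Longrightarrow> g x = 0" for g :: "real ^ 'n \<Rightarrow> real"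
    unfolding set_lebesgue_integral_def using that by (intro Bochner_Integration.integral_cong) (auto simp: indicator_def)
  have ff: "(\<integral>x. (f x)\<^sup>2 \<partial>lborel) = (\<Prod>i\<in>UNIV. h $ i) * ?q" "(\<integral>x. (f' x)\<^sup>2 \<partial>lborel) = (\<Prod>i\<in>UNIV. h' $ i) * ?q"
    using set_lebesgue_integral_rescale_square[OF h(1) t(1)] set_lebesgue_integral_rescale_square[OF h(2) t(2)] out
    unfolding f_def[symmetric] f'_def[symmetric] by (auto simp: cube)
  have b01: "\<bar>f x\<bar> \<le> indicator unit_cube x" "\<bar>f' x\<bar> \<le> indicator unit_cube x" for x
    using out[of x] unfolding f_def f'_def rescale_def
    by (auto simp: indicator_def abs_psi_1_le_1)
  have int: "integrable lborel (\<lambda>x. g x * g' x)" if "g \<in> borel_measurable borel" "g' \<in> borel_measurable borel"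
     "\<And>x. \<bar>g x\<bar> \<le> indicator unit_cube x" "\<And>x. \<bar>g' x\<bar> \<le> indicator unit_cube x" for g g' :: "real ^ 'n \<Rightarrow> real"
  proof (rule Bochner_Integration.integrable_bound)
    show "integrable lborel (indicator unit_cube :: real ^ 'n \<Rightarrow> real)"
      by (intro integrable_real_indicator) (auto simp: emeasure_bounded_finite[unfolded infinity_ennreal_def])
    have "\<bar>g x\<bar> * \<bar>g' x\<bar> \<le> indicator unit_cube x * indicator unit_cube x" for x
      by (intro mult_mono that) auto
    then show "AE x in lborel. norm (g x * g' x) \<le> norm (indicator unit_cube x :: real)"
      by (auto simp: abs_mult indicator_times_eq_if(1)[symmetric] simp flip: indicator_inter_arith)
  qed (use that in auto)
  let ?X = "\<integral>x. f x * f' x \<partial>lborel"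
  have i: "integrable lborel (\<lambda>x. (f x)\<^sup>2)" "integrable lborel (\<lambda>x. (f' x)\<^sup>2)" "integrable lborel (\<lambda>x. f x * f' x)"
    unfolding power2_eq_square by (auto intro!: int b01)
  have expand: "(\<integral>x. (u * f x - v * f' x)\<^sup>2 \<partial>lborel) = u\<^sup>2 * ((\<Prod>i\<in>UNIV. h $ i) * ?q) + v\<^sup>2 * ((\<Prod>i\<in>UNIV. h' $ i) * ?q) - 2 * u * v * ?X" for u v
  proof -
    have "(\<integral>x. (u * f x - v * f' x)\<^sup>2 \<partial>lborel) = (\<integral>x. u\<^sup>2 * (f x)\<^sup>2 + v\<^sup>2 * (f' x)\<^sup>2 - 2 * u * v * (f x * f' x) \<partial>lborel)"
      by (intro Bochner_Integration.integral_cong) (auto simp: power2_eq_square algebra_simps)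
    also have "\<dots> = u\<^sup>2 * (\<integral>x. (f x)\<^sup>2 \<partial>lborel) + v\<^sup>2 * (\<integral>x. (f' x)\<^sup>2 \<partial>lborel) - 2 * u * v * ?X"
      using i by simp
    finally show ?thesis unfolding ff .
  qed
  have sq: "a\<^sup>2 * ((\<Prod>i\<in>UNIV. h $ i) * ?q) = 1" "a'\<^sup>2 * ((\<Prod>i\<in>UNIV. h' $ i) * ?q) = 1"
    unfolding a_def a'_def by (intro scale_norm_square h)+
  have n: "(\<Prod>i\<in>UNIV. h $ i) * ?q = (1 / a)\<^sup>2" "(\<Prod>i\<in>UNIV. h' $ i) * ?q = (1 / a')\<^sup>2"
  proof -
    have "A = (1 / b)\<^sup>2" if "b\<^sup>2 * A = 1" "0 < b" for A b :: real
      using that by (simp add: power_divide eq_divide_eq mult.commute)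
    then show "(\<Prod>i\<in>UNIV. h $ i) * ?q = (1 / a)\<^sup>2" "(\<Prod>i\<in>UNIV. h' $ i) * ?q = (1 / a')\<^sup>2"
      using sq a by blast+
  qed
  have e: "(\<integral>x. (1 * f x - 1 * f' x)\<^sup>2 \<partial>lborel) = (1 / a)\<^sup>2 + (1 / a')\<^sup>2 - 2 * ?X"
    unfolding expand n by simp
  \<comment> \<open>Both normalised kernels are unit vectors, so their distance depends only on the
    inner product \<open>?X\<close>; the comparison is then \<open>2 * u * v \<le> u^2 + v^2\<close>
    with \<open>u = 1 / a\<close> and \<open>v = 1 / a'\<close>.\<close>
  have "(\<integral>x. (a * f x - a' * f' x)\<^sup>2 \<partial>lborel) = 2 - 2 * a * a' * ?X"
    unfolding expand sq by simp
  also have "\<dots> = a * a' * (2 * (1 / a) * (1 / a') - 2 * ?X)" using a by (simp add: right_diff_distrib)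
  also have "\<dots> \<le> a * a' * ((1 / a)\<^sup>2 + (1 / a')\<^sup>2 - 2 * ?X)"
    using a sum_squares_bound[of "1 / a" "1 / a'"] by (intro mult_left_mono) auto
  also have "\<dots> = a * a' * (\<integral>x. (f x - f' x)\<^sup>2 \<partial>lborel)" using e by simp
  also have "\<dots> \<le> 1 / ((\<Prod>i\<in>UNIV. \<eta> i) * ?q) * (72 * (real CARD('n))\<^sup>2 * 4 ^ CARD('n) * (\<Prod>i\<in>UNIV. \<eta> i) * \<delta>\<^sup>2)"
  proof (rule mult_mono)
    let ?e = "(\<Prod>i\<in>UNIV. \<eta> i) * ?q"
    have ep: "0 < ?e" using eta l2_norm_psi_1(1)[where 'n='n] by (simp add: prod_pos)
    have "b\<^sup>2 \<le> 1 / ?e" if "b\<^sup>2 * ((\<Prod>i\<in>UNIV. k $ i) * ?q) = 1" "\<And>i. \<eta> i \<le> k $ i" for b and k :: "real ^ 'n"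
    proof -
      have "?e \<le> (\<Prod>i\<in>UNIV. k $ i) * ?q" using that(2) eta by (intro mult_right_mono prod_mono) (auto simp: less_imp_le)
      then have "b\<^sup>2 * ?e \<le> b\<^sup>2 * ((\<Prod>i\<in>UNIV. k $ i) * ?q)" by (intro mult_left_mono) auto
      then have "b\<^sup>2 * ?e \<le> 1" by (simp only: that(1))
      then show ?thesis using ep by (simp add: field_simps)
    qed
    then have "a\<^sup>2 \<le> 1 / ?e" "a'\<^sup>2 \<le> 1 / ?e" using sq h by auto
    then show "a * a' \<le> 1 / ?e" using sum_squares_bound[of a a'] by linarith
    show "(\<integral>x. (f x - f' x)\<^sup>2 \<partial>lborel) \<le> 72 * (real CARD('n))\<^sup>2 * 4 ^ CARD('n) * (\<Prod>i\<in>UNIV. \<eta> i) * \<delta>\<^sup>2"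
      unfolding f_def f'_def using h eta dh dt by (intro rescale_psi_L2_diff) auto
    show "0 \<le> 1 / ?e" using ep by simp
  qed simp
  also have "\<dots> = (chaining_const TYPE('n) * \<delta>)\<^sup>2"
  proof -
    have "(\<Prod>i\<in>UNIV. \<eta> i) \<noteq> 0" using eta by (simp add: less_imp_neq[symmetric])
    then show ?thesis by (simp add: chaining_const_def power_mult_distrib power_divide)
  qed
  finally show ?thesis
    using out unfolding a_def[symmetric] a'_def[symmetric] f_def[symmetric] f'_def[symmetric] by (simp add: cube)
qed

section \<open>Gaussian tails of Wiener integrals\<close>

text \<open>For \<open>0 \<le> x \<le> y\<close> one has \<open>y^2 \<ge> x^2 + (y - x)^2\<close>,
  so on the tail the density is dominated by \<open>exp (- x^2 / (2 * \<sigma>^2))\<close> times the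
  normal density centred at x, which has total mass one.\<close>

lemma normal_upper_tail:
  assumes "prob_space M" and X: "distributed M lborel X (normal_density 0 \<sigma>)" and "0 < \<sigma>" "0 \<le> x"
  shows "measure M {\<omega> \<in> space M. x \<le> X \<omega>} \<le> exp (- x\<^sup>2 / (2 * \<sigma>\<^sup>2))"
proof -
  interpret prob_space M by fact
  have eq: "{\<omega> \<in> space M. x \<le> X \<omega>} = X -` {x..} \<inter> space M" by auto
  have pt: "normal_density 0 \<sigma> y * indicator {x..} y \<le> exp (- x\<^sup>2 / (2 * \<sigma>\<^sup>2)) * normal_density x \<sigma> y" for y
  proof (cases "x \<le> y")
    case True
    have "- y\<^sup>2 \<le> - x\<^sup>2 + - (y - x)\<^sup>2"
      using mult_left_mono[OF True, of x] \<open>0 \<le> x\<close> by (simp add: power2_eq_square algebra_simps)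
    then have "- y\<^sup>2 / (2 * \<sigma>\<^sup>2) \<le> (- x\<^sup>2 + - (y - x)\<^sup>2) / (2 * \<sigma>\<^sup>2)"
      by (intro divide_right_mono) auto
    then have "exp (- y\<^sup>2 / (2 * \<sigma>\<^sup>2)) \<le> exp (- x\<^sup>2 / (2 * \<sigma>\<^sup>2)) * exp (- (y - x)\<^sup>2 / (2 * \<sigma>\<^sup>2))"
      unfolding exp_add[symmetric] exp_le_cancel_iff add_divide_distrib[symmetric] .
    then show ?thesis
      using True \<open>0 < \<sigma>\<close> unfolding normal_density_def
      by (simp add: divide_simps)
  qed (simp add: \<open>0 < \<sigma>\<close> less_imp_le)
  have "emeasure M (X -` {x..} \<inter> space M) = (\<integral>\<^sup>+y. ennreal (normal_density 0 \<sigma> y) * indicator {x..} y \<partial>lborel)"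
    using X by (intro distributed_emeasure) auto
  also have "\<dots> = (\<integral>\<^sup>+y. ennreal (normal_density 0 \<sigma> y * indicator {x..} y) \<partial>lborel)"
    by (intro nn_integral_cong) (auto simp: indicator_def)
  also have "\<dots> \<le> (\<integral>\<^sup>+y. ennreal (exp (- x\<^sup>2 / (2 * \<sigma>\<^sup>2)) * normal_density x \<sigma> y) \<partial>lborel)"
    by (intro nn_integral_mono ennreal_leI pt)
  also have "\<dots> = ennreal (\<integral>y. exp (- x\<^sup>2 / (2 * \<sigma>\<^sup>2)) * normal_density x \<sigma> y \<partial>lborel)"
    using \<open>0 < \<sigma>\<close> by (intro nn_integral_eq_integral) auto
  also have "\<dots> = ennreal (exp (- x\<^sup>2 / (2 * \<sigma>\<^sup>2)))"
    using \<open>0 < \<sigma>\<close> by simp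
  finally show ?thesis
    unfolding eq by (simp add: emeasure_eq_measure)
qed

text \<open>Stating the tail for an upper bound \<open>v\<close> of the second moment treats
  degenerate and proper Gaussian variables alike, and suits approximants whose variance is only
  known up to an error.\<close>

lemma
  assumes "prob_space M" "gaussian_rv M X"
  shows gaussian_rv_integrable: "integrable M X"
    and gaussian_rv_integrable_square: "integrable M (\<lambda>\<omega>. (X \<omega>)\<^sup>2)"
    and gaussian_rv_upper_tail: "\<lbrakk>integral\<^sup>L M X = 0; (\<integral>\<omega>. (X \<omega>)\<^sup>2 \<partial>M) \<le> v; 0 < v; 0 \<le> x\<rbrakk>
      \<Longrightarrow> measure M {\<omega> \<in> space M. x \<le> X \<omega>} \<le> exp (- x\<^sup>2 / (2 * v))"
proof -
  interpret prob_space M by fact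
  have [measurable]: "X \<in> borel_measurable M"
    using assms by (simp add: gaussian_rv_def)
  have "integrable M X \<and> integrable M (\<lambda>\<omega>. (X \<omega>)\<^sup>2) \<and> 
    (integral\<^sup>L M X = 0 \<longrightarrow> (\<integral>\<omega>. (X \<omega>)\<^sup>2 \<partial>M) \<le> v \<longrightarrow> 0 < v \<longrightarrow> 0 \<le> x
      \<longrightarrow> measure M {\<omega> \<in> space M. x \<le> X \<omega>} \<le> exp (- x\<^sup>2 / (2 * v)))"
    using assms(2) unfolding gaussian_rv_def
  proof (elim conjE disjE exE)
    fix \<mu> assume ae: "AE \<omega> in M. X \<omega> = \<mu>"
    have i: "integrable M X" 
      using integrable_cong_AE[of X M "\<lambda>_. \<mu>"] ae by simp
    have "AE \<omega> in M. (X \<omega>)\<^sup>2 = \<mu>\<^sup>2" using ae by eventually_elim simp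
    then have i2: "integrable M (\<lambda>\<omega>. (X \<omega>)\<^sup>2)"
      using integrable_cong_AE[of "\<lambda>\<omega>. (X \<omega>)\<^sup>2" M "\<lambda>_. \<mu>\<^sup>2"] by simp
    have e: "integral\<^sup>L M X = \<mu>"
      using integral_cong_AE[of X M "\<lambda>_. \<mu>"] ae by (simp add: prob_space)
    have "measure M {\<omega> \<in> space M. x \<le> X \<omega>} \<le> exp (- x\<^sup>2 / (2 * v))" if "\<mu> = 0" "0 \<le> x"
    proof (cases "x = 0")
      \<comment> \<open>At \<open>x = 0\<close> the event is almost sure, but the bound is
        1.\<close>
      case True then show ?thesis by simp
    next
      case False
      have "AE \<omega> in M. \<not> (x \<le> X \<omega>)" using ae by eventually_elim (use that False in auto)
      then have "prob {\<omega> \<in> space M. x \<le> X \<omega>} = 0"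
        by (subst prob_eq_0) auto
      then show ?thesis by simp
    qed
    with i i2 e show ?thesis by simp
  next
    fix \<mu> \<sigma> :: real
    assume s: "0 < \<sigma>" and X: "distributed M lborel X (normal_density \<mu> \<sigma>)"
    have m: "integral\<^sup>L M X = \<mu>" and var: "(\<integral>\<omega>. (X \<omega> - \<mu>)\<^sup>2 \<partial>M) = \<sigma>\<^sup>2"
      using normal_distributed_expectation[OF s X] normal_distributed_variance[OF s X] by auto
    have i1: "integrable M X"
      using s X by (rule_tac distributed_integrable_var[of _ _ "normal_density \<mu> \<sigma>"])
        (auto simp: integrable_normal_moment_nz_1)
    have "integrable M (\<lambda>\<omega>. (X \<omega> - \<mu>)\<^sup>2)"
      using distributed_integrable[OF X, of "\<lambda>x. (x - \<mu>)\<^sup>2"] integrable_normal_moment[OF s, of \<mu> 2]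
      by simp
    then have "integrable M (\<lambda>\<omega>. (X \<omega> - \<mu>)\<^sup>2 + 2 * \<mu> * X \<omega> - \<mu>\<^sup>2)"
      using i1 by (intro Bochner_Integration.integrable_add Bochner_Integration.integrable_diff) auto
    then have i2: "integrable M (\<lambda>\<omega>. (X \<omega>)\<^sup>2)"
      by (rule back_subst[of "integrable M"]) (auto simp: power2_eq_square algebra_simps)
    have "measure M {\<omega> \<in> space M. x \<le> X \<omega>} \<le> exp (- x\<^sup>2 / (2 * v))"
      if "\<mu> = 0" "(\<integral>\<omega>. (X \<omega>)\<^sup>2 \<partial>M) \<le> v" "0 < v" "0 \<le> x"
    proof -
      have "measure M {\<omega> \<in> space M. x \<le> X \<omega>} \<le> exp (- x\<^sup>2 / (2 * \<sigma>\<^sup>2))"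
        using X s that by (intro normal_upper_tail) (auto intro: prob_space_axioms)
      also have "\<dots> \<le> exp (- x\<^sup>2 / (2 * v))"
        using that var s by (auto intro!: divide_left_mono)
      finally show ?thesis .
    qed
    then show ?thesis using i1 i2 m by simp
  qed
  then show "integrable M X" "integrable M (\<lambda>\<omega>. (X \<omega>)\<^sup>2)"
    "\<lbrakk>integral\<^sup>L M X = 0; (\<integral>\<omega>. (X \<omega>)\<^sup>2 \<partial>M) \<le> v; 0 < v; 0 \<le> x\<rbrakk>
      \<Longrightarrow> measure M {\<omega> \<in> space M. x \<le> X \<omega>} \<le> exp (- x\<^sup>2 / (2 * v))" by auto
qed

section \<open>Step functions and the isometry of the Wiener integral\<close>

lemma measure_cbox_Int_cbox:
  fixes s t :: "real ^ 'n"
  assumes "s \<in> unit_cube" "t \<in> unit_cube"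
  shows "measure lborel (cbox 0 s \<inter> cbox 0 t) = (\<Prod>i\<in>UNIV. min (s $ i) (t $ i))"
proof -
  have "cbox 0 s \<inter> cbox 0 t = cbox 0 (\<chi> i. min (s $ i) (t $ i))"
    by (auto simp: mem_box_cart)
  moreover have "0 \<le> min (s $ i) (t $ i)" for i
    using assms by (auto simp: mem_box_cart)
  ultimately show ?thesis
    by (simp add: content_cbox_cart interval_ne_empty_cart)
qed

lemma step_function_square_integrable:
  fixes S :: "(real ^ 'n) set"
  assumes "finite S"
  shows "set_integrable lborel unit_cube (\<lambda>x. (\<Sum>t\<in>S. c t * indicator (cbox 0 t) x)\<^sup>2 :: real)"
proof -
  have "integrable lborel (\<lambda>x. indicator (cbox 0 s \<inter> cbox 0 t \<inter> unit_cube) x * (c s * c t))"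
    for s t :: "real ^ 'n"
    by (intro integrable_mult_left integrable_real_indicator)
       (simp_all add: emeasure_bounded_finite[unfolded infinity_ennreal_def] bounded_Int)
  then have "integrable lborel (\<lambda>x. \<Sum>s\<in>S. \<Sum>t\<in>S. indicator (cbox 0 s \<inter> cbox 0 t \<inter> unit_cube) x * (c s * c t))"
    by (intro Bochner_Integration.integrable_sum)
  moreover have "(\<Sum>s\<in>S. \<Sum>t\<in>S. indicator (cbox 0 s \<inter> cbox 0 t \<inter> unit_cube) x * (c s * c t))
      = indicator unit_cube x *\<^sub>R (\<Sum>t\<in>S. c t * indicator (cbox 0 t) x)\<^sup>2" for x :: "real ^ 'n"
    unfolding power2_eq_square sum_product by (cases "x \<in> unit_cube") (auto simp: indicator_def intro!: sum.cong)
  ultimately show ?thesis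
    unfolding set_integrable_def by simp
qed

lemma step_function_L2:
  fixes S :: "(real ^ 'n) set"
  assumes "finite S" "S \<subseteq> unit_cube"
  shows "(LINT x:unit_cube|lborel. (\<Sum>t\<in>S. c t * indicator (cbox 0 t) x)\<^sup>2)
    = (\<Sum>s\<in>S. \<Sum>t\<in>S. c s * c t * (\<Prod>i\<in>UNIV. min (s $ i) (t $ i)))"
proof -
  have int: "integrable lborel (\<lambda>x. c s * c t * indicator (cbox 0 s \<inter> cbox 0 t) x)" for s t :: "real ^ 'n"
    by (intro integrable_mult_right integrable_real_indicator)
       (simp_all add: emeasure_bounded_finite[unfolded infinity_ennreal_def] bounded_Int)
  have "indicator unit_cube x *\<^sub>R (\<Sum>t\<in>S. c t * indicator (cbox 0 t) x)\<^sup>2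
      = (\<Sum>s\<in>S. \<Sum>t\<in>S. c s * c t * indicator (cbox 0 s \<inter> cbox 0 t) x)" for x :: "real ^ 'n"
  proof -
    have "cbox 0 t \<subseteq> unit_cube" if "t \<in> S" for t
      using that assms(2) by (auto simp: mem_box_cart subset_iff) (meson order_trans)
    then have "indicator unit_cube x * (c s * indicator (cbox 0 s) x) = c s * indicator (cbox 0 s) x"
      if "s \<in> S" for s
      using that by (auto simp: indicator_def)
    then have eq: "indicator unit_cube x * (\<Sum>t\<in>S. c t * indicator (cbox 0 t) x) = (\<Sum>t\<in>S. c t * indicator (cbox 0 t) x)"
      unfolding sum_distrib_left by (intro sum.cong) auto
    have "indicator unit_cube x *\<^sub>R (\<Sum>t\<in>S. c t * indicator (cbox 0 t) x)\<^sup>2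
      = (indicator unit_cube x * (\<Sum>t\<in>S. c t * indicator (cbox 0 t) x)) * (\<Sum>t\<in>S. c t * indicator (cbox 0 t) x)"
      by (simp only: power2_eq_square real_scaleR_def mult.assoc)
    then show ?thesis
      unfolding eq sum_product by (auto simp: indicator_inter_arith intro!: sum.cong)
  qed
  then have "(LINT x:unit_cube|lborel. (\<Sum>t\<in>S. c t * indicator (cbox 0 t) x)\<^sup>2)
      = (\<integral>x. (\<Sum>s\<in>S. \<Sum>t\<in>S. c s * c t * indicator (cbox 0 s \<inter> cbox 0 t) x) \<partial>lborel)"
    unfolding set_lebesgue_integral_def by simp
  also have "\<dots> = (\<Sum>s\<in>S. \<Sum>t\<in>S. c s * c t * measure lborel (cbox 0 s \<inter> cbox 0 t))"
    using int by (simp add: Bochner_Integration.integral_sum Bochner_Integration.integrable_sum)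
  finally show ?thesis
    using assms by (simp add: measure_cbox_Int_cbox subset_iff)
qed

text \<open>A small weight \<open>e\<close> leaves the coefficient of the main term arbitrarily
  close to 1, as the exact exponent requires; \<open>e = 1\<close> gives the crude bound used for
  integrability.\<close>

lemma square_add_le_weighted:
  fixes a b e :: real
  assumes "0 < e"
  shows "(a + b)\<^sup>2 \<le> (1 + e) * a\<^sup>2 + (1 + 1 / e) * b\<^sup>2"
proof -
  have "0 \<le> (e * a - b)\<^sup>2 / e" using assms by simp
  also have "\<dots> = e * a\<^sup>2 + b\<^sup>2 / e - 2 * a * b"
    using assms by (simp add: field_simps power2_eq_square)
  finally show ?thesis by (simp add: algebra_simps power2_eq_square)
qed

lemma integrable_square_diff:
  fixes f g :: "'a \<Rightarrow> real"
  assumes "integrable M (\<lambda>x. (f x)\<^sup>2)" "integrable M (\<lambda>x. (g x)\<^sup>2)" "f \<in> borel_measurable M" "g \<in> borel_measurable M"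
  shows "integrable M (\<lambda>x. (f x - g x)\<^sup>2)"
proof (rule Bochner_Integration.integrable_bound)
  show "integrable M (\<lambda>x. 2 * (f x)\<^sup>2 + 2 * (g x)\<^sup>2)" using assms by simp
  have "(f x - g x)\<^sup>2 \<le> 2 * (f x)\<^sup>2 + 2 * (g x)\<^sup>2" for x
    using square_add_le_weighted[of 1 "f x" "- g x"] by simp
  then show "AE x in M. norm ((f x - g x)\<^sup>2) \<le> norm (2 * (f x)\<^sup>2 + 2 * (g x)\<^sup>2)" by simp
qed (use assms in measurable)

lemma integrable_mult_of_squares:
  fixes f g :: "'a \<Rightarrow> real"
  assumes "integrable M (\<lambda>x. (f x)\<^sup>2)" "integrable M (\<lambda>x. (g x)\<^sup>2)" "f \<in> borel_measurable M" "g \<in> borel_measurable M"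
  shows "integrable M (\<lambda>x. f x * g x)"
proof -
  have "integrable M (\<lambda>x. (1/2) * ((f x)\<^sup>2 + (g x)\<^sup>2 - (f x - g x)\<^sup>2))"
    using integrable_square_diff[OF assms] assms by simp
  moreover have "(1/2) * ((f x)\<^sup>2 + (g x)\<^sup>2 - (f x - g x)\<^sup>2) = f x * g x" for x
    by (simp add: power2_diff)
  ultimately show ?thesis by simp
qed

text \<open>The covariance of the sheet, a product of minima, is the volume of the intersection of
  two boxes with corner 0. Hence it is the inner product of their indicators, and both sides of the
  isometry are the same double sum.\<close>

lemma
  fixes W :: "real ^ 'n \<Rightarrow> 'w \<Rightarrow> real" and c :: "real ^ 'n \<Rightarrow> real"
  assumes "brownian_sheet \<Omega> W" "finite S" "S \<subseteq> unit_cube"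
  defines "X \<equiv> \<lambda>\<omega>. \<Sum>t\<in>S. c t * W t \<omega>"
  defines "s \<equiv> \<lambda>x. \<Sum>t\<in>S. c t * indicator (cbox 0 t) x"
  shows brownian_sheet_step_gaussian: "gaussian_rv \<Omega> X"
    and brownian_sheet_step_mean: "integral\<^sup>L \<Omega> X = 0"
    and brownian_sheet_step_isometry: "integral\<^sup>L \<Omega> (\<lambda>\<omega>. (X \<omega>)\<^sup>2) = (LINT x:unit_cube|lborel. (s x)\<^sup>2)"
proof -
  have ps: "prob_space \<Omega>" and gp: "gaussian_process \<Omega> unit_cube W"
    using assms(1) by (auto simp: brownian_sheet_def)
  show "gaussian_rv \<Omega> X"
    using gp[unfolded gaussian_process_def, rule_format, of S c] assms(2,3) unfolding X_def by simp
  have g1: "gaussian_rv \<Omega> (W t)" if "t \<in> S" for t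
  proof -
    have "gaussian_rv \<Omega> (\<lambda>\<omega>. \<Sum>i\<in>{t}. 1 * W i \<omega>)"
      using assms(3) that by (intro gp[unfolded gaussian_process_def, rule_format]) auto
    then show ?thesis by simp
  qed
  have meas: "W t \<in> borel_measurable \<Omega>" if "t \<in> S" for t
    using g1[OF that] by (simp add: gaussian_rv_def)
  have i1: "integrable \<Omega> (W t)" if "t \<in> S" for t
    using gaussian_rv_integrable[OF ps g1[OF that]] .
  have i2: "integrable \<Omega> (\<lambda>\<omega>. W t \<omega> * W u \<omega>)" if "t \<in> S" "u \<in> S" for t u
    using that by (intro integrable_mult_of_squares gaussian_rv_integrable_square[OF ps g1] meas)
  show "integral\<^sup>L \<Omega> X = 0"
    unfolding X_def using assms(1,3) i1
    by (subst Bochner_Integration.integral_sum) (auto simp: brownian_sheet_def subset_iff)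
  have "integral\<^sup>L \<Omega> (\<lambda>\<omega>. (X \<omega>)\<^sup>2) = integral\<^sup>L \<Omega> (\<lambda>\<omega>. \<Sum>t\<in>S. \<Sum>u\<in>S. (c t * c u) * (W t \<omega> * W u \<omega>))"
    unfolding X_def power2_eq_square sum_product
    by (intro Bochner_Integration.integral_cong sum.cong refl) (simp only: ac_simps)
  also have "\<dots> = (\<Sum>t\<in>S. \<Sum>u\<in>S. c t * c u * integral\<^sup>L \<Omega> (\<lambda>\<omega>. W t \<omega> * W u \<omega>))"
    using i2 by (simp add: Bochner_Integration.integral_sum Bochner_Integration.integrable_sum)
  also have "\<dots> = (\<Sum>t\<in>S. \<Sum>u\<in>S. c t * c u * (\<Prod>i\<in>UNIV. min (t $ i) (u $ i)))"
    using assms(1,3) by (intro sum.cong) (auto simp: brownian_sheet_def subset_iff)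
  finally show "integral\<^sup>L \<Omega> (\<lambda>\<omega>. (X \<omega>)\<^sup>2) = (LINT x:unit_cube|lborel. (s x)\<^sup>2)"
    unfolding s_def step_function_L2[OF assms(2,3)] .
qed

text \<open>Gaussianity of the limit \<open>X\<close> is bypassed: the tail bound holds for the step
  approximants, the remainder is small in L2, and \<open>k\<close> tends to infinity before
  \<open>e\<close> tends to 0.\<close>

lemma wiener_integral_upper_tail:
  fixes W :: "real ^ 'n \<Rightarrow> 'w \<Rightarrow> real"
  assumes bs: "brownian_sheet \<Omega> W" and wi: "is_wiener_integral \<Omega> W \<phi> X"
    and v: "(LINT x:unit_cube|lborel. (\<phi> x)\<^sup>2) \<le> v" "0 < v" and "0 < x"
  shows "measure \<Omega> {\<omega> \<in> space \<Omega>. x \<le> X \<omega>} \<le> exp (- x\<^sup>2 / (2 * v))"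
proof -
  interpret prob_space \<Omega> using bs by (simp add: brownian_sheet_def)
  obtain S :: "nat \<Rightarrow> (real ^ 'n) set" and c :: "nat \<Rightarrow> real ^ 'n \<Rightarrow> real" where
    S: "\<And>k. finite (S k)" "\<And>k. S k \<subseteq> unit_cube"
    and c1: "(\<lambda>k. LINT x:unit_cube|lborel.
        (\<phi> x - (\<Sum>t\<in>S k. c k t * indicator (cbox 0 t) x))\<^sup>2) \<longlonglongrightarrow> 0"
    and c2: "(\<lambda>k. LINT \<omega>|\<Omega>. (X \<omega> - (\<Sum>t\<in>S k. c k t * W t \<omega>))\<^sup>2) \<longlonglongrightarrow> 0"
    using wi unfolding is_wiener_integral_def by blast
  define s where "s k x = (\<Sum>t\<in>S k. c k t * indicator (cbox 0 t) x)" for k x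
  define Y where "Y k \<omega> = (\<Sum>t\<in>S k. c k t * W t \<omega>)" for k \<omega>
  have gY: "gaussian_rv \<Omega> (Y k)" and eY: "expectation (Y k) = 0"
    and vY: "expectation (\<lambda>\<omega>. (Y k \<omega>)\<^sup>2) = (LINT x:unit_cube|lborel. (s k x)\<^sup>2)" for k
    using brownian_sheet_step_gaussian[OF bs S, of "c k" k] brownian_sheet_step_mean[OF bs S, of "c k" k]
      brownian_sheet_step_isometry[OF bs S, of "c k" k]
    unfolding Y_def s_def by auto
  have [measurable]: "X \<in> borel_measurable \<Omega>" "Y k \<in> borel_measurable \<Omega>" for k
    using wi gY by (auto simp: is_wiener_integral_def gaussian_rv_def)
  have iX: "integrable \<Omega> (\<lambda>\<omega>. (X \<omega>)\<^sup>2)" using wi by (simp add: is_wiener_integral_def)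
  have iXY: "integrable \<Omega> (\<lambda>\<omega>. (X \<omega> - Y k \<omega>)\<^sup>2)" for k
    by (intro integrable_square_diff iX gaussian_rv_integrable_square[OF prob_space_axioms gY]) auto
  have phi: "integrable lborel (\<lambda>x. (indicator unit_cube x * \<phi> x)\<^sup>2)"
    "(\<lambda>x. indicator unit_cube x * \<phi> x) \<in> borel_measurable lborel"
  proof -
    have "(\<lambda>x. indicator unit_cube x *\<^sub>R (\<phi> x)\<^sup>2) = (\<lambda>x. (indicator unit_cube x * \<phi> x)\<^sup>2)"
      by (auto simp: indicator_def)
    then show "integrable lborel (\<lambda>x. (indicator unit_cube x * \<phi> x)\<^sup>2)"
      "(\<lambda>x. indicator unit_cube x * \<phi> x) \<in> borel_measurable lborel"
      using wi unfolding is_wiener_integral_def set_integrable_def set_borel_measurable_def by auto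
  qed
  have [measurable]: "s k \<in> borel_measurable borel" for k
    unfolding s_def by measurable
  have s2: "integrable lborel (\<lambda>x. (indicator unit_cube x * s k x)\<^sup>2)" for k
    using step_function_square_integrable[OF S(1), of "c k" k]
    unfolding set_integrable_def s_def
    by (rule back_subst[of "integrable lborel"]) (auto simp: indicator_def)
  have ieq: "(LINT x:unit_cube|lborel. (f x)\<^sup>2) = (\<integral>x. (indicator unit_cube x * f x)\<^sup>2 \<partial>lborel)" for f :: "real ^ 'n \<Rightarrow> real"
    unfolding set_lebesgue_integral_def by (intro Bochner_Integration.integral_cong) (auto simp: indicator_def)
  have d: "integrable lborel (\<lambda>x. (indicator unit_cube x * (\<phi> x - s k x))\<^sup>2)" for k
    using integrable_square_diff[OF phi(1) s2[of k] phi(2)] by (simp add: algebra_simps)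
  \<comment> \<open>Writing \<open>s k\<close> as \<open>\<phi>\<close> plus a remainder, the weight
    \<open>e\<close> keeps the variance of the approximant below \<open>(1 + e) * v\<close>, up to
    an error that vanishes as \<open>k\<close> grows.\<close>
  have bound: "(LINT x:unit_cube|lborel. (s k x)\<^sup>2) \<le> (1 + e) * v + 
     (1 + 1 / e) * (LINT x:unit_cube|lborel. (\<phi> x - s k x)\<^sup>2)" if "0 < e" for k e
  proof -
    have "(LINT x:unit_cube|lborel. (s k x)\<^sup>2) \<le> (\<integral>x. (1 + e) * (indicator unit_cube x * \<phi> x)\<^sup>2
        + (1 + 1 / e) * (indicator unit_cube x * (\<phi> x - s k x))\<^sup>2 \<partial>lborel)"
      unfolding ieq
    proof (intro integral_mono s2 Bochner_Integration.integrable_add integrable_mult_right phi d)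
      fix x :: "real ^ 'n"
      show "(indicator unit_cube x * s k x)\<^sup>2 \<le> (1 + e) * (indicator unit_cube x * \<phi> x)\<^sup>2
        + (1 + 1 / e) * (indicator unit_cube x * (\<phi> x - s k x))\<^sup>2"
        using square_add_le_weighted[OF that, of "\<phi> x" "s k x - \<phi> x"]
        by (cases "x \<in> unit_cube") (simp_all add: power2_commute)
    qed
    also have "\<dots> = (1 + e) * (LINT x:unit_cube|lborel. (\<phi> x)\<^sup>2) + (1 + 1 / e) * (LINT x:unit_cube|lborel. (\<phi> x - s k x)\<^sup>2)"
      unfolding ieq using phi d by simp
    finally show ?thesis using v(1) that by (simp add: mult_left_mono order_trans)
  qed
  have main: "prob {\<omega> \<in> space \<Omega>. x \<le> X \<omega>} \<le> exp (- ((1 - e) * x)\<^sup>2 / (2 * ((1 + 2 * e) * v)))"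
    if e: "0 < e" "e < 1" for e
  proof -
    have "(\<lambda>k. (1 + e) * v + (1 + 1 / e) * (LINT x:unit_cube|lborel. (\<phi> x - s k x)\<^sup>2)) \<longlonglongrightarrow> (1 + e) * v + (1 + 1 / e) * 0"
      using c1 unfolding s_def by (intro tendsto_intros)
    moreover have "(1 + e) * v + (1 + 1 / e) * 0 < (1 + 2 * e) * v" using e v by simp
    ultimately have ev: "eventually (\<lambda>k. (1 + e) * v + (1 + 1 / e) * (LINT x:unit_cube|lborel. (\<phi> x - s k x)\<^sup>2) < (1 + 2 * e) * v) sequentially"
      by (rule order_tendstoD(2))
    have lim: "(\<lambda>k. exp (- ((1 - e) * x)\<^sup>2 / (2 * ((1 + 2 * e) * v))) + expectation (\<lambda>\<omega>. (X \<omega> - Y k \<omega>)\<^sup>2) / (e * x)\<^sup>2)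
      \<longlonglongrightarrow> exp (- ((1 - e) * x)\<^sup>2 / (2 * ((1 + 2 * e) * v))) + 0 / (e * x)\<^sup>2"
      using c2 \<open>0 < x\<close> e unfolding Y_def by (intro tendsto_intros) auto
    have "eventually (\<lambda>k. prob {\<omega> \<in> space \<Omega>. x \<le> X \<omega>} \<le> exp (- ((1 - e) * x)\<^sup>2 / (2 * ((1 + 2 * e) * v)))
       + expectation (\<lambda>\<omega>. (X \<omega> - Y k \<omega>)\<^sup>2) / (e * x)\<^sup>2) sequentially"
      using ev
    proof eventually_elim
      case (elim k)
      \<comment> \<open>If \<open>X\<close> reaches x, then either the Gaussian approximant reaches
        \<open>(1 - e) * x\<close> or the remainder reaches \<open>e * x\<close>; Markov's
        inequality for the square controls the second event.\<close>
      have "prob {\<omega> \<in> space \<Omega>. x \<le> X \<omega>} \<le> prob ({\<omega> \<in> space \<Omega>. (1 - e) * x \<le> Y k \<omega>} \<union> {\<omega> \<in> space \<Omega>. (e * x)\<^sup>2 \<le> (X \<omega> - Y k \<omega>)\<^sup>2})"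
      proof (intro finite_measure_mono subsetI)
        fix \<omega> assume "\<omega> \<in> {\<omega> \<in> space \<Omega>. x \<le> X \<omega>}"
        moreover have "(e * x)\<^sup>2 \<le> (X \<omega> - Y k \<omega>)\<^sup>2" if "e * x \<le> X \<omega> - Y k \<omega>"
          using that e \<open>0 < x\<close> by (intro power_mono) auto
        moreover have "(1 - e) * x \<le> Y k \<omega> \<or> e * x \<le> X \<omega> - Y k \<omega>" if "x \<le> X \<omega>"
          using that by (auto simp: left_diff_distrib)
        ultimately show "\<omega> \<in> {\<omega> \<in> space \<Omega>. (1 - e) * x \<le> Y k \<omega>} \<union> {\<omega> \<in> space \<Omega>. (e * x)\<^sup>2 \<le> (X \<omega> - Y k \<omega>)\<^sup>2}"
          by blast
      qed measurable
      also have "\<dots> \<le> prob {\<omega> \<in> space \<Omega>. (1 - e) * x \<le> Y k \<omega>} + prob {\<omega> \<in> space \<Omega>. (e * x)\<^sup>2 \<le> (X \<omega> - Y k \<omega>)\<^sup>2}"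
        by (intro measure_Un_le) measurable
      also have "prob {\<omega> \<in> space \<Omega>. (1 - e) * x \<le> Y k \<omega>} \<le> exp (- ((1 - e) * x)\<^sup>2 / (2 * ((1 + 2 * e) * v)))"
        using gaussian_rv_upper_tail[OF prob_space_axioms gY eY, of k "(1 + 2 * e) * v" "(1 - e) * x"] 
          vY[of k] bound[OF e(1), of k] elim e v \<open>0 < x\<close> by auto
      also have "prob {\<omega> \<in> space \<Omega>. (e * x)\<^sup>2 \<le> (X \<omega> - Y k \<omega>)\<^sup>2} \<le> expectation (\<lambda>\<omega>. (X \<omega> - Y k \<omega>)\<^sup>2) / (e * x)\<^sup>2"
        using e \<open>0 < x\<close> iXY by (intro integral_Markov_inequality_measure[where A="{}"]) auto
      finally show ?case by simp
    qed
    then have "prob {\<omega> \<in> space \<Omega>. x \<le> X \<omega>} \<le> exp (- ((1 - e) * x)\<^sup>2 / (2 * ((1 + 2 * e) * v))) + 0 / (e * x)\<^sup>2"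
      by (intro tendsto_lowerbound[OF lim]) auto
    then show ?thesis by simp
  qed
  \<comment> \<open>Letting \<open>e\<close> decrease to 0 restores the exact exponent.\<close>
  have "((\<lambda>e. exp (- ((1 - e) * x)\<^sup>2 / (2 * ((1 + 2 * e) * v)))) \<longlongrightarrow> exp (- ((1 - 0) * x)\<^sup>2 / (2 * ((1 + 2 * 0) * v)))) (at_right 0)"
    using v by (intro tendsto_intros) auto
  moreover have "eventually (\<lambda>e. prob {\<omega> \<in> space \<Omega>. x \<le> X \<omega>} \<le> exp (- ((1 - e) * x)\<^sup>2 / (2 * ((1 + 2 * e) * v)))) (at_right 0)"
  proof (rule eventually_mono)
    show "eventually (\<lambda>e. e \<in> {0<..<1::real}) (at_right 0)" by (rule eventually_at_right_real) simp
  qed (use main in auto)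
  ultimately show ?thesis
    by (intro tendsto_lowerbound[where F="at_right (0::real)"]) auto
qed

lemma wiener_approx_diff:
  fixes f g f' g' :: "'a \<Rightarrow> real" 
  assumes "integrable M (\<lambda>x. (f x - g x)\<^sup>2)" "integrable M (\<lambda>x. (f' x - g' x)\<^sup>2)"
    and [measurable]: "f \<in> borel_measurable M" "f' \<in> borel_measurable M" "g \<in> borel_measurable M" "g' \<in> borel_measurable M"
  shows "(\<integral>x. ((a * f x - b * f' x) - (a * g x - b * g' x))\<^sup>2 \<partial>M)
    \<le> 2 * a\<^sup>2 * (\<integral>x. (f x - g x)\<^sup>2 \<partial>M) + 2 * b\<^sup>2 * (\<integral>x. (f' x - g' x)\<^sup>2 \<partial>M)"
proof -
  have pt: "((a * f x - b * f' x) - (a * g x - b * g' x))\<^sup>2 \<le> 2 * a\<^sup>2 * (f x - g x)\<^sup>2 + 2 * b\<^sup>2 * (f' x - g' x)\<^sup>2" for x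
  proof -
    have "(a * f x - b * f' x) - (a * g x - b * g' x) = a * (f x - g x) + (- b) * (f' x - g' x)"
      by (simp add: algebra_simps)
    then show ?thesis
      using square_add_le_weighted[of 1 "a * (f x - g x)" "(- b) * (f' x - g' x)"]
      by (simp add: power_mult_distrib)
  qed
  have "(\<integral>x. ((a * f x - b * f' x) - (a * g x - b * g' x))\<^sup>2 \<partial>M)
      \<le> (\<integral>x. 2 * a\<^sup>2 * (f x - g x)\<^sup>2 + 2 * b\<^sup>2 * (f' x - g' x)\<^sup>2 \<partial>M)"
  proof (rule integral_mono)
    show int: "integrable M (\<lambda>x. 2 * a\<^sup>2 * (f x - g x)\<^sup>2 + 2 * b\<^sup>2 * (f' x - g' x)\<^sup>2)"
      using assms by simp
    show "integrable M (\<lambda>x. ((a * f x - b * f' x) - (a * g x - b * g' x))\<^sup>2)"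
      by (rule Bochner_Integration.integrable_bound[OF int]) (auto intro!: AE_I2 order_trans[OF pt])
  qed (rule pt)
  then show ?thesis using assms by simp
qed

text \<open>Besides increments of the noise field, this provides scaling (\<open>b = 0\<close>) and
  negation (\<open>a = 0\<close>, \<open>b = 1\<close>).\<close>

lemma is_wiener_integral_diff:
  fixes W :: "real ^ 'n \<Rightarrow> 'w \<Rightarrow> real"
  assumes bs: "brownian_sheet \<Omega> W" and X: "is_wiener_integral \<Omega> W \<phi> X" and X': "is_wiener_integral \<Omega> W \<phi>' X'"
  shows "is_wiener_integral \<Omega> W (\<lambda>x. a * \<phi> x - b * \<phi>' x) (\<lambda>\<omega>. a * X \<omega> - b * X' \<omega>)"
proof -
  interpret prob_space \<Omega> using bs by (simp add: brownian_sheet_def)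
  let ?D = "\<lambda>c S (x :: real ^ 'n). \<Sum>t\<in>S. c t * indicator (cbox 0 t) x :: real"
  obtain S :: "nat \<Rightarrow> (real ^ 'n) set" and c where
    S: "\<And>k. finite (S k)" "\<And>k. S k \<subseteq> unit_cube"
    and c1: "(\<lambda>k. LINT x:unit_cube|lborel. (\<phi> x - ?D (c k) (S k) x)\<^sup>2) \<longlonglongrightarrow> 0"
    and c2: "(\<lambda>k. LINT \<omega>|\<Omega>. (X \<omega> - (\<Sum>t\<in>S k. c k t * W t \<omega>))\<^sup>2) \<longlonglongrightarrow> 0"
    using X unfolding is_wiener_integral_def by blast
  obtain S' :: "nat \<Rightarrow> (real ^ 'n) set" and c' where
    S': "\<And>k. finite (S' k)" "\<And>k. S' k \<subseteq> unit_cube"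
    and c1': "(\<lambda>k. LINT x:unit_cube|lborel. (\<phi>' x - ?D (c' k) (S' k) x)\<^sup>2) \<longlonglongrightarrow> 0"
    and c2': "(\<lambda>k. LINT \<omega>|\<Omega>. (X' \<omega> - (\<Sum>t\<in>S' k. c' k t * W t \<omega>))\<^sup>2) \<longlonglongrightarrow> 0"
    using X' unfolding is_wiener_integral_def by blast
  \<comment> \<open>Each family of coefficients is extended by 0 beyond its own nodes, so that both
    approximations live on the union of the two node sets.\<close>
  define C where "C k t = a * (if t \<in> S k then c k t else 0) - b * (if t \<in> S' k then c' k t else 0)" for k t
  have C: "(\<Sum>t\<in>S k \<union> S' k. C k t * f t) = a * (\<Sum>t\<in>S k. c k t * f t) - b * (\<Sum>t\<in>S' k. c' k t * f t)"
    for k and f :: "real ^ 'n \<Rightarrow> real"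
  proof -
    have "(\<Sum>t\<in>S k \<union> S' k. C k t * f t) = (\<Sum>t\<in>S k \<union> S' k. a * (if t \<in> S k then c k t * f t else 0))
       - (\<Sum>t\<in>S k \<union> S' k. b * (if t \<in> S' k then c' k t * f t else 0))"
      unfolding sum_subtractf[symmetric] C_def by (intro sum.cong) (auto simp: algebra_simps)
    also have "\<dots> = a * (\<Sum>t\<in>(S k \<union> S' k) \<inter> S k. c k t * f t) - b * (\<Sum>t\<in>(S k \<union> S' k) \<inter> S' k. c' k t * f t)"
      using S(1) S'(1) by (simp only: sum_distrib_left[symmetric] sum.inter_restrict[symmetric] finite_Un simp_thms)
    finally show ?thesis by (simp add: Int_absorb1 Int_commute)
  qed
  \<comment> \<open>With the restricted measure, set integrals over the cube become ordinary
    integrals, and \<open>wiener_approx_diff\<close> serves the kernels and the random variables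
    alike.\<close>
  define R where "R = restrict_space lborel (unit_cube :: (real ^ 'n) set)"
  have R: "set_borel_measurable lborel unit_cube f \<longleftrightarrow> f \<in> borel_measurable R"
    "set_integrable lborel unit_cube f \<longleftrightarrow> integrable R f"
    "(LINT x:unit_cube|lborel. f x) = integral\<^sup>L R f" for f :: "real ^ 'n \<Rightarrow> real"
    unfolding R_def set_borel_measurable_def set_lebesgue_integral_def set_integrable_def
    by (subst borel_measurable_restrict_space_iff integrable_restrict_space integral_restrict_space; simp)+
  have step: "integrable R (\<lambda>x. (?D d A x)\<^sup>2)" "?D d A \<in> borel_measurable R" if "finite A" for d A
    using step_function_square_integrable[OF that, of d] unfolding R
    by (auto simp: R_def intro!: measurable_restrict_space1)
  have phi: "\<phi> \<in> borel_measurable R" "integrable R (\<lambda>x. (\<phi> x)\<^sup>2)" "\<phi>' \<in> borel_measurable R" "integrable R (\<lambda>x. (\<phi>' x)\<^sup>2)"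
    using X X' unfolding is_wiener_integral_def R by auto
  have Xs: "X \<in> borel_measurable \<Omega>" "integrable \<Omega> (\<lambda>x. (X x)\<^sup>2)" "X' \<in> borel_measurable \<Omega>" "integrable \<Omega> (\<lambda>x. (X' x)\<^sup>2)"
    using X X' unfolding is_wiener_integral_def by auto
  have lin: "integrable M (\<lambda>x. (a * f x - b * g x)\<^sup>2)"
    if "integrable M (\<lambda>x. (f x)\<^sup>2)" "integrable M (\<lambda>x. (g x)\<^sup>2)" "f \<in> borel_measurable M" "g \<in> borel_measurable M"
    for M and f g :: "'a \<Rightarrow> real"
    using that by (intro integrable_square_diff) (auto simp: power_mult_distrib)
  have Ws: "(\<lambda>\<omega>. \<Sum>t\<in>A. d t * W t \<omega>) \<in> borel_measurable \<Omega>" "integrable \<Omega> (\<lambda>\<omega>. (\<Sum>t\<in>A. d t * W t \<omega>)\<^sup>2)"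
    if "finite A" "A \<subseteq> unit_cube" for A d
    using brownian_sheet_step_gaussian[OF bs that, of d] gaussian_rv_integrable_square[OF prob_space_axioms]
    by (auto simp: gaussian_rv_def)
  show ?thesis
    unfolding is_wiener_integral_def R
  proof (intro conjI exI)
    show "\<forall>k. finite (S k \<union> S' k) \<and> S k \<union> S' k \<subseteq> unit_cube"
      using S S' by auto
    have "(\<lambda>k. 2 * a\<^sup>2 * (\<integral>x. (\<phi> x - ?D (c k) (S k) x)\<^sup>2 \<partial>R) + 2 * b\<^sup>2 * (\<integral>x. (\<phi>' x - ?D (c' k) (S' k) x)\<^sup>2 \<partial>R)) \<longlonglongrightarrow> 2 * a\<^sup>2 * 0 + 2 * b\<^sup>2 * 0"
      using c1 c1' unfolding R by (intro tendsto_intros)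
    then have lim: "(\<lambda>k. 2 * a\<^sup>2 * (\<integral>x. (\<phi> x - ?D (c k) (S k) x)\<^sup>2 \<partial>R) + 2 * b\<^sup>2 * (\<integral>x. (\<phi>' x - ?D (c' k) (S' k) x)\<^sup>2 \<partial>R)) \<longlonglongrightarrow> 0"
      by simp
    show "(\<lambda>k. \<integral>x. (a * \<phi> x - b * \<phi>' x - ?D (C k) (S k \<union> S' k) x)\<^sup>2 \<partial>R) \<longlonglongrightarrow> 0"
      unfolding C
    proof (rule tendsto_sandwich[OF _ _ tendsto_const lim]; intro always_eventually allI)
      show "(\<integral>x. (a * \<phi> x - b * \<phi>' x - (a * ?D (c k) (S k) x - b * ?D (c' k) (S' k) x))\<^sup>2 \<partial>R)
        \<le> 2 * a\<^sup>2 * (\<integral>x. (\<phi> x - ?D (c k) (S k) x)\<^sup>2 \<partial>R) + 2 * b\<^sup>2 * (\<integral>x. (\<phi>' x - ?D (c' k) (S' k) x)\<^sup>2 \<partial>R)" for k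
        using phi step S S' by (intro wiener_approx_diff integrable_square_diff) auto
    qed simp
    have "(\<lambda>k. 2 * a\<^sup>2 * (\<integral>\<omega>. (X \<omega> - (\<Sum>t\<in>S k. c k t * W t \<omega>))\<^sup>2 \<partial>\<Omega>) + 2 * b\<^sup>2 * (\<integral>\<omega>. (X' \<omega> - (\<Sum>t\<in>S' k. c' k t * W t \<omega>))\<^sup>2 \<partial>\<Omega>)) \<longlonglongrightarrow> 2 * a\<^sup>2 * 0 + 2 * b\<^sup>2 * 0"
      using c2 c2' by (intro tendsto_intros)
    then have lim: "(\<lambda>k. 2 * a\<^sup>2 * (\<integral>\<omega>. (X \<omega> - (\<Sum>t\<in>S k. c k t * W t \<omega>))\<^sup>2 \<partial>\<Omega>) + 2 * b\<^sup>2 * (\<integral>\<omega>. (X' \<omega> - (\<Sum>t\<in>S' k. c' k t * W t \<omega>))\<^sup>2 \<partial>\<Omega>)) \<longlonglongrightarrow> 0"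
      by simp
    show "(\<lambda>k. \<integral>\<omega>. (a * X \<omega> - b * X' \<omega> - (\<Sum>t\<in>S k \<union> S' k. C k t * W t \<omega>))\<^sup>2 \<partial>\<Omega>) \<longlonglongrightarrow> 0"
      unfolding C
    proof (rule tendsto_sandwich[OF _ _ tendsto_const lim]; intro always_eventually allI)
      show "(\<integral>\<omega>. (a * X \<omega> - b * X' \<omega> - (a * (\<Sum>t\<in>S k. c k t * W t \<omega>) - b * (\<Sum>t\<in>S' k. c' k t * W t \<omega>)))\<^sup>2 \<partial>\<Omega>)
        \<le> 2 * a\<^sup>2 * (\<integral>\<omega>. (X \<omega> - (\<Sum>t\<in>S k. c k t * W t \<omega>))\<^sup>2 \<partial>\<Omega>) + 2 * b\<^sup>2 * (\<integral>\<omega>. (X' \<omega> - (\<Sum>t\<in>S' k. c' k t * W t \<omega>))\<^sup>2 \<partial>\<Omega>)" for k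
        using Xs Ws S S' by (intro wiener_approx_diff integrable_square_diff) auto
    qed simp
  qed (use phi Xs lin in auto)
qed

lemma wiener_integral_tail:
  fixes W :: "real ^ 'n \<Rightarrow> 'w \<Rightarrow> real"
  assumes bs: "brownian_sheet \<Omega> W" and wi: "is_wiener_integral \<Omega> W \<phi> X"
    and v: "(LINT x:unit_cube|lborel. (\<phi> x)\<^sup>2) \<le> v" "0 < v" and "0 < x"
  shows "measure \<Omega> {\<omega> \<in> space \<Omega>. x \<le> \<bar>X \<omega>\<bar>} \<le> 2 * exp (- x\<^sup>2 / (2 * v))"
proof -
  interpret prob_space \<Omega> using bs by (simp add: brownian_sheet_def)
  have wi': "is_wiener_integral \<Omega> W (\<lambda>x. - \<phi> x) (\<lambda>\<omega>. - X \<omega>)"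
    using is_wiener_integral_diff[OF bs wi wi, of 0 1] by simp
  have [measurable]: "X \<in> borel_measurable \<Omega>" using wi by (simp add: is_wiener_integral_def)
  have "{\<omega> \<in> space \<Omega>. x \<le> \<bar>X \<omega>\<bar>} = {\<omega> \<in> space \<Omega>. x \<le> X \<omega>} \<union> {\<omega> \<in> space \<Omega>. x \<le> - X \<omega>}"
    by auto
  then have "prob {\<omega> \<in> space \<Omega>. x \<le> \<bar>X \<omega>\<bar>} \<le> prob {\<omega> \<in> space \<Omega>. x \<le> X \<omega>} + prob {\<omega> \<in> space \<Omega>. x \<le> - X \<omega>}"
    by (simp add: measure_Un_le)
  also have "\<dots> \<le> exp (- x\<^sup>2 / (2 * v)) + exp (- x\<^sup>2 / (2 * v))"
    using v \<open>0 < x\<close> by (intro add_mono wiener_integral_upper_tail[OF bs wi] wiener_integral_upper_tail[OF bs wi']) auto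
  finally show ?thesis by simp
qed

section \<open>Chaining on a cube\<close>

lemma finite_bounded_funs:
  fixes n :: nat
  shows "finite {j :: 'p::finite \<Rightarrow> nat. \<forall>a. j a \<le> n}" "card {j :: 'p \<Rightarrow> nat. \<forall>a. j a \<le> n} = (n + 1) ^ CARD('p)"
proof -
  have eq: "{j :: 'p \<Rightarrow> nat. \<forall>a. j a \<le> n} = (\<Pi>\<^sub>E a\<in>UNIV. {..n})"
    by (auto simp: PiE_def Pi_def)
  show "finite {j :: 'p \<Rightarrow> nat. \<forall>a. j a \<le> n}" unfolding eq by (intro finite_PiE) auto
  show "card {j :: 'p \<Rightarrow> nat. \<forall>a. j a \<le> n} = (n + 1) ^ CARD('p)" unfolding eq by (subst card_PiE) auto
qed

lemma (in finite_measure) measure_UN_le_card: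
  fixes c :: real
  assumes "finite I" "\<And>i. i \<in> I \<Longrightarrow> A i \<in> sets M" "\<And>i. i \<in> I \<Longrightarrow> measure M (A i) \<le> c"
  shows "measure M (\<Union>i\<in>I. A i) \<le> card I * c"
proof -
  have "measure M (\<Union>i\<in>I. A i) \<le> (\<Sum>i\<in>I. measure M (A i))"
    using assms by (intro finite_measure_subadditive_finite) auto
  also have "\<dots> \<le> (\<Sum>i\<in>I. c)" by (intro sum_mono assms)
  finally show ?thesis by simp
qed

text \<open>The summands are the chaining thresholds up to a constant factor; the closed form shows
  that for nonnegative x and b the sums stay below \<open>x + 2 * b\<close>.\<close>

lemma sum_weighted_half_powers:
  "(\<Sum>l<i. x * (1/2) ^ Suc l + b * (real l + 1) * (1/2) ^ Suc l)
    = x * (1 - (1/2)^i) + b * (2 - (real i + 2) * (1/2)^i)" for x b :: real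
proof (induction i)
  case (Suc i)
  show ?case
    unfolding sum.lessThan_Suc Suc.IH by (simp add: field_simps)
qed simp

text \<open>
  Starting from a grid of mesh about \<open>1 / x\<^sup>2\<close> makes the chaining increments add up to
  only \<open>O(1 / x)\<close>, at the price of a polynomial factor, so that the exponent keeps its constant.
\<close>

lemma chaining_bound:
  fixes G :: "real ^ 'p \<Rightarrow> 'w \<Rightarrow> real"
  assumes "prob_space M"
    and meas: "\<And>w. w \<in> cbox 0 1 \<Longrightarrow> G w \<in> borel_measurable M"
    and cont: "\<And>\<omega>. \<omega> \<in> space M \<Longrightarrow> continuous_on (cbox 0 1) (\<lambda>w. G w \<omega>)"
    and tail: "\<And>w x. w \<in> cbox 0 1 \<Longrightarrow> 0 < x \<Longrightarrow> measure M {\<omega> \<in> space M. x \<le> \<bar>G w \<omega>\<bar>} \<le> 2 * exp (- x\<^sup>2 / 2)"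
    and incr: "\<And>w w' \<delta> x. w \<in> cbox 0 1 \<Longrightarrow> w' \<in> cbox 0 1 \<Longrightarrow> (\<And>i. \<bar>w $ i - w' $ i\<bar> \<le> \<delta>) \<Longrightarrow> 0 < \<delta> \<Longrightarrow> 0 < x
      \<Longrightarrow> measure M {\<omega> \<in> space M. C * \<delta> * x \<le> \<bar>G w \<omega> - G w' \<omega>\<bar>} \<le> 2 * exp (- x\<^sup>2 / 2)"
    and "0 < C" "1 \<le> x"
  shows "\<exists>B\<in>sets M. measure M B \<le> 4 * (4 * x\<^sup>2) ^ CARD('p) * exp (- x\<^sup>2 / 2) \<and>
    (\<forall>\<omega>\<in>space M - B. \<forall>w\<in>cbox 0 1. \<bar>G w \<omega>\<bar> \<le> x + C * (2 * real CARD('p) + 3) / x)"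
proof -
  interpret prob_space M by fact
  let ?p = "CARD('p)"
  \<comment> \<open>The initial mesh \<open>1 / N\<close> is fine enough for the increments to be of
    order \<open>1 / x\<close>, and coarse enough for the number of initial points to be polynomial
    in x.\<close>
  define N where "N = nat \<lceil>x\<^sup>2\<rceil>"
  have x2: "1 \<le> x\<^sup>2" using \<open>1 \<le> x\<close> by simp
  have N: "x\<^sup>2 \<le> real N" "real N \<le> 2 * x\<^sup>2" "1 \<le> N"
    using x2 unfolding N_def by linarith+
  define J where "J i = {j :: 'p \<Rightarrow> nat. \<forall>a. j a \<le> N * 2 ^ i}" for i
  define P :: "nat \<Rightarrow> ('p \<Rightarrow> nat) \<Rightarrow> real ^ 'p" where "P i j = (\<chi> a. real (j a) / (N * 2 ^ i))" for i j
  have finJ: "finite (J i)" for i unfolding J_def by (rule finite_bounded_funs)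
  have cardJ: "real (card (J i)) \<le> (4 * x\<^sup>2) ^ ?p * 2 ^ (i * ?p)" for i
  proof -
    have "real (N * 2 ^ i + 1) \<le> 2 * (real N * 2 ^ i)" using N(3) 
      by (simp add: mult_ge1_I)
    also have "\<dots> \<le> 2 * (2 * x\<^sup>2 * 2 ^ i)" using N by (intro mult_left_mono mult_right_mono) auto
    finally have "real (N * 2 ^ i + 1) ^ ?p \<le> (4 * x\<^sup>2 * 2 ^ i) ^ ?p"
      by (intro power_mono) auto
    then show ?thesis unfolding J_def finite_bounded_funs(2) by (simp add: power_mult_distrib power_mult)
  qed
  have PJ: "P i j \<in> cbox 0 1" if "j \<in> J i" for i j
  proof -
    have "real (j a) \<le> real N * 2 ^ i" for a
    proof -
      have "real (j a) \<le> real (N * 2 ^ i)"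
        using that unfolding J_def by (intro of_nat_mono) simp
      then show ?thesis by simp
    qed
    then show ?thesis using N(3) unfolding P_def by (auto simp: mem_box_cart divide_simps)
  qed
  \<comment> \<open>Halving the index rounds a point of level \<open>i + 1\<close> down to the grid
    of level \<open>i\<close>; in each coordinate this moves it by at most one step of the finer
    grid.\<close>
  define par where "par j = (\<lambda>a. j a div 2)" for j :: "'p \<Rightarrow> nat"
  have par: "par j \<in> J i" if "j \<in> J (Suc i)" for i j
  proof -
    have "j a div 2 \<le> N * 2 ^ i" for a
    proof -
      have "j a \<le> N * 2 ^ i * 2" using that by (auto simp: J_def mult_ac)
      then have "j a div 2 \<le> N * 2 ^ i * 2 div 2" by (rule div_le_mono)
      then show ?thesis by simp
    qed
    then show ?thesis by (auto simp: J_def par_def)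
  qed
  \<comment> \<open>The slope of \<open>y l\<close> is chosen such that
    \<open>exp (- (y l)^2 / 2)\<close> gains a factor \<open>exp (- b * (l + 1))\<close>. Of the
    \<open>p + 1\<close> units in \<open>b\<close>, where p is the dimension, p pay for the refined
    grid with its extra factor \<open>2 ^ ((l + 1) * p)\<close>, and the last one makes the sum over
    levels geometric.\<close>
  define b where "b = real ?p + 1"
  define y where "y l = x + b * (real l + 1)" for l :: nat
  define \<delta> where "\<delta> l = 1 / (real N * 2 ^ Suc l)" for l
  define thr where "thr l = C * \<delta> l * y l" for l
  have ypos: "0 < y l" for l unfolding y_def b_def using \<open>1 \<le> x\<close> by (auto intro!: add_pos_nonneg)
  have dpos: "0 < \<delta> l" for l unfolding \<delta>_def using N(3) by simp
  have near: "\<bar>P (Suc l) j $ a - P l (par j) $ a\<bar> \<le> \<delta> l" for l j a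
  proof -
    have "real (j a) = real (2 * (j a div 2) + j a mod 2)" by simp
    then have "real (j a) = 2 * real (j a div 2) + real (j a mod 2)"
      by (simp only: of_nat_add of_nat_mult of_nat_numeral)
    then have "P (Suc l) j $ a - P l (par j) $ a = real (j a mod 2) * \<delta> l"
      using N(3) unfolding P_def par_def \<delta>_def by (simp add: field_simps)
    moreover have "real (j a mod 2) \<le> 1" by linarith
    moreover have "0 \<le> \<delta> l" using dpos[of l] by simp
    ultimately show ?thesis by (simp add: abs_mult mult_left_le_one_le)
  qed
  define B0 where "B0 = (\<Union>j\<in>J 0. {\<omega> \<in> space M. x \<le> \<bar>G (P 0 j) \<omega>\<bar>})"
  define Bl where "Bl l = (\<Union>j\<in>J (Suc l). {\<omega> \<in> space M. thr l \<le> \<bar>G (P (Suc l) j) \<omega> - G (P l (par j)) \<omega>\<bar>})" for l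
  let ?q = "2 * ((4 * x\<^sup>2) ^ ?p * exp (- x\<^sup>2 / 2))"
  have ms0: "{\<omega> \<in> space M. x \<le> \<bar>G (P 0 j) \<omega>\<bar>} \<in> sets M" if "j \<in> J 0" for j
  proof -
    have [measurable]: "G (P 0 j) \<in> borel_measurable M" using meas PJ that by simp
    show ?thesis by measurable
  qed
  have ms1: "{\<omega> \<in> space M. thr l \<le> \<bar>G (P (Suc l) j) \<omega> - G (P l (par j)) \<omega>\<bar>} \<in> sets M" if "j \<in> J (Suc l)" for j l
  proof -
    have [measurable]: "G (P (Suc l) j) \<in> borel_measurable M" "G (P l (par j)) \<in> borel_measurable M"
      using meas PJ par that by simp_all
    show ?thesis by measurable
  qed
  have [measurable]: "B0 \<in> sets M" "Bl l \<in> sets M" for l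
    unfolding B0_def Bl_def using finJ ms0 ms1 by (auto intro!: sets.finite_UN)
  have B0: "prob B0 \<le> ?q"
  proof -
    have "prob B0 \<le> card (J 0) * (2 * exp (- x\<^sup>2 / 2))"
      unfolding B0_def using finJ ms0 PJ \<open>1 \<le> x\<close> by (intro measure_UN_le_card tail) auto
    also have "\<dots> \<le> (4 * x\<^sup>2) ^ ?p * (2 * exp (- x\<^sup>2 / 2))"
      using cardJ[of 0] by (intro mult_right_mono) auto
    finally show ?thesis by simp
  qed
  have Bl: "prob (Bl l) \<le> ?q * (1/2) ^ Suc l" for l
  proof -
    have "prob (Bl l) \<le> card (J (Suc l)) * (2 * exp (- (y l)\<^sup>2 / 2))"
      unfolding Bl_def 
    proof (intro measure_UN_le_card finJ ms1)
      fix j assume j: "j \<in> J (Suc l)"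
      show "prob {\<omega> \<in> space M. thr l \<le> \<bar>G (P (Suc l) j) \<omega> - G (P l (par j)) \<omega>\<bar>} \<le> 2 * exp (- (y l)\<^sup>2 / 2)"
        unfolding thr_def by (intro incr PJ[OF j] PJ[OF par[OF j]] near dpos ypos)
    qed
    also have "\<dots> \<le> (4 * x\<^sup>2) ^ ?p * 2 ^ (Suc l * ?p) * (2 * exp (- (y l)\<^sup>2 / 2))"
      using cardJ[of "Suc l"] by (intro mult_right_mono) auto
    also have "\<dots> \<le> (4 * x\<^sup>2) ^ ?p * exp (Suc l * ?p) * (2 * (exp (- x\<^sup>2 / 2) * exp (- real (Suc l * ?p)) * (1/2) ^ Suc l))"
    proof (intro mult_mono order_refl)
      have two: "(2::real) \<le> exp 1" using exp_ge_add_one_self[of 1] by simp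
      then have "(2::real) ^ (Suc l * ?p) \<le> exp 1 ^ (Suc l * ?p)" by (intro power_mono) auto
      then show "(2::real) ^ (Suc l * ?p) \<le> exp (Suc l * ?p)" 
        using exp_of_nat_mult[of "Suc l * ?p" "1::real"] by simp
      have "exp (- 1 :: real) \<le> 1/2" using two by (simp add: exp_minus field_simps)
      then have "exp (- 1 :: real) ^ Suc l \<le> (1/2) ^ Suc l" by (intro power_mono) auto
      then have h: "exp (- real (Suc l)) \<le> (1/2) ^ Suc l"
        using exp_of_nat_mult[of "Suc l" "- 1 :: real"] by simp
      have "1 * (b * (real l + 1)) \<le> x * (b * (real l + 1))"
        using \<open>1 \<le> x\<close> by (intro mult_right_mono) (auto simp: b_def)
      moreover have "0 \<le> (b * (real l + 1))\<^sup>2" by simp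
      ultimately have "x\<^sup>2 + 2 * (b * (real l + 1)) \<le> x\<^sup>2 + 2 * x * (b * (real l + 1)) + (b * (real l + 1))\<^sup>2"
        by linarith
      also have "\<dots> = (y l)\<^sup>2" unfolding y_def by (simp add: power2_sum)
      finally have "- (y l)\<^sup>2 / 2 \<le> - x\<^sup>2 / 2 + - b * (real l + 1)" by simp
      also have "\<dots> = - x\<^sup>2 / 2 + - real (Suc l * ?p) + - real (Suc l)"
        unfolding b_def by (simp add: algebra_simps)
      finally have "exp (- (y l)\<^sup>2 / 2) \<le> exp (- x\<^sup>2 / 2) * exp (- real (Suc l * ?p)) * exp (- real (Suc l))"
        by (simp only: exp_add[symmetric] exp_le_cancel_iff)
      also have "\<dots> \<le> exp (- x\<^sup>2 / 2) * exp (- real (Suc l * ?p)) * (1/2) ^ Suc l"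
        by (intro mult_left_mono h) auto
      finally show "exp (- (y l)\<^sup>2 / 2) \<le> exp (- x\<^sup>2 / 2) * exp (- real (Suc l * ?p)) * (1/2) ^ Suc l" .
    qed auto
    also have "\<dots> = ?q * (1/2) ^ Suc l * (exp (Suc l * ?p) * exp (- real (Suc l * ?p)))"
      by (simp only: ac_simps)
    also have "exp (real (Suc l * ?p)) * exp (- real (Suc l * ?p)) = 1"
      by (simp only: exp_add[symmetric] add.right_inverse exp_zero)
    finally show ?thesis by simp
  qed
  have BU: "prob (\<Union>l. Bl l) \<le> ?q"
  proof -
    \<comment> \<open>The weights of the levels add up to 1, so all refinements together cost as
      much as the initial grid; this turns the factor 2 of a single tail into 4.\<close>
    have s: "(\<lambda>l. ?q * (1/2) ^ Suc l) sums ?q" 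
      using sums_mult[OF power_half_series, of ?q] by simp
    have sm: "summable (\<lambda>l. prob (Bl l))"
      using Bl by (intro summable_comparison_test'[OF sums_summable[OF s], of 0]) auto
    have "prob (\<Union>l. Bl l) \<le> (\<Sum>l. prob (Bl l))"
      by (intro finite_measure_subadditive_countably sm) auto
    also have "\<dots> \<le> (\<Sum>l. ?q * (1/2) ^ Suc l)"
      by (intro suminf_le Bl sm sums_summable[OF s])
    finally show ?thesis using sums_unique[OF s] by simp
  qed
  show ?thesis
  proof (intro bexI conjI ballI)
    show "B0 \<union> (\<Union>l. Bl l) \<in> sets M" by measurable
    have "prob (B0 \<union> (\<Union>l. Bl l)) \<le> prob B0 + prob (\<Union>l. Bl l)" by (intro measure_Un_le) measurable
    then show "prob (B0 \<union> (\<Union>l. Bl l)) \<le> 4 * (4 * x\<^sup>2) ^ ?p * exp (- x\<^sup>2 / 2)"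
      using B0 BU by simp
    fix \<omega> and w :: "real ^ 'p" assume w: "w \<in> cbox 0 1" and \<omega>: "\<omega> \<in> space M - (B0 \<union> (\<Union>l. Bl l))"
    \<comment> \<open>Rounding \<open>w\<close> down at every level yields a chain of grid points:
      taking floors commutes with halving, so the parent of each point is its predecessor.\<close>
    define j where "j i = (\<lambda>a. nat \<lfloor>real N * 2 ^ i * w $ a\<rfloor>)" for i
    have w01: "0 \<le> w $ a" "w $ a \<le> 1" for a using w by (auto simp: mem_box_cart)
    have jJ: "j i \<in> J i" for i
    proof -
      have "nat \<lfloor>real N * 2 ^ i * w $ a\<rfloor> \<le> N * 2 ^ i" for a
      proof -
        have "real N * 2 ^ i * w $ a \<le> real (N * 2 ^ i)" using w01[of a] by (simp add: mult_left_le)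
        then show ?thesis by linarith
      qed
      then show ?thesis by (simp add: J_def j_def)
    qed
    have jpar: "par (j (Suc i)) = j i" for i
    proof (rule ext)
      fix a
      have "\<lfloor>(real N * 2 ^ Suc i * w $ a) / real_of_int 2\<rfloor> = \<lfloor>real N * 2 ^ Suc i * w $ a\<rfloor> div 2"
        by (rule floor_divide_real_eq_div) simp
      then have "\<lfloor>real N * 2 ^ i * w $ a\<rfloor> = \<lfloor>real N * 2 ^ Suc i * w $ a\<rfloor> div 2" by (simp add: mult.assoc)
      then show "par (j (Suc i)) a = j i a"
        unfolding par_def j_def using nat_div_distrib'[of 2 "\<lfloor>real N * 2 ^ Suc i * w $ a\<rfloor>"] by simp
    qed
    have bd: "\<bar>G (P i (j i)) \<omega>\<bar> \<le> x + (\<Sum>l<i. thr l)" for i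
    proof (induction i)
      case 0
      have "\<omega> \<notin> B0" "\<omega> \<in> space M" using \<omega> by auto
      then show ?case using jJ[of 0] unfolding B0_def by auto
    next
      case (Suc i)
      have "\<omega> \<notin> Bl i" "\<omega> \<in> space M" using \<omega> by auto
      then have "\<bar>G (P (Suc i) (j (Suc i))) \<omega> - G (P i (j i)) \<omega>\<bar> < thr i"
        using jJ[of "Suc i"] jpar[of i] unfolding Bl_def by force
      then show ?case using Suc by simp
    qed
    \<comment> \<open>The sum of the levels \<open>y l\<close> with geometric weights is of order x,
      and \<open>1 / N \<le> 1 / x^2\<close> reduces it to order \<open>1 / x\<close>. The constant
      is \<open>1 + 2 * b\<close>.\<close>
    have thr: "(\<Sum>l<i. thr l) \<le> C * (2 * real ?p + 3) / x" for i
    proof -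
      have "(\<Sum>l<i. thr l) = C / N * (\<Sum>l<i. x * (1/2) ^ Suc l + b * (real l + 1) * (1/2) ^ Suc l)"
        unfolding sum_distrib_left thr_def \<delta>_def y_def using N(3)
        by (intro sum.cong refl) (simp add: field_simps power_one_over)
      also have "\<dots> \<le> C / N * (x + b * 2)"
        unfolding sum_weighted_half_powers using \<open>0 < C\<close> \<open>1 \<le> x\<close>
        by (intro mult_left_mono add_mono) (auto simp: b_def mult_left_le)
      also have "\<dots> \<le> C / x\<^sup>2 * (x + b * 2)"
        using \<open>0 < C\<close> \<open>1 \<le> x\<close> N by (intro mult_right_mono divide_left_mono) (auto simp: b_def)
      also have "\<dots> \<le> C / x\<^sup>2 * (x + b * 2 * x)"
        using \<open>0 < C\<close> \<open>1 \<le> x\<close> by (intro mult_left_mono add_left_mono) (auto simp: b_def mult_left_le)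
      also have "\<dots> = C * (2 * real ?p + 3) / x"
        using \<open>1 \<le> x\<close> by (simp add: b_def field_simps power2_eq_square)
      finally show ?thesis .
    qed
    have "(\<lambda>i. P i (j i)) \<longlonglongrightarrow> w"
    proof (rule vec_tendstoI)
      fix a
      have "(\<lambda>i. 1 / real N * (1/2)^i) \<longlonglongrightarrow> 1 / real N * 0"
        by (intro tendsto_intros LIMSEQ_realpow_zero) auto
      then have z: "(\<lambda>i. 1 / real N * (1/2)^i) \<longlonglongrightarrow> 0" by simp
      have "\<bar>P i (j i) $ a - w $ a\<bar> \<le> 1 / real N * (1/2)^i" for i
      proof -
        let ?u = "real N * 2 ^ i * w $ a"
        have "0 \<le> ?u" using w01[of a] by simp
        then have "\<bar>real (nat \<lfloor>?u\<rfloor>) - ?u\<bar> \<le> 1" by linarith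
        then have "\<bar>real (nat \<lfloor>?u\<rfloor>) - ?u\<bar> / (real N * 2 ^ i) \<le> 1 / (real N * 2 ^ i)"
          by (intro divide_right_mono) auto
        moreover have "w $ a = ?u / (real N * 2 ^ i)" using N(3) by simp
        then have "P i (j i) $ a - w $ a = (real (nat \<lfloor>?u\<rfloor>) - ?u) / (real N * 2 ^ i)"
          unfolding diff_divide_distrib by (simp add: P_def j_def)
        ultimately show ?thesis by (simp add: power_one_over abs_mult)
      qed
      then have "(\<lambda>i. P i (j i) $ a - w $ a) \<longlonglongrightarrow> 0"
        by (intro Lim_null_comparison[OF _ z]) auto
      then show "(\<lambda>i. P i (j i) $ a) \<longlonglongrightarrow> w $ a" by (simp add: LIM_zero_iff)
    qed
    \<comment> \<open>The exceptional set controls only grid points; path continuity carries the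
      bound to every \<open>w\<close>.\<close>
    then have "(\<lambda>i. G (P i (j i)) \<omega>) \<longlonglongrightarrow> G w \<omega>"
      using cont[of \<omega>] \<omega> w PJ[OF jJ] by (auto simp: continuous_on_sequentially comp_def)
    then have "(\<lambda>i. \<bar>G (P i (j i)) \<omega>\<bar>) \<longlonglongrightarrow> \<bar>G w \<omega>\<bar>" by (rule tendsto_rabs)
    then show "\<bar>G w \<omega>\<bar> \<le> x + C * (2 * real ?p + 3) / x"
    proof (rule LIMSEQ_le_const2, intro exI allI impI)
      show "\<bar>G (P i (j i)) \<omega>\<bar> \<le> x + C * (2 * real ?p + 3) / x" for i
        using bd[of i] thr[of i] by linarith
    qed
  qed
qed

section \<open>The noise statistic\<close>

lemma wiener_version_tail:
  fixes W :: "real ^ 'n \<Rightarrow> 'w \<Rightarrow> real"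
  assumes bs: "brownian_sheet \<Omega> W" and cw: "continuous_wiener_version \<Omega> W (psi 1) Z"
    and h: "h \<in> bandwidths" "t \<in> locations h" and "0 < x"
  shows "measure \<Omega> {\<omega> \<in> space \<Omega>. x \<le> \<bar>scale_norm h * Z t h \<omega>\<bar>} \<le> 2 * exp (- x\<^sup>2 / 2)"
proof -
  have wi: "is_wiener_integral \<Omega> W (rescale (psi 1) t h) (Z t h)"
    using cw h by (simp add: continuous_wiener_version_def)
  have "(LINT x:unit_cube|lborel. (scale_norm h * rescale (psi 1) t h x)\<^sup>2)
      = (scale_norm h)\<^sup>2 * (LINT x:unit_cube|lborel. (rescale (psi 1) t h x)\<^sup>2)"
    unfolding power_mult_distrib by simp
  \<comment> \<open>Subtracting 0 times the same integral puts the scaled integral into the form of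
    \<open>is_wiener_integral_diff\<close>.\<close>
  then have v: "(LINT x:unit_cube|lborel. (scale_norm h * rescale (psi 1) t h x - 0 * rescale (psi 1) t h x)\<^sup>2) \<le> 1"
    using scale_norm_square[OF h(1)] by (simp add: set_lebesgue_integral_rescale_square[OF h])
  show ?thesis
    using wiener_integral_tail[OF bs is_wiener_integral_diff[OF bs wi wi] v _ \<open>0 < x\<close>] by simp
qed

lemma wiener_version_increment_tail:
  fixes W :: "real ^ 'n \<Rightarrow> 'w \<Rightarrow> real"
  assumes bs: "brownian_sheet \<Omega> W" and cw: "continuous_wiener_version \<Omega> W (psi 1) Z"
    and h: "h \<in> bandwidths" "h' \<in> bandwidths" "\<And>i. \<eta> i \<le> h $ i" "\<And>i. h $ i \<le> 2 * \<eta> i" "\<And>i. \<eta> i \<le> h' $ i" "\<And>i. h' $ i \<le> 2 * \<eta> i"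
    and t: "t \<in> locations h" "t' \<in> locations h'"
    and eta: "\<And>i. 0 < \<eta> i"
    and dh: "\<And>i. \<bar>h $ i - h' $ i\<bar> \<le> \<delta> * \<eta> i" and dt: "\<And>i. \<bar>t $ i - t' $ i\<bar> \<le> 5 * \<delta> * \<eta> i"
    and "0 < \<delta>" "0 < x"
  shows "measure \<Omega> {\<omega> \<in> space \<Omega>. chaining_const TYPE('n) * \<delta> * x \<le> \<bar>scale_norm h * Z t h \<omega> - scale_norm h' * Z t' h' \<omega>\<bar>}
    \<le> 2 * exp (- x\<^sup>2 / 2)"
proof -
  let ?c = "chaining_const TYPE('n) * \<delta>"
  have wi: "is_wiener_integral \<Omega> W (rescale (psi 1) t h) (Z t h)" "is_wiener_integral \<Omega> W (rescale (psi 1) t' h') (Z t' h')"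
    using cw h t by (simp_all add: continuous_wiener_version_def)
  have c: "0 < ?c" using chaining_const_pos[where 'n='n] \<open>0 < \<delta>\<close> by simp
  have "measure \<Omega> {\<omega> \<in> space \<Omega>. ?c * x \<le> \<bar>scale_norm h * Z t h \<omega> - scale_norm h' * Z t' h' \<omega>\<bar>}
    \<le> 2 * exp (- (?c * x)\<^sup>2 / (2 * ?c\<^sup>2))"
    using c \<open>0 < x\<close>
    by (intro wiener_integral_tail[OF bs is_wiener_integral_diff[OF bs wi]]
        rescale_psi_normalized_L2_diff[OF h t eta dh dt]) auto
  also have "- (?c * x)\<^sup>2 / (2 * ?c\<^sup>2) = - x\<^sup>2 / 2"
    using \<open>0 < \<delta>\<close> chaining_const_pos[where 'n='n] by (simp add: power_mult_distrib)
  finally show ?thesis .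
qed

section \<open>Dyadic cells of bandwidths and locations\<close>

text \<open>
  Pairs of a location and a bandwidth are grouped into cells indexed by a dyadic scale \<open>k\<close> and a
  position \<open>j\<close> in each coordinate. A cell is parametrised by a unit cube, with the relative position
  \<open>(t - h) / (1 - 2 * h)\<close> of the left end of the window in place of \<open>t\<close>, so that
  every parameter is admissible.
\<close>

definition cell_bandwidth :: "('n \<Rightarrow> nat) \<Rightarrow> real ^ ('n::finite + 'n) \<Rightarrow> real ^ 'n"
  where "cell_bandwidth k w = (\<chi> i. (1 + w $ Inr i) * ((1/2) ^ k i / 4))"

text \<open>The \<open>Inr\<close> coordinates carry the bandwidth, the \<open>Inl\<close>
  coordinates the relative position. Both use the dyadic scale \<open>k i\<close>, so that crossing
  a cell moves the location by at most a fixed multiple of the bandwidth.\<close>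

definition cell_location :: "('n \<Rightarrow> nat) \<Rightarrow> ('n \<Rightarrow> nat) \<Rightarrow> real ^ ('n::finite + 'n) \<Rightarrow> real ^ 'n"
  where "cell_location k j w = (\<chi> i. cell_bandwidth k w $ i
    + (real (j i) + w $ Inl i) * (1/2) ^ k i * (1 - 2 * cell_bandwidth k w $ i))"

lemma cell_bandwidth_bounds:
  assumes "w \<in> cbox 0 1"
  shows "((1/2) ^ k i / 4) \<le> cell_bandwidth k w $ i" "cell_bandwidth k w $ i \<le> 2 * ((1/2) ^ k i / 4)"
    "cell_bandwidth k w $ i \<le> 1 / 2"
proof -
  have w: "0 \<le> w $ Inr i" "w $ Inr i \<le> 1" using assms by (auto simp: mem_box_cart)
  show "((1/2) ^ k i / 4) \<le> cell_bandwidth k w $ i" 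
    unfolding cell_bandwidth_def using w by (simp add: mult_ge1_I)
  show *: "cell_bandwidth k w $ i \<le> 2 * ((1/2) ^ k i / 4)"
    unfolding cell_bandwidth_def using w by simp
  have "(1/2 :: real) ^ k i \<le> 1" by (intro power_le_one) auto
  then show "cell_bandwidth k w $ i \<le> 1 / 2" using * by simp
qed

lemma cell_bandwidth_in:
  assumes "w \<in> cbox 0 1"
  shows "cell_bandwidth k w \<in> bandwidths"
proof -
  have "0 < (1/2 :: real) ^ k i / 4" for i by simp
  then have "0 < cell_bandwidth k w $ i" for i
    using cell_bandwidth_bounds(1)[OF assms, of k i] by (rule less_le_trans)
  then show ?thesis using cell_bandwidth_bounds(3)[OF assms, of k] by (simp add: bandwidths_def)
qed

lemma relative_position_bounds:
  fixes a :: nat and u :: real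
  assumes "a < 2 ^ k" "0 \<le> u" "u \<le> 1"
  shows "0 \<le> (real a + u) * (1/2) ^ k" "(real a + u) * (1/2) ^ k \<le> 1"
proof -
  have "real (Suc a) \<le> real (2 ^ k)" using assms(1) by (intro of_nat_mono) simp
  then have "real a + 1 \<le> 2 ^ k" by simp
  then show "0 \<le> (real a + u) * (1/2) ^ k" "(real a + u) * (1/2) ^ k \<le> 1"
    using assms by (auto simp: power_one_over divide_simps)
qed

lemma cell_location_in:
  assumes w: "w \<in> cbox 0 1" and j: "\<And>i. j i < 2 ^ k i"
  shows "cell_location k j w \<in> locations (cell_bandwidth k w)"
proof -
  have "cell_bandwidth k w $ i \<le> cell_location k j w $ i \<and> cell_location k j w $ i \<le> 1 - cell_bandwidth k w $ i" for i
  proof -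
    let ?h = "cell_bandwidth k w $ i" and ?s = "(real (j i) + w $ Inl i) * (1/2) ^ k i"
    have "0 \<le> ?s" "?s \<le> 1" using relative_position_bounds[OF j] w by (auto simp: mem_box_cart)
    moreover have "0 \<le> a * b \<and> a * b \<le> b" if "0 \<le> a" "a \<le> 1" "0 \<le> b" for a b :: real
      using that by (simp add: mult_left_le_one_le)
    ultimately have "0 \<le> ?s * (1 - 2 * ?h)" "?s * (1 - 2 * ?h) \<le> 1 - 2 * ?h"
      using cell_bandwidth_bounds(3)[OF w, of k i] by auto
    then show ?thesis unfolding cell_location_def by simp
  qed
  then show ?thesis by (simp add: locations_def)
qed

text \<open>For \<open>h + s * (1 - 2 * h)\<close> the difference splits into
  \<open>(h - h') * (1 - 2 * s')\<close> and \<open>(s - s') * (1 - 2 * h)\<close>, whose second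
  factors have modulus at most 1. With \<open>(1/2) ^ k i / 4\<close> as unit, the bandwidth
  contributes 1 and the relative position 4, which gives the 5.\<close>

lemma cell_increments:
  assumes w: "w \<in> cbox 0 1" "w' \<in> cbox 0 1" and j: "\<And>i. j i < 2 ^ k i" and d: "\<And>i. \<bar>w $ i - w' $ i\<bar> \<le> \<delta>"
  shows "\<bar>cell_bandwidth k w $ i - cell_bandwidth k w' $ i\<bar> \<le> \<delta> * ((1/2) ^ k i / 4)"
    and "\<bar>cell_location k j w $ i - cell_location k j w' $ i\<bar> \<le> 5 * \<delta> * ((1/2) ^ k i / 4)"
proof -
  let ?e = "((1/2 :: real) ^ k i / 4)"
  let ?h = "cell_bandwidth k w $ i" and ?s = "(real (j i) + w $ Inl i) * (1/2) ^ k i"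
  let ?h' = "cell_bandwidth k w' $ i" and ?s' = "(real (j i) + w' $ Inl i) * (1/2) ^ k i"
  have "?h - ?h' = (w $ Inr i - w' $ Inr i) * ?e" 
    unfolding cell_bandwidth_def by (simp add: field_simps)
  then show dh: "\<bar>?h - ?h'\<bar> \<le> \<delta> * ?e"
    using d[of "Inr i"] by (simp only: abs_mult) (simp add: mult_right_mono)
  have "?s - ?s' = (w $ Inl i - w' $ Inl i) * (4 * ?e)" by (simp add: field_simps)
  then have ds: "\<bar>?s - ?s'\<bar> \<le> \<delta> * (4 * ?e)"
    using d[of "Inl i"] by (simp only: abs_mult) (simp add: mult_right_mono)
  have "\<bar>1 - 2 * ?s'\<bar> \<le> 1" using relative_position_bounds[OF j, of "w' $ Inl i"] w by (auto simp: mem_box_cart abs_le_iff)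
  moreover have "\<bar>1 - 2 * ?h\<bar> \<le> 1" using cell_bandwidth_bounds[OF w(1), of k i] zero_less_power[of "1/2::real" "k i"] by (simp add: abs_le_iff)
  moreover have "\<bar>a * b\<bar> \<le> c" if "\<bar>a\<bar> \<le> c" "\<bar>b\<bar> \<le> 1" for a b c :: real
    using mult_mono[OF that] that by (simp add: abs_mult)
  ultimately have b: "\<bar>(?h - ?h') * (1 - 2 * ?s')\<bar> \<le> \<delta> * ?e" "\<bar>(?s - ?s') * (1 - 2 * ?h)\<bar> \<le> \<delta> * (4 * ?e)"
    using dh ds by blast+
  have "cell_location k j w $ i - cell_location k j w' $ i = (?h - ?h') * (1 - 2 * ?s') + (?s - ?s') * (1 - 2 * ?h)"
    unfolding cell_location_def by (simp add: algebra_simps)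
  then have "\<bar>cell_location k j w $ i - cell_location k j w' $ i\<bar> \<le> \<delta> * ?e + \<delta> * (4 * ?e)"
    using order_trans[OF abs_triangle_ineq add_mono[OF b]] by (simp only:)
  then show "\<bar>cell_location k j w $ i - cell_location k j w' $ i\<bar> \<le> 5 * \<delta> * ?e"
    by (simp add: field_simps)
qed

lemma continuous_cell:
  "continuous_on A (cell_bandwidth k)" "continuous_on A (cell_location k j)"
  unfolding cell_location_def[abs_def] cell_bandwidth_def[abs_def] by (auto intro!: continuous_intros)

text \<open>Chaining takes place in dimension \<open>2 * d\<close>, and its increment constant is
  the same for all cells. This uniformity permits a union bound over cells of all scales.\<close>

lemma cell_bound:
  fixes W :: "real ^ 'n \<Rightarrow> 'w \<Rightarrow> real"
  assumes bs: "brownian_sheet \<Omega> W" and cw: "continuous_wiener_version \<Omega> W (psi 1) Z"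
    and j: "\<And>i. j i < 2 ^ k i" and x: "1 \<le> x"
  shows "\<exists>B\<in>sets \<Omega>. measure \<Omega> B \<le> 4 * (4 * x\<^sup>2) ^ CARD('n + 'n) * exp (- x\<^sup>2 / 2) \<and>
    (\<forall>\<omega>\<in>space \<Omega> - B. \<forall>w\<in>cbox 0 1. \<bar>scale_norm (cell_bandwidth k w) * Z (cell_location k j w) (cell_bandwidth k w) \<omega>\<bar>
      \<le> x + chaining_const TYPE('n) * (2 * real CARD('n + 'n) + 3) / x)"
proof (rule chaining_bound)
  show "prob_space \<Omega>" using bs by (simp add: brownian_sheet_def)
  fix w :: "real ^ ('n + 'n)" assume w: "w \<in> cbox 0 1"
  have "is_wiener_integral \<Omega> W (rescale (psi 1) (cell_location k j w) (cell_bandwidth k w)) (Z (cell_location k j w) (cell_bandwidth k w))"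
    using cw cell_location_in[OF w j] cell_bandwidth_in[OF w] by (simp add: continuous_wiener_version_def)
  then show "(\<lambda>\<omega>. scale_norm (cell_bandwidth k w) * Z (cell_location k j w) (cell_bandwidth k w) \<omega>) \<in> borel_measurable \<Omega>"
    unfolding is_wiener_integral_def by auto
  show "measure \<Omega> {\<omega> \<in> space \<Omega>. y \<le> \<bar>scale_norm (cell_bandwidth k w) * Z (cell_location k j w) (cell_bandwidth k w) \<omega>\<bar>}
     \<le> 2 * exp (- y\<^sup>2 / 2)" if "0 < y" for y
    by (rule wiener_version_tail[OF bs cw cell_bandwidth_in[OF w] cell_location_in[OF w j] that])
  fix w' :: "real ^ ('n + 'n)" and \<delta> y :: real
  assume w': "w' \<in> cbox 0 1" and d: "\<And>i. \<bar>w $ i - w' $ i\<bar> \<le> \<delta>" and p: "0 < \<delta>" "0 < y"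
  show "measure \<Omega> {\<omega> \<in> space \<Omega>. chaining_const TYPE('n) * \<delta> * y \<le>
      \<bar>scale_norm (cell_bandwidth k w) * Z (cell_location k j w) (cell_bandwidth k w) \<omega> -
       scale_norm (cell_bandwidth k w') * Z (cell_location k j w') (cell_bandwidth k w') \<omega>\<bar>} \<le> 2 * exp (- y\<^sup>2 / 2)"
    by (rule wiener_version_increment_tail[where \<eta>="\<lambda>i. (1/2) ^ k i / 4", OF bs cw])
      (use w w' j d p in \<open>auto intro!: cell_bandwidth_in cell_location_in cell_bandwidth_bounds[simplified] cell_increments[simplified]\<close>)
next
  fix \<omega> assume "\<omega> \<in> space \<Omega>"
  then have Z: "continuous_on {(t, h). h \<in> bandwidths \<and> t \<in> locations h} (\<lambda>(t, h). Z t h \<omega>)"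
    using cw by (simp add: continuous_wiener_version_def)
  have "continuous_on (cbox 0 1) (\<lambda>w. (\<lambda>(t, h). Z t h \<omega>) (cell_location k j w, cell_bandwidth k w))"
    using cell_bandwidth_in cell_location_in[OF _ j]
    by (intro continuous_on_compose2[OF Z] continuous_on_Pair continuous_cell) auto
  moreover have "continuous_on (cbox 0 1) (\<lambda>w. scale_norm (cell_bandwidth k w))"
    unfolding scale_norm_def
  proof (intro continuous_intros continuous_cell ballI)
    fix w :: "real ^ ('n + 'n)" assume "w \<in> cbox 0 1"
    then show "(\<Prod>i\<in>UNIV. cell_bandwidth k w $ i) \<noteq> 0"
      using cell_bandwidth_in[of w k] by (simp add: bandwidths_def less_imp_neq[symmetric])
  qed
  ultimately show "continuous_on (cbox 0 1) (\<lambda>w. scale_norm (cell_bandwidth k w) * Z (cell_location k j w) (cell_bandwidth k w) \<omega>)"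
    by (auto intro: continuous_on_mult)
qed (use x chaining_const_pos in auto)

section \<open>Covering of the admissible pairs by cells, and the number of cells\<close>

lemma dyadic_scale:
  fixes h :: real
  assumes "0 < h" "h \<le> 1/2"
  shows "\<exists>k v. 0 \<le> v \<and> v \<le> 1 \<and> h = (1 + v) * ((1/2) ^ k / 4)"
proof -
  have ex: "\<exists>n. (1/2) ^ (n + 2) \<le> h"
  proof -
    obtain n where "(1/2 :: real) ^ n < h" using real_arch_pow_inv[OF assms(1), of "1/2"] by auto
    moreover have "(1/2 :: real) ^ (n + 2) \<le> (1/2) ^ n" by (intro power_decreasing) auto
    ultimately show ?thesis by (metis less_imp_le order_trans)
  qed
  define k where "k = (LEAST n. (1/2) ^ (n + 2) \<le> h)"
  have lo: "(1/2) ^ (k + 2) \<le> h" unfolding k_def using ex by (rule LeastI_ex)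
  \<comment> \<open>Minimality of \<open>k\<close> excludes the next larger scale; for
    \<open>k = 0\<close> the bound is the assumption \<open>h \<le> 1/2\<close>.\<close>
  have hi: "h \<le> 2 * (1/2) ^ (k + 2)"
  proof (cases k)
    case (Suc l)
    have "\<not> (1/2) ^ (l + 2) \<le> h" using not_less_Least[of l "\<lambda>n. (1/2) ^ (n + 2) \<le> h"] Suc unfolding k_def by simp
    then show ?thesis using Suc by simp
  qed (use assms in \<open>simp add: power2_eq_square\<close>)
  define v where "v = h * (2 ^ k * 4) - 1"
  have "h = (1 + v) * ((1/2) ^ k / 4)" unfolding v_def by (simp add: power_one_over)
  moreover have "0 \<le> v" "v \<le> 1" using lo hi unfolding v_def by (auto simp: power_one_over field_simps)
  ultimately show ?thesis by blast
qed

lemma dyadic_position: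
  fixes s :: real
  assumes "0 \<le> s" "s \<le> 1"
  shows "\<exists>j u. j < 2 ^ k \<and> 0 \<le> u \<and> u \<le> 1 \<and> s = (real j + u) * (1/2) ^ k"
proof (cases "s = 1")
  \<comment> \<open>Rounding down would give the index \<open>2 ^ k\<close>, one too many; the point
    1 is taken as the right end of the last interval instead.\<close>
  case True
  then have "(2::nat) ^ k - 1 < 2 ^ k \<and> 0 \<le> (1::real) \<and> (1::real) \<le> 1 \<and> s = (real (2 ^ k - 1) + 1) * (1/2) ^ k"
    by (simp add: of_nat_diff power_one_over)
  then show ?thesis by blast
next
  case False
  define y where "y = s * 2 ^ k"
  have y: "0 \<le> y" "y < 2 ^ k" unfolding y_def using assms False by auto
  have "real (nat \<lfloor>y\<rfloor>) \<le> y" "y - real (nat \<lfloor>y\<rfloor>) \<le> 1" using y(1) by linarith+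
  moreover from this(1) have "real (nat \<lfloor>y\<rfloor>) < 2 ^ k" using y(2) by (rule le_less_trans)
  then have "real (nat \<lfloor>y\<rfloor>) < real (2 ^ k)" by (simp only: of_nat_power of_nat_numeral)
  then have "nat \<lfloor>y\<rfloor> < 2 ^ k" by (simp only: of_nat_less_iff)
  moreover have "s = (real (nat \<lfloor>y\<rfloor>) + (y - real (nat \<lfloor>y\<rfloor>))) * (1/2) ^ k"
    unfolding y_def by (simp add: power_one_over)
  ultimately show ?thesis by (intro exI[of _ "nat \<lfloor>y\<rfloor>"] exI[of _ "y - real (nat \<lfloor>y\<rfloor>)"]) auto
qed

lemma cells_cover:
  fixes t h :: "real ^ 'n"
  assumes "h \<in> bandwidths" "t \<in> locations h"
  obtains k j w where "w \<in> cbox 0 1" "\<And>i. j i < 2 ^ k i" "h = cell_bandwidth k w" "t = cell_location k j w"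
proof -
  have "\<forall>i. \<exists>k v. 0 \<le> v \<and> v \<le> 1 \<and> h $ i = (1 + v) * ((1/2) ^ k / 4)"
    using assms(1) by (intro allI dyadic_scale) (auto simp: bandwidths_def)
  then obtain k v where v: "\<And>i. 0 \<le> v i" "\<And>i. v i \<le> 1" "\<And>i. h $ i = (1 + v i) * ((1/2) ^ k i / 4)" by metis
  \<comment> \<open>At \<open>h $ i = 1/2\<close> the only admissible location is
    \<open>1/2\<close>; the relative position would be \<open>0 / 0\<close> and is set to 0.\<close>
  define s where "s i = (if h $ i = 1/2 then 0 else (t $ i - h $ i) / (1 - 2 * h $ i))" for i
  have b: "h $ i \<le> t $ i" "t $ i \<le> 1 - h $ i" "h $ i \<le> 1/2" for i using assms by (auto simp: bandwidths_def locations_def)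
  have s: "0 \<le> s i" "s i \<le> 1" "t $ i = h $ i + s i * (1 - 2 * h $ i)" for i
  proof -
    consider "h $ i = 1/2" | "0 < 1 - 2 * h $ i" using b(3)[of i] by linarith
    then show "0 \<le> s i" "s i \<le> 1" "t $ i = h $ i + s i * (1 - 2 * h $ i)"
      using b[of i] unfolding s_def by (cases; simp add: divide_le_eq)+
  qed
  have "\<forall>i. \<exists>j u. j < 2 ^ k i \<and> 0 \<le> u \<and> u \<le> 1 \<and> s i = (real j + u) * (1/2) ^ k i"
    using s by (intro allI dyadic_position)
  then obtain j u where u: "\<And>i. j i < 2 ^ k i" "\<And>i. 0 \<le> u i" "\<And>i. u i \<le> 1" "\<And>i. s i = (real (j i) + u i) * (1/2) ^ k i"
    by metis
  define w :: "real ^ ('n + 'n)" where "w = (\<chi> i. case i of Inl i \<Rightarrow> u i | Inr i \<Rightarrow> v i)"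
  have w: "w \<in> cbox 0 1" unfolding w_def using u v by (auto simp: mem_box_cart split: sum.split)
  have h: "h = cell_bandwidth k w" unfolding cell_bandwidth_def w_def by (simp add: vec_eq_iff v)
  have "t = cell_location k j w" unfolding cell_location_def h[symmetric]
    unfolding w_def by (simp add: vec_eq_iff s(3) u(4))
  with w u(1) h show thesis by (rule that)
qed

lemma finite_scales:
  "finite {k :: 'n::finite \<Rightarrow> nat. sum k UNIV = m}" "card {k :: 'n \<Rightarrow> nat. sum k UNIV = m} \<le> (m + 1) ^ CARD('n)"
proof -
  have sub: "{k :: 'n \<Rightarrow> nat. sum k UNIV = m} \<subseteq> {k. \<forall>i. k i \<le> m}"
    by (auto intro: member_le_sum)
  show "finite {k :: 'n \<Rightarrow> nat. sum k UNIV = m}" by (rule finite_subset[OF sub finite_bounded_funs(1)])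
  show "card {k :: 'n \<Rightarrow> nat. sum k UNIV = m} \<le> (m + 1) ^ CARD('n)"
    using card_mono[OF finite_bounded_funs(1) sub] by (simp add: finite_bounded_funs(2))
qed

text \<open>Cells are grouped by the sum of their scales because it determines the volume up to a
  factor \<open>2 ^ d\<close>, and thereby the correction terms. There are at most
  \<open>(m + 1) ^ d\<close> shapes \<open>k\<close>, each with exactly \<open>2 ^ m\<close>
  positions \<open>j\<close>.\<close>

definition cell_indices :: "nat \<Rightarrow> (('n::finite \<Rightarrow> nat) \<times> ('n \<Rightarrow> nat)) set"
  where "cell_indices m = (SIGMA k : {k. sum k UNIV = m}. {j. \<forall>i. j i < 2 ^ k i})"

lemma cell_indices:
  "finite (cell_indices m :: (('n::finite \<Rightarrow> nat) \<times> ('n \<Rightarrow> nat)) set)"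
  "card (cell_indices m :: (('n \<Rightarrow> nat) \<times> ('n \<Rightarrow> nat)) set) \<le> (m + 1) ^ CARD('n) * 2 ^ m"
proof -
  have eq: "{j :: 'n \<Rightarrow> nat. \<forall>i. j i < 2 ^ k i} = (\<Pi>\<^sub>E i\<in>UNIV. {..<2 ^ k i})" for k :: "'n \<Rightarrow> nat"
    by (auto simp: PiE_def Pi_def)
  have fin: "finite {j :: 'n \<Rightarrow> nat. \<forall>i. j i < 2 ^ k i}" for k :: "'n \<Rightarrow> nat"
    unfolding eq by (intro finite_PiE) auto
  have card: "card {j :: 'n \<Rightarrow> nat. \<forall>i. j i < 2 ^ k i} = 2 ^ sum k UNIV" for k :: "'n \<Rightarrow> nat"
    unfolding eq by (subst card_PiE) (auto simp: power_sum)
  show "finite (cell_indices m :: (('n \<Rightarrow> nat) \<times> ('n \<Rightarrow> nat)) set)"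
    unfolding cell_indices_def by (intro finite_SigmaI finite_scales fin)
  have "card (cell_indices m :: (('n \<Rightarrow> nat) \<times> ('n \<Rightarrow> nat)) set) = (\<Sum>k | sum k UNIV = m. card {j :: 'n \<Rightarrow> nat. \<forall>i. j i < 2 ^ k i})"
    unfolding cell_indices_def by (intro card_SigmaI ballI finite_scales fin)
  also have "\<dots> = (\<Sum>k | sum (k :: 'n \<Rightarrow> nat) UNIV = m. 2 ^ m)"
    by (intro sum.cong) (auto simp: card)
  also have "\<dots> \<le> (m + 1) ^ CARD('n) * 2 ^ m"
    using finite_scales(2)[of m, where 'n='n] by simp
  finally show "card (cell_indices m :: (('n \<Rightarrow> nat) \<times> ('n \<Rightarrow> nat)) set) \<le> (m + 1) ^ CARD('n) * 2 ^ m" .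
qed

lemma cell_volume_bounds:
  fixes k :: "'n::finite \<Rightarrow> nat"
  assumes w: "w \<in> cbox 0 1"
  defines "r \<equiv> 2 ^ CARD('n) * (\<Prod>i\<in>UNIV. cell_bandwidth k w $ i)"
  shows "(1/2) ^ (sum k UNIV + CARD('n)) \<le> r" "r \<le> (1/2) ^ sum k UNIV"
proof -
  have r: "r = (\<Prod>i\<in>UNIV. 2 * cell_bandwidth k w $ i)"
    unfolding r_def by (simp add: prod.distrib)
  have "(1/2 :: real) ^ (sum k UNIV + CARD('n)) = (\<Prod>i\<in>UNIV. 2 * ((1/2) ^ k i / 4))"
    by (simp add: power_add power_sum prod_dividef power_one_over prod.distrib)
  also have "\<dots> \<le> r"
    unfolding r using cell_bandwidth_bounds(1)[OF w, of k] by (intro prod_mono) (auto simp: mult.commute)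
  finally show "(1/2) ^ (sum k UNIV + CARD('n)) \<le> r" .
  have "0 < cell_bandwidth k w $ i" for i
    using cell_bandwidth_in[OF w] by (simp add: bandwidths_def)
  then have "r \<le> (\<Prod>i\<in>UNIV. 2 * (2 * ((1/2) ^ k i / 4)))"
    unfolding r using cell_bandwidth_bounds(2)[OF w, of k] by (intro prod_mono) (auto simp: less_imp_le mult.commute)
  also have "\<dots> = (1/2) ^ sum k UNIV" by (simp add: power_sum)
  finally show "r \<le> (1/2) ^ sum k UNIV" .
qed

text \<open>
  The logarithmic term pays for the number of shapes of a given volume and for the polynomial
  factor in the chaining bound; the free parameter \<open>c\<close> makes the union bound small.
\<close>

definition threshold :: "real \<Rightarrow> nat \<Rightarrow> nat \<Rightarrow> real"
  where "threshold K c m = sqrt (2 * (real m * ln 2 + K * ln (real (m + c))))"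

lemma ln2_ge_half: "1 / 2 \<le> ln (2 :: real)"
  using ln_le_minus_one[of "1/2 :: real"] by (simp add: ln_div)

lemma ln_ge_1: "3 \<le> x \<Longrightarrow> 1 \<le> ln (x :: real)"
proof -
  assume "3 \<le> x"
  moreover have "exp 1 \<le> (3 :: real)" by (rule exp_le)
  ultimately show ?thesis by (subst ln_ge_iff) auto
qed

text \<open>The last equation is the purpose of the definition: the tail at the threshold cancels
  the \<open>2 ^ m\<close> positions and leaves a power of \<open>m + c\<close>. The linear upper
  bound on the square controls the polynomial factor of the chaining bound, the linear lower bound
  the reciprocal of the threshold.\<close>

lemma threshold_square:
  assumes "1 \<le> K" "3 \<le> c"
  shows "(threshold K c m)\<^sup>2 = 2 * (real m * ln 2 + K * ln (real (m + c)))"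
    and "real m + 2 \<le> (threshold K c m)\<^sup>2"
    and "1 \<le> threshold K c m"
    and "(threshold K c m)\<^sup>2 \<le> 2 * (1 + K) * real (m + c)"
    and "exp (- (threshold K c m)\<^sup>2 / 2) = (1/2) ^ m * real (m + c) powr (- K)"
proof -
  have l: "1 \<le> ln (real (m + c))" using assms by (intro ln_ge_1) simp
  then have Kl: "1 \<le> K * ln (real (m + c))" using mult_mono[OF assms(1) l] assms(1) by simp
  have ml: "real m * (1/2) \<le> real m * ln 2" using ln2_ge_half by (intro mult_left_mono) auto
  then show sq: "(threshold K c m)\<^sup>2 = 2 * (real m * ln 2 + K * ln (real (m + c)))"
    unfolding threshold_def using Kl by (intro real_sqrt_pow2) auto
  show ge: "real m + 2 \<le> (threshold K c m)\<^sup>2" unfolding sq using Kl ml by simp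
  have "0 \<le> threshold K c m" unfolding threshold_def using Kl ml by simp
  moreover have "1\<^sup>2 \<le> (threshold K c m)\<^sup>2" using ge by simp
  ultimately show "1 \<le> threshold K c m" using power2_le_imp_le by blast
  have "ln (real (m + c)) \<le> real (m + c)" using assms ln_le_minus_one[of "real (m + c)"] by simp
  then have "K * ln (real (m + c)) \<le> K * real (m + c)" using assms by (intro mult_left_mono) auto
  moreover have "real m * ln 2 \<le> real m * 1" using ln_le_minus_one[of "2 :: real"] by (intro mult_left_mono) auto
  ultimately show "(threshold K c m)\<^sup>2 \<le> 2 * (1 + K) * real (m + c)"
    unfolding sq by (simp add: algebra_simps)
  have "exp (- (threshold K c m)\<^sup>2 / 2) = exp (- (real m * ln 2)) * exp (- K * ln (real (m + c)))"
    unfolding sq by (simp add: exp_add[symmetric])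
  also have "exp (- (real m * ln 2)) = (1/2) ^ m"
    by (simp add: exp_minus exp_of_nat_mult power_one_over inverse_eq_divide)
  finally show "exp (- (threshold K c m)\<^sup>2 / 2) = (1/2) ^ m * real (m + c) powr (- K)"
    using assms by (simp add: powr_def)
qed

text \<open>The value of \<open>K\<close> is a budget for powers of \<open>m + c\<close>:
  \<open>d\<close> for the shapes, \<open>2 * d\<close> for the polynomial factor of chaining in
  dimension \<open>2 * d\<close>, and 2 more to make the series over m converge.\<close>

lemma noise_bound_outside_small_set:
  fixes W :: "real ^ 'n \<Rightarrow> 'w \<Rightarrow> real"
  assumes bs: "brownian_sheet \<Omega> W" and cw: "continuous_wiener_version \<Omega> W (psi 1) Z" and "0 < \<alpha>"
  defines "K \<equiv> real (CARD('n + 'n) + CARD('n) + 2)"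
  shows "\<exists>c\<ge>3. \<exists>B\<in>sets \<Omega>. measure \<Omega> B \<le> \<alpha> \<and> (\<forall>\<omega>\<in>space \<Omega> - B. \<forall>h\<in>bandwidths. \<forall>t\<in>locations h.
    \<exists>m. (1/2) ^ (m + CARD('n)) \<le> 2 ^ CARD('n) * (\<Prod>i\<in>UNIV. h $ i) \<and> 2 ^ CARD('n) * (\<Prod>i\<in>UNIV. h $ i) \<le> (1/2) ^ m \<and>
      \<bar>scale_norm h * Z t h \<omega>\<bar> \<le> threshold K c m + chaining_const TYPE('n) * (2 * real CARD('n + 'n) + 3) / threshold K c m)"
proof -
  interpret prob_space \<Omega> using bs by (simp add: brownian_sheet_def)
  let ?p = "CARD('n + 'n)" and ?d = "CARD('n)"
  let ?E = "chaining_const TYPE('n) * (2 * real ?p + 3)"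
  define Q where "Q = 4 * (8 * (1 + K)) ^ ?p"
  have K: "1 \<le> K" by (simp add: K_def)
  have "0 < Q" unfolding Q_def using K by simp
  have sQ: "summable (\<lambda>n. Q * (1 / real n ^ 2))"
    using inverse_power_summable[of 2, where 'a=real] by (intro summable_mult) (simp add: inverse_eq_divide)
  from suminf_exist_split[OF \<open>0 < \<alpha>\<close> this]
  obtain N where N: "\<And>n. n \<ge> N \<Longrightarrow> norm (\<Sum>i. Q * (1 / real (i + n) ^ 2)) < \<alpha>" by auto
  \<comment> \<open>Raising \<open>c\<close> moves the series to a tail with sum below \<alpha>; the
    summand 3 ensures \<open>ln (m + c) \<ge> 1\<close>.\<close>
  define c where "c = N + 3"
  have c3: "3 \<le> c" by (simp add: c_def)
  define x where "x m = threshold K c m" for m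
  note x = threshold_square[OF K c3, folded x_def]
  define q where "q m = Q * (1 / real (m + c) ^ 2)" for m
  have sq: "summable q"
    unfolding q_def[abs_def] by (rule summable_ignore_initial_segment[OF sQ])
  have "\<bar>\<Sum>m. q m\<bar> < \<alpha>" using N[of c] unfolding q_def c_def by simp
  then have qsum: "(\<Sum>m. q m) \<le> \<alpha>" by linarith
  have "\<exists>B\<in>sets \<Omega>. prob B \<le> 4 * (4 * (x m)\<^sup>2) ^ ?p * exp (- (x m)\<^sup>2 / 2) \<and>
    (\<forall>\<omega>\<in>space \<Omega> - B. \<forall>w\<in>cbox 0 1. \<bar>scale_norm (cell_bandwidth k w) * Z (cell_location k j w) (cell_bandwidth k w) \<omega>\<bar>
      \<le> x m + ?E / x m)" if "(k, j) \<in> cell_indices m" for m k j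
    using that x(3) by (intro cell_bound[OF bs cw]) (auto simp: cell_indices_def)
  then have "\<forall>m k j. \<exists>B. (k, j) \<in> cell_indices m \<longrightarrow> B\<in>sets \<Omega> \<and> prob B \<le> 4 * (4 * (x m)\<^sup>2) ^ ?p * exp (- (x m)\<^sup>2 / 2) \<and>
    (\<forall>\<omega>\<in>space \<Omega> - B. \<forall>w\<in>cbox 0 1. \<bar>scale_norm (cell_bandwidth k w) * Z (cell_location k j w) (cell_bandwidth k w) \<omega>\<bar>
      \<le> x m + ?E / x m)" by blast
  then obtain B where B: "\<And>m k j. (k, j) \<in> cell_indices m \<Longrightarrow> B m k j \<in> sets \<Omega>"
    "\<And>m k j. (k, j) \<in> cell_indices m \<Longrightarrow> prob (B m k j) \<le> 4 * (4 * (x m)\<^sup>2) ^ ?p * exp (- (x m)\<^sup>2 / 2)"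
    "\<And>m k j \<omega> w. (k, j) \<in> cell_indices m \<Longrightarrow> \<omega> \<in> space \<Omega> - B m k j \<Longrightarrow> w \<in> cbox 0 1 \<Longrightarrow>
      \<bar>scale_norm (cell_bandwidth k w) * Z (cell_location k j w) (cell_bandwidth k w) \<omega>\<bar> \<le> x m + ?E / x m"
    by metis
  define U where "U m = (\<Union>(k, j)\<in>cell_indices m. B m k j)" for m
  have Us: "U m \<in> sets \<Omega>" for m
    unfolding U_def using B(1) by (intro sets.finite_UN cell_indices) auto
  have PU: "prob (U m) \<le> q m" for m
  proof -
    let ?y = "real (m + c)"
    have y: "1 \<le> ?y" using c3 by simp
    have "prob (U m) \<le> card (cell_indices m :: (('n \<Rightarrow> nat) \<times> ('n \<Rightarrow> nat)) set) * (4 * (4 * (x m)\<^sup>2) ^ ?p * exp (- (x m)\<^sup>2 / 2))"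
      unfolding U_def using B(1,2) by (intro measure_UN_le_card cell_indices) auto
    also have "\<dots> \<le> (?y ^ ?d * 2 ^ m) * (4 * (8 * (1 + K) * ?y) ^ ?p * ((1/2) ^ m * ?y powr (- K)))"
      unfolding x(5)
    proof (rule mult_mono)
      have "real (card (cell_indices m :: (('n \<Rightarrow> nat) \<times> ('n \<Rightarrow> nat)) set)) \<le> real ((m + 1) ^ ?d * 2 ^ m)"
        by (intro of_nat_mono cell_indices)
      also have "\<dots> = real (m + 1) ^ ?d * 2 ^ m" by simp
      also have "\<dots> \<le> ?y ^ ?d * 2 ^ m" using c3 by (intro mult_right_mono power_mono) auto
      finally show "real (card (cell_indices m :: (('n \<Rightarrow> nat) \<times> ('n \<Rightarrow> nat)) set)) \<le> ?y ^ ?d * 2 ^ m" .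
      have "4 * (x m)\<^sup>2 \<le> 8 * (1 + K) * ?y" using x(4)[of m] unfolding mult.assoc by linarith
      then have "(4 * (x m)\<^sup>2) ^ ?p \<le> (8 * (1 + K) * ?y) ^ ?p" by (intro power_mono) auto
      then show "4 * (4 * (x m)\<^sup>2) ^ ?p * ((1/2) ^ m * ?y powr (- K)) \<le> 4 * (8 * (1 + K) * ?y) ^ ?p * ((1/2) ^ m * ?y powr (- K))"
        by (intro mult_right_mono mult_left_mono) auto
    qed auto
    \<comment> \<open>The number of positions cancels exactly against the tail, and the remaining
      powers of \<open>m + c\<close> combine to the exponent -2.\<close>
    also have "\<dots> = 4 * (8 * (1 + K)) ^ ?p * (?y ^ ?d * ?y ^ ?p * ?y powr (- K)) * (2 ^ m * (1/2) ^ m)"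
      by (simp only: power_mult_distrib ac_simps)
    also have "(2 ^ m * (1/2) ^ m :: real) = 1" by (simp add: power_one_over)
    also have "?y ^ ?d * ?y ^ ?p * ?y powr (- K) = ?y powr (- 2)"
    proof -
      have "?y ^ ?d * ?y ^ ?p * ?y powr (- K) = ?y powr (real ?d + real ?p + (- K))"
        using y by (simp only: powr_realpow[symmetric] powr_add)
      then show ?thesis by (simp add: K_def)
    qed
    also have "?y powr (- 2) = 1 / ?y ^ 2"
      using y by (simp add: powr_minus_divide)
    finally show ?thesis unfolding q_def Q_def by simp
  qed
  have su: "summable (\<lambda>m. prob (U m))"
    using PU by (intro summable_comparison_test'[OF sq, of 0]) auto
  have "prob (\<Union>m. U m) \<le> (\<Sum>m. prob (U m))"
    using Us by (intro finite_measure_subadditive_countably su) auto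
  also have "\<dots> \<le> (\<Sum>m. q m)" by (intro suminf_le PU su sq)
  finally have "prob (\<Union>m. U m) \<le> \<alpha>" using qsum by linarith
  moreover have "\<exists>m. (1/2) ^ (m + ?d) \<le> 2 ^ ?d * (\<Prod>i\<in>UNIV. h $ i) \<and> 2 ^ ?d * (\<Prod>i\<in>UNIV. h $ i) \<le> (1/2) ^ m \<and>
      \<bar>scale_norm h * Z t h \<omega>\<bar> \<le> x m + ?E / x m"
    if om: "\<omega> \<in> space \<Omega> - (\<Union>m. U m)" and h: "h \<in> bandwidths" "t \<in> locations h" for \<omega> h t
  proof -
    obtain k j w where w: "w \<in> cbox 0 1" and j: "\<And>i. j i < 2 ^ k i" and eq: "h = cell_bandwidth k w" "t = cell_location k j w"
      using cells_cover[OF h] by blast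
    have kj: "(k, j) \<in> cell_indices (sum k UNIV)" using j by (simp add: cell_indices_def)
    have "\<omega> \<in> space \<Omega> - B (sum k UNIV) k j" using om kj unfolding U_def by blast
    from B(3)[OF kj this w] show ?thesis
      using cell_volume_bounds[OF w, of k] unfolding eq by blast
  qed
  ultimately show ?thesis
    using Us c3 unfolding x_def by (intro exI[of _ c] conjI bexI[of _ "\<Union>m. U m"]) auto
qed

section \<open>Comparison of the thresholds with the correction terms of the statistic\<close>

lemma ln_inverse_arg:
  fixes r :: real
  assumes "0 < r"
  shows "ln (1 / r) = - ln r" "ln (exp a / r) = a - ln r"
  using assms by (simp_all add: ln_div)

lemma D_corr_eq:
  assumes r: "0 < r" "r \<le> 1"
  shows "D_corr r = ln (exp 1 - ln r) / sqrt (1 - ln r)"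
proof -
  have "ln r \<le> 0" using r by simp
  then have "0 \<le> 1 - ln r" by simp
  then have "(1 - ln r) powr (- 1 / 2) = 1 / sqrt (1 - ln r)"
    using powr_minus_divide[of "1 - ln r" "1/2"] powr_half_sqrt[of "1 - ln r"] by simp
  then show ?thesis unfolding D_corr_def ln_inverse_arg[OF r(1)] by simp
qed

text \<open>Exceeding the critical value costs that value times \<open>D_corr\<close>, so a bound
  uniform in \<open>r\<close> is called for. With \<open>u = - ln r\<close> and
  \<open>v = sqrt (1 + u)\<close> it follows from \<open>exp 1 + u \<le> exp 1 * v^2\<close> and
  \<open>ln v \<le> v - 1\<close>.\<close>

lemma
  fixes r :: real
  assumes r: "0 < r" "r \<le> 1"
  shows D_corr_pos: "0 < D_corr r" and D_corr_le_2: "D_corr r \<le> 2"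
proof -
  let ?u = "- ln r"
  have u: "0 \<le> ?u" using r by simp
  have e2: "2 \<le> exp (1 :: real)" using exp_ge_add_one_self[of 1] by simp
  show "0 < D_corr r" unfolding D_corr_eq[OF r] using u e2 by (intro divide_pos_pos) auto
  let ?v = "sqrt (1 + ?u)"
  have v: "1 \<le> ?v" using u by simp
  have e4: "exp 1 \<le> (3 :: real)" by (rule exp_le)
  have "exp 1 + ?u \<le> exp 1 * (1 + ?u)" using mult_right_mono[of 1 "exp 1" ?u] u e2 by (simp add: algebra_simps)
  then have "ln (exp 1 + ?u) \<le> ln (exp 1 * (1 + ?u))" using u e2 by (subst ln_le_cancel_iff) auto
  also have "\<dots> = 1 + ln (?v\<^sup>2)" using u by (simp add: ln_mult)
  also have "\<dots> = 1 + 2 * ln ?v" using v by (subst ln_realpow) auto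
  also have "\<dots> \<le> 2 * ?v" using ln_le_minus_one[of ?v] v by simp
  finally show "D_corr r \<le> 2" unfolding D_corr_eq[OF r] using v by (simp add: divide_le_eq)
qed

text \<open>The squared threshold exceeds \<open>2 * m * ln 2\<close>, itself at most the square of
  \<open>Gamma_corr r\<close>, by \<open>2 * K * ln (m + c)\<close>. The excess of the threshold is
  thus of order \<open>ln m / sqrt m\<close>, the order of \<open>D_corr r\<close> for
  \<open>r\<close> about \<open>(1/2) ^ m\<close>.\<close>

lemma threshold_le_corr:
  assumes K: "1 \<le> K" "3 \<le> c" and E: "0 \<le> E"
    and r: "(1/2) ^ (m + d) \<le> r" "r \<le> (1/2) ^ m"
  shows "threshold K c m + E / threshold K c m
    \<le> Gamma_corr r + sqrt (1 + real d) * (2 * K * (ln (real c) + 2) + E) * D_corr r"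
proof -
  note x = threshold_square[OF K, of m]
  define x where "x = threshold K c m"
  note x = x[folded x_def]
  have r0: "0 < r" using less_le_trans[OF zero_less_power r(1)] by simp
  have r1: "r \<le> 1" using order_trans[OF r(2) power_le_one] by simp
  define u where "u = - ln r"
  define l where "l = ln (real (m + c))"
  define v where "v = ln (exp 1 + u)"
  have ln12: "ln ((1/2) ^ k) = - (real k * ln 2)" for k :: nat
    by (simp add: ln_realpow ln_div)
  have "ln r \<le> ln ((1/2) ^ m)" "ln ((1/2) ^ (m + d)) \<le> ln r" using r r0 by (auto intro: ln_mono)
  then have u: "real m * ln 2 \<le> u" "u \<le> real (m + d) * ln 2" unfolding ln12 u_def by auto
  have "real m * (1/2) \<le> real m * ln 2" using ln2_ge_half by (intro mult_left_mono) auto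
  then have um: "real m / 2 \<le> u" using u by simp
  have "real (m + d) * ln 2 \<le> real (m + d) * 1" using ln_le_minus_one[of "2 :: real"] by (intro mult_left_mono) auto
  then have umd: "u \<le> real m + real d" using u by simp
  have e2: "2 \<le> exp (1 :: real)" using exp_ge_add_one_self[of 1] by simp
  have v1: "1 \<le> v"
  proof -
    have "ln (exp 1) \<le> ln (exp 1 + u)" using um by (intro ln_mono) auto
    then show ?thesis by (simp add: v_def)
  qed
  have l0: "0 \<le> l" unfolding l_def using K by simp
  \<comment> \<open>Since \<open>m \<le> 2 * u\<close>, the numerator \<open>v\<close> of
    \<open>D_corr\<close> dominates \<open>ln (m + 1)\<close> up to a constant; as
    \<open>v \<ge> 1\<close>, constants depending on \<open>c\<close> can be written as multiples of
    \<open>v\<close>.\<close>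
  have lv: "l \<le> (ln (real c) + 2) * v"
  proof -
    have "real (m + c) \<le> real c * (real m + 1)"
      using K mult_right_mono[of 1 "real c" "real m"] by (simp add: algebra_simps)
    then have "l \<le> ln (real c * (real m + 1))" unfolding l_def using K by (intro ln_mono) auto
    also have "\<dots> = ln (real c) + ln (real m + 1)" using K by (simp add: ln_mult)
    also have "ln (real m + 1) \<le> ln (2 * (exp 1 + u))" using um e2 by (intro ln_mono) auto
    also have "ln (2 * (exp 1 + u)) = ln 2 + v" unfolding v_def using um e2 by (subst ln_mult) auto
    also have "ln 2 \<le> (1 :: real)" using ln_le_minus_one[of "2 :: real"] by simp
    finally have "l \<le> ln (real c) + 1 + v" by simp
    also have "\<dots> \<le> (ln (real c) + 1) * v + v"
      using v1 K mult_left_mono[OF v1, of "ln (real c) + 1"] by simp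
    finally show ?thesis by (simp add: algebra_simps)
  qed
  let ?y = "sqrt (2 * (real m * ln 2))"
  have y: "?y \<le> Gamma_corr r"
    unfolding Gamma_corr_def ln_inverse_arg[OF r0] u_def[symmetric] using u(1) by simp
  have y0: "0 \<le> ?y" by simp
  have xp: "0 < x" using x(3) by simp
  \<comment> \<open>Dividing \<open>x^2 = y^2 + 2 * K * l\<close> by x and using
    \<open>y \<le> x\<close> bounds the excess \<open>x - y\<close> by
    \<open>2 * K * l / x\<close>.\<close>
  have "?y\<^sup>2 = 2 * (real m * ln 2)" by (intro real_sqrt_pow2) simp
  then have "x\<^sup>2 = ?y\<^sup>2 + 2 * K * l" unfolding x(1) l_def by (simp add: algebra_simps)
  moreover have "?y\<^sup>2 \<le> ?y * x"
  proof -
    have "?y \<le> x" unfolding x_def threshold_def using K by simp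
    then show ?thesis unfolding power2_eq_square by (intro mult_left_mono y0)
  qed
  ultimately have "x\<^sup>2 \<le> ?y * x + 2 * K * l" by simp
  then have xy: "x \<le> ?y + 2 * K * l / x" using xp by (simp add: field_simps power2_eq_square)
  \<comment> \<open>From \<open>u \<le> m + d\<close> and \<open>m + 2 \<le> x^2\<close>: the
    reciprocal of the threshold is comparable with the denominator of \<open>D_corr\<close>, at the
    price of \<open>sqrt (1 + d)\<close>.\<close>
  have ix: "1 / x \<le> sqrt (1 + real d) / sqrt (1 + u)"
  proof -
    have "0 \<le> real d * real m" by simp
    then have "1 + u \<le> (1 + real d) * (real m + 2)" using umd unfolding distrib_left distrib_right by linarith
    also have "\<dots> \<le> (1 + real d) * x\<^sup>2" using x(2) by (intro mult_left_mono) auto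
    finally have "sqrt (1 + u) \<le> sqrt ((1 + real d) * x\<^sup>2)" by (rule real_sqrt_le_mono)
    then have "sqrt (1 + u) \<le> sqrt (1 + real d) * x" using xp by (simp add: real_sqrt_mult)
    moreover have "0 < sqrt (1 + u)" using um by simp
    ultimately show ?thesis using xp by (simp add: field_simps)
  qed
  have "threshold K c m + E / threshold K c m \<le> ?y + (2 * K * l + E) * (1 / x)"
    using xy unfolding x_def[symmetric] by (simp add: add_divide_distrib)
  also have "(2 * K * l + E) * (1 / x) \<le> (2 * K * ((ln (real c) + 2) * v) + E * v) * (sqrt (1 + real d) / sqrt (1 + u))"
    using lv E K l0 v1 xp mult_left_mono[OF v1 E] by (intro mult_mono ix add_mono mult_left_mono) (auto intro: add_nonneg_nonneg)
  also have "\<dots> = sqrt (1 + real d) * (2 * K * (ln (real c) + 2) + E) * D_corr r"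
    unfolding D_corr_eq[OF r0 r1] u_def v_def by (simp add: algebra_simps add_divide_distrib)
  finally show ?thesis using y unfolding x_def by simp
qed

lemma bandwidth_volume:
  fixes h :: "real ^ 'n"
  assumes "h \<in> bandwidths"
  shows "0 < 2 ^ CARD('n) * (\<Prod>i\<in>UNIV. h $ i)" "2 ^ CARD('n) * (\<Prod>i\<in>UNIV. h $ i) \<le> 1"
proof -
  have eq: "2 ^ CARD('n) * (\<Prod>i\<in>UNIV. h $ i) = (\<Prod>i\<in>UNIV. 2 * h $ i)" by (simp add: prod.distrib)
  show "0 < 2 ^ CARD('n) * (\<Prod>i\<in>UNIV. h $ i)"
    unfolding eq using assms by (intro prod_pos) (auto simp: bandwidths_def)
  show "2 ^ CARD('n) * (\<Prod>i\<in>UNIV. h $ i) \<le> 1"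
    unfolding eq using assms by (intro prod_le_1) (auto simp: bandwidths_def less_imp_le mult.commute)
qed

lemma multiscale_stat_psi_1:
  "multiscale_stat (psi 1 :: real ^ 'n \<Rightarrow> real) \<Phi> = (SUP h\<in>bandwidths. SUP t\<in>locations h.
    ereal ((\<bar>scale_norm h * \<Phi> t h\<bar> - Gamma_corr (2 ^ CARD('n) * (\<Prod>i\<in>UNIV. h $ i))) / D_corr (2 ^ CARD('n) * (\<Prod>i\<in>UNIV. h $ i))))"
  unfolding multiscale_stat_def scale_norm_def Let_def by simp

text \<open>Any level exceeded only within a set of probability at most \<alpha> belongs to the set
  whose infimum is the critical value. Nonnegativity of the bound allows it to be multiplied by
  \<open>D_corr r \<le> 2\<close> later.\<close>

lemma critical_value_bounded:
  fixes W :: "real ^ 'n \<Rightarrow> 'w \<Rightarrow> real"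
  assumes bs: "brownian_sheet \<Omega> W" and cw: "continuous_wiener_version \<Omega> W (psi 1) Z" and "0 < \<alpha>"
  shows "\<exists>c\<ge>0. critical_value \<Omega> (psi 1) Z \<alpha> \<le> ereal c"
proof -
  interpret prob_space \<Omega> using bs by (simp add: brownian_sheet_def)
  let ?d = "CARD('n)"
  let ?E = "chaining_const TYPE('n) * (2 * real CARD('n + 'n) + 3)"
  define K where "K = real (CARD('n + 'n) + CARD('n) + 2)"
  obtain c B where c: "3 \<le> c" and B: "B \<in> sets \<Omega>" "prob B \<le> \<alpha>"
    and bd: "\<And>\<omega> h t. \<omega> \<in> space \<Omega> - B \<Longrightarrow> h \<in> bandwidths \<Longrightarrow> t \<in> locations h \<Longrightarrow>
     \<exists>m. (1/2) ^ (m + ?d) \<le> 2 ^ ?d * (\<Prod>i\<in>UNIV. h $ i) \<and> 2 ^ ?d * (\<Prod>i\<in>UNIV. h $ i) \<le> (1/2) ^ m \<and>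
      \<bar>scale_norm h * Z t h \<omega>\<bar> \<le> threshold K c m + ?E / threshold K c m"
    using noise_bound_outside_small_set[OF bs cw \<open>0 < \<alpha>\<close>, folded K_def] by blast
  have K: "1 \<le> K" by (simp add: K_def)
  have E: "0 \<le> ?E" using chaining_const_pos[where 'n='n] by simp
  define C where "C = sqrt (1 + real ?d) * (2 * K * (ln (real c) + 2) + ?E)"
  have C0: "0 \<le> C" unfolding C_def using K E c by (intro mult_nonneg_nonneg[OF _ add_nonneg_nonneg[OF _ E]]) auto
  have "noise_stat (psi 1) Z \<omega> \<le> ereal C" if om: "\<omega> \<in> space \<Omega> - B" for \<omega>
    unfolding noise_stat_def multiscale_stat_psi_1
  proof (intro SUP_least)
    fix h t :: "real ^ 'n" assume h: "h \<in> bandwidths" and t: "t \<in> locations h"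
    let ?r = "2 ^ ?d * (\<Prod>i\<in>UNIV. h $ i)"
    obtain m where m: "(1/2) ^ (m + ?d) \<le> ?r" "?r \<le> (1/2) ^ m"
      "\<bar>scale_norm h * Z t h \<omega>\<bar> \<le> threshold K c m + ?E / threshold K c m"
      using bd[OF om h t] by blast
    have "\<bar>scale_norm h * Z t h \<omega>\<bar> \<le> Gamma_corr ?r + C * D_corr ?r"
      using m(3) threshold_le_corr[OF K c E m(1,2)] unfolding C_def by linarith
    then show "ereal ((\<bar>scale_norm h * Z t h \<omega>\<bar> - Gamma_corr ?r) / D_corr ?r) \<le> ereal C"
      using D_corr_pos[OF bandwidth_volume[OF h]] by (simp add: divide_le_eq)
  qed
  then have "{\<omega> \<in> space \<Omega>. noise_stat (psi 1) Z \<omega> > ereal C} \<subseteq> B" by (force simp: not_le[symmetric])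
  \<comment> \<open>no measurability of the left-hand side is needed: non-measurable sets have measure \<open>0\<close>\<close>
  then have "prob {\<omega> \<in> space \<Omega>. noise_stat (psi 1) Z \<omega> > ereal C} \<le> \<alpha>"
    using finite_measure_mono[OF _ B(1)] B(2) by (meson order_trans)
  then have "critical_value \<Omega> (psi 1) Z \<alpha> \<le> ereal C"
    unfolding critical_value_def by (intro Inf_lower) auto
  with C0 show ?thesis by blast
qed

section \<open>The power of the test\<close>

lemma abs_psi_1_mult_le: "\<bar>psi 1 x * b\<bar> \<le> \<bar>b\<bar>"
  unfolding abs_mult by (intro mult_left_le_one_le abs_ge_zero abs_psi_1_le_1)

definition scale_space :: "((real ^ 'n) \<times> (real ^ 'n)) set"
  where "scale_space = {(t, h). h \<in> bandwidths \<and> t \<in> locations h}"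

text \<open>Dominated convergence along sequences: the kernel is continuous in its parameters and
  bounded by 1, so \<open>\<bar>g\<bar>\<close> on the cube is a majorant.\<close>

lemma continuous_on_signal:
  fixes g :: "real ^ 'n \<Rightarrow> real"
  assumes g: "set_integrable lborel unit_cube g"
  shows "continuous_on scale_space (\<lambda>(t, h). LINT x:unit_cube|lborel. rescale (psi 1) t h x * g x)"
  unfolding continuous_on_sequentially comp_def
proof (intro ballI allI impI, elim conjE)
  fix s :: "nat \<Rightarrow> (real ^ 'n) \<times> (real ^ 'n)" and a
  assume a: "a \<in> scale_space" and s: "\<forall>k. s k \<in> scale_space" "s \<longlonglongrightarrow> a"
  obtain t h where th: "a = (t, h)" by (cases a)
  let ?g = "\<lambda>x. indicator unit_cube x * g x"
  have gi: "integrable lborel ?g" using g by (simp add: set_integrable_def)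
  have h: "0 < h $ i" for i using a th by (auto simp: scale_space_def bandwidths_def)
  have hk: "0 < snd (s k) $ i" for i k using s(1)[rule_format, of k] by (auto simp: scale_space_def bandwidths_def)
  have "(\<lambda>k. \<integral>x. rescale (psi 1) (fst (s k)) (snd (s k)) x * ?g x \<partial>lborel) \<longlonglongrightarrow> (\<integral>x. rescale (psi 1) t h x * ?g x \<partial>lborel)"
  proof (rule integral_dominated_convergence[where w="\<lambda>x. \<bar>?g x\<bar>"])
    have [measurable]: "?g \<in> borel_measurable borel" using borel_measurable_integrable[OF gi] by simp
    have [measurable]: "rescale (psi 1) t h \<in> borel_measurable borel" by (intro measurable_rescale h) simp
    show "(\<lambda>x. rescale (psi 1) t h x * ?g x) \<in> borel_measurable lborel" by measurable
    show "(\<lambda>x. rescale (psi 1) (fst (s k)) (snd (s k)) x * ?g x) \<in> borel_measurable lborel" for k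
    proof -
      have [measurable]: "rescale (psi 1) (fst (s k)) (snd (s k)) \<in> borel_measurable borel" by (intro measurable_rescale hk) simp
      show ?thesis by measurable
    qed
    show "integrable lborel (\<lambda>x. \<bar>?g x\<bar>)" using gi by (rule integrable_abs)
    show "AE x in lborel. norm (rescale (psi 1) (fst (s k)) (snd (s k)) x * ?g x) \<le> \<bar>?g x\<bar>" for k
      unfolding rescale_def real_norm_def by (intro AE_I2 abs_psi_1_mult_le)
    show "AE x in lborel. (\<lambda>k. rescale (psi 1) (fst (s k)) (snd (s k)) x * ?g x) \<longlonglongrightarrow> rescale (psi 1) t h x * ?g x"
    proof (intro AE_I2 tendsto_mult tendsto_const)
      fix x
      have "(\<lambda>k. fst (s k)) \<longlonglongrightarrow> t" "(\<lambda>k. snd (s k)) \<longlonglongrightarrow> h"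
        using tendsto_fst[OF s(2)] tendsto_snd[OF s(2)] th by auto
      then have "(\<lambda>k. \<chi> i. (x $ i - fst (s k) $ i) / snd (s k) $ i) \<longlonglongrightarrow> (\<chi> i. (x $ i - t $ i) / h $ i)"
        using h by (intro tendsto_vec_lambda tendsto_intros) (auto simp: less_imp_neq[symmetric])
      then show "(\<lambda>k. rescale (psi 1) (fst (s k)) (snd (s k)) x) \<longlonglongrightarrow> rescale (psi 1) t h x"
        unfolding rescale_def
        by (intro continuous_on_tendsto_compose[OF continuous_psi_1]) auto
    qed
  qed
  then show "(\<lambda>k. case s k of (t, h) \<Rightarrow> LINT x:unit_cube|lborel. rescale (psi 1) t h x * g x) \<longlonglongrightarrow>
      (case a of (t, h) \<Rightarrow> LINT x:unit_cube|lborel. rescale (psi 1) t h x * g x)"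
    unfolding th set_lebesgue_integral_def by (simp add: split_def mult_ac)
qed

text \<open>The supremum runs over uncountably many pairs, but each path of the corrected statistic
  is continuous, so a countable dense set of pairs detects every exceedance.\<close>

lemma sets_data_stat_greater:
  fixes W :: "real ^ 'n \<Rightarrow> 'w \<Rightarrow> real"
  assumes cw: "continuous_wiener_version \<Omega> W (psi 1) Z" and g: "set_integrable lborel unit_cube g"
  shows "{\<omega> \<in> space \<Omega>. \<kappa> < data_stat (psi 1) n g Z \<omega>} \<in> sets \<Omega>"
proof -
  let ?r = "\<lambda>h :: real ^ 'n. 2 ^ CARD('n) * (\<Prod>i\<in>UNIV. h $ i)"
  define F where "F \<omega> p = (\<bar>scale_norm (snd p) * observation_integral n g (rescale (psi 1) (fst p) (snd p)) (Z (fst p) (snd p) \<omega>)\<bar>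
     - Gamma_corr (?r (snd p))) / D_corr (?r (snd p))" for \<omega> and p :: "(real ^ 'n) \<times> (real ^ 'n)"
  have pos: "0 < ?r (snd p)" "?r (snd p) \<le> 1" if "p \<in> scale_space" for p
    using that bandwidth_volume[of "snd p"] by (auto simp: scale_space_def)
  have cont_r: "continuous_on scale_space (\<lambda>p. ?r (snd p))"
    by (intro continuous_intros)
  have cont_prod: "continuous_on scale_space (\<lambda>p. \<Prod>i\<in>UNIV. snd p $ i)"
    by (intro continuous_intros)
  have cont_scale: "continuous_on scale_space (\<lambda>p. scale_norm (snd p))"
    unfolding scale_norm_def
    by (intro continuous_on_mult continuous_on_const continuous_on_powr cont_prod)
       (auto simp: scale_space_def bandwidths_def less_imp_neq[symmetric])
  have cont_ln: "continuous_on scale_space (\<lambda>p. ln (?r (snd p)))"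
  proof (intro continuous_on_ln[OF cont_r] ballI)
    show "?r (snd p) \<noteq> 0" if "p \<in> scale_space" for p using pos(1)[OF that] by linarith
  qed
  then have "continuous_on scale_space (\<lambda>p. sqrt (2 * (- ln (?r (snd p)))))"
    by (intro continuous_on_real_sqrt continuous_on_mult[OF continuous_on_const] continuous_on_minus)
  then have cont_G: "continuous_on scale_space (\<lambda>p. Gamma_corr (?r (snd p)))"
    by (rule continuous_on_cong[THEN iffD1, OF refl, rotated]) (simp only: Gamma_corr_def ln_inverse_arg pos)
  have "continuous_on scale_space (\<lambda>p. ln (exp 1 - ln (?r (snd p))) / sqrt (1 - ln (?r (snd p))))"
  proof (intro continuous_on_divide continuous_on_real_sqrt continuous_on_ln[of _ "\<lambda>p. exp 1 - ln (?r (snd p))"]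
      continuous_on_diff[OF continuous_on_const] cont_ln ballI)
    fix p :: "(real ^ 'n) \<times> (real ^ 'n)" assume "p \<in> scale_space"
    then have "ln (?r (snd p)) \<le> 0" using pos by simp
    moreover have "0 < exp (1 :: real)" by simp
    ultimately have "0 < exp 1 - ln (?r (snd p))" "0 < 1 - ln (?r (snd p))" by linarith+
    then show "exp 1 - ln (?r (snd p)) \<noteq> 0" "sqrt (1 - ln (?r (snd p))) \<noteq> 0"
      unfolding real_sqrt_eq_0_iff by linarith+
  qed
  then have cont_D: "continuous_on scale_space (\<lambda>p. D_corr (?r (snd p)))"
    by (rule continuous_on_cong[THEN iffD1, OF refl, rotated]) (simp add: D_corr_eq pos)
  have cont_F: "continuous_on scale_space (F \<omega>)" if om: "\<omega> \<in> space \<Omega>" for \<omega>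
  proof -
    have "continuous_on scale_space (\<lambda>(t, h). Z t h \<omega>)"
      using cw om unfolding continuous_wiener_version_def scale_space_def by blast
    then have Z: "continuous_on scale_space (\<lambda>p. Z (fst p) (snd p) \<omega>)" by (simp add: split_def)
    have S: "continuous_on scale_space (\<lambda>p. LINT x:unit_cube|lborel. rescale (psi 1) (fst p) (snd p) x * g x)"
      using continuous_on_signal[OF g] by (simp add: split_def)
    have Dn: "D_corr (?r (snd p)) \<noteq> 0" if "p \<in> scale_space" for p
      using D_corr_pos[OF pos[OF that]] by simp
    show ?thesis
      unfolding F_def observation_integral_def using Dn
      by (intro continuous_on_divide continuous_on_diff continuous_on_rabs continuous_on_mult continuous_on_add
          continuous_on_const cont_scale cont_G cont_D Z S) auto
  qed
  obtain D :: "((real ^ 'n) \<times> (real ^ 'n)) set" where D: "countable D" "D \<subseteq> scale_space" "scale_space \<subseteq> closure D"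
    using separable[of scale_space] by blast
  have meas: "{\<omega> \<in> space \<Omega>. \<kappa> < ereal (F \<omega> p)} \<in> sets \<Omega>" if "p \<in> scale_space" for p
  proof -
    have "is_wiener_integral \<Omega> W (rescale (psi 1) (fst p) (snd p)) (Z (fst p) (snd p))"
      using cw that unfolding continuous_wiener_version_def scale_space_def by auto
    then have [measurable]: "Z (fst p) (snd p) \<in> borel_measurable \<Omega>" by (simp add: is_wiener_integral_def)
    show ?thesis unfolding F_def observation_integral_def by measurable
  qed
  have iff: "\<kappa> < data_stat (psi 1) n g Z \<omega> \<longleftrightarrow> (\<exists>p\<in>scale_space. \<kappa> < ereal (F \<omega> p))" for \<omega>
    unfolding data_stat_def multiscale_stat_psi_1 less_SUP_iff scale_space_def F_def by auto
  have dense: "\<exists>q\<in>D. \<kappa> < ereal (F \<omega> q)" if om: "\<omega> \<in> space \<Omega>" and p: "p \<in> scale_space" "\<kappa> < ereal (F \<omega> p)" for \<omega> p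
  proof -
    \<comment> \<open>The level \<open>\<kappa>\<close> is an extended real while the convergence
      takes place in the reals; a real number in between links the two.\<close>
    obtain a where a: "\<kappa> < ereal a" "ereal a < ereal (F \<omega> p)" using ereal_dense2[OF p(2)] by blast
    obtain s where s: "\<And>k. s k \<in> D" "s \<longlonglongrightarrow> p" using p(1) D(3) closure_sequential[of p D] by blast
    have "(\<lambda>k. F \<omega> (s k)) \<longlonglongrightarrow> F \<omega> p"
      using cont_F[OF om] p(1) s D(2) unfolding continuous_on_sequentially comp_def by blast
    then have "eventually (\<lambda>k. a < F \<omega> (s k)) sequentially" using a(2) by (intro order_tendstoD(1)) auto
    then obtain k where "a < F \<omega> (s k)" by (meson eventually_sequentially order_refl)
    then have "\<kappa> < ereal (F \<omega> (s k))" using a(1) by (meson ereal_less(2) less_ereal.simps(1) order_less_trans)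
    then show ?thesis using s(1) by blast
  qed
  have "{\<omega> \<in> space \<Omega>. \<kappa> < data_stat (psi 1) n g Z \<omega>} = (\<Union>p\<in>D. {\<omega> \<in> space \<Omega>. \<kappa> < ereal (F \<omega> p)})"
    unfolding iff using dense D(2) by blast
  also have "\<dots> \<in> sets \<Omega>"
    using D meas by (intro sets.countable_UN') auto
  finally show ?thesis .
qed

text \<open>Multiplying by the sign of \<open>g t\<close> reduces both signs to one inequality. The
  factor \<open>psi 1\<close> vanishes outside the unit ball of the rescaled coordinate, so the
  Hoelder bound is invoked only where it gives the bump \<open>psi \<beta>\<close>.\<close>

lemma signal_lower_bound:
  fixes g :: "real ^ 'n \<Rightarrow> real"
  assumes g: "g \<in> holder_class \<beta> L" and "0 < \<beta>" "0 < L" and \<delta>: "0 < \<delta>" "\<delta> \<le> 1/2"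
    and t: "t \<in> inner_cube \<delta>" and gt: "L * \<delta> powr \<beta> \<le> \<bar>g t\<bar>"
  shows "L * \<delta> powr \<beta> * \<delta> ^ CARD('n) * l2_inner (psi 1) (psi \<beta> :: real ^ 'n \<Rightarrow> real)
    \<le> \<bar>LINT x:unit_cube|lborel. rescale (psi 1) t (\<chi> i. \<delta>) x * g x\<bar>"
proof -
  let ?h = "\<chi> i. \<delta> :: real ^ 'n"
  let ?P = "\<lambda>x. psi 1 x * psi \<beta> x :: real"
  define \<sigma> where "\<sigma> = sgn (g t)"
  have h: "?h \<in> bandwidths" "t \<in> locations ?h" using \<delta> t by (auto simp: bandwidths_def locations_def inner_cube_def)
  have gi: "set_integrable lborel unit_cube g" and gh: "\<And>x y. x \<in> unit_cube \<Longrightarrow> y \<in> unit_cube \<Longrightarrow> \<bar>g x - g y\<bar> \<le> L * norm (x - y) powr \<beta>"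
    using g by (auto simp: holder_class_def)
  have tc: "t \<in> unit_cube"
  proof -
    have "0 \<le> t $ i \<and> t $ i \<le> 1" for i using t \<delta>(1) unfolding inner_cube_def by (smt (verit) mem_Collect_eq)
    then show ?thesis by (auto simp: mem_box_cart)
  qed
  have pt: "L * \<delta> powr \<beta> * rescale ?P t ?h x \<le> \<sigma> * (indicator unit_cube x * (rescale (psi 1) t ?h x * g x))" for x
  proof (cases "x \<in> unit_cube")
    case True
    let ?y = "\<chi> i. (x $ i - t $ i) / \<delta> :: real ^ 'n"
    have xt: "x - t = \<delta> *\<^sub>R ?y" using \<delta>(1) by (simp add: vec_eq_iff)
    have "L * \<delta> powr \<beta> * psi \<beta> ?y \<le> \<sigma> * g x" if "norm ?y \<le> 1"
    proof -
      have "norm (x - t) = \<delta> * norm ?y" unfolding xt using \<delta>(1) by simp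
      then have "norm (x - t) powr \<beta> = \<delta> powr \<beta> * norm ?y powr \<beta>" using \<delta>(1) by (simp add: powr_mult)
      then have "\<bar>g x - g t\<bar> \<le> L * (\<delta> powr \<beta> * norm ?y powr \<beta>)" using gh[OF True tc] by simp
      moreover have "\<bar>g t\<bar> - \<bar>g x - g t\<bar> \<le> \<sigma> * g x" unfolding \<sigma>_def by (auto simp: sgn_if)
      ultimately have "L * \<delta> powr \<beta> - L * (\<delta> powr \<beta> * norm ?y powr \<beta>) \<le> \<sigma> * g x" using gt by linarith
      then show ?thesis using that by (simp add: psi_def algebra_simps)
    qed
    then have "psi 1 ?y * (L * \<delta> powr \<beta> * psi \<beta> ?y) \<le> psi 1 ?y * (\<sigma> * g x)"
      using psi_nonneg[of 1 ?y] psi_eq_0[of ?y 1] by (cases "norm ?y \<le> 1") (auto intro!: mult_left_mono)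
    then show ?thesis using True by (simp add: rescale_def mult_ac)
  next
    case False
    then show ?thesis using rescale_psi_outside_cube[OF h False, of 1] by (simp add: rescale_def)
  qed
  have hp: "\<And>i. 0 < ?h $ i" using \<delta> by simp
  have [measurable]: "rescale ?P t ?h \<in> borel_measurable borel" "rescale (psi 1) t ?h \<in> borel_measurable borel"
    by (intro measurable_rescale hp; measurable)+
  let ?G = "\<lambda>x. indicator unit_cube x * g x"
  have Gi: "integrable lborel ?G" using gi by (simp add: set_integrable_def)
  have [measurable]: "?G \<in> borel_measurable borel" using borel_measurable_integrable[OF Gi] by simp
  have "integrable lborel (\<lambda>x. rescale (psi 1) t ?h x * ?G x)"
  proof (rule Bochner_Integration.integrable_bound[OF Gi])
    show "AE x in lborel. norm (rescale (psi 1) t ?h x * ?G x) \<le> norm (?G x)"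
      unfolding rescale_def real_norm_def by (intro AE_I2 abs_psi_1_mult_le)
  qed measurable
  then have int: "integrable lborel (\<lambda>x. \<sigma> * (indicator unit_cube x * (rescale (psi 1) t ?h x * g x)))"
    by (intro integrable_mult_right) (simp add: mult.left_commute)
  have "L * \<delta> powr \<beta> * \<delta> ^ CARD('n) * l2_inner (psi 1) (psi \<beta> :: real ^ 'n \<Rightarrow> real) = L * \<delta> powr \<beta> * (\<integral>x. rescale ?P t ?h x \<partial>lborel)"
    unfolding l2_inner_def by (subst integral_rescale[OF _ hp]) auto
  also have "\<dots> = (\<integral>x. L * \<delta> powr \<beta> * rescale ?P t ?h x \<partial>lborel)" by simp
  also have "\<dots> \<le> (\<integral>x. \<sigma> * (indicator unit_cube x * (rescale (psi 1) t ?h x * g x)) \<partial>lborel)"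
  proof (rule integral_mono'[OF int pt])
    fix x
    have "0 \<le> L * \<delta> powr \<beta> * rescale ?P t ?h x"
      unfolding rescale_def using psi_nonneg[of 1] psi_nonneg[OF \<open>0 < \<beta>\<close>] \<open>0 < L\<close> by (intro mult_nonneg_nonneg) auto
    then show "0 \<le> \<sigma> * (indicator unit_cube x * (rescale (psi 1) t ?h x * g x))" using pt by (rule order_trans)
  qed
  also have "\<dots> = \<sigma> * (LINT x:unit_cube|lborel. rescale (psi 1) t ?h x * g x)"
    unfolding set_lebesgue_integral_def by simp
  also have "\<dots> \<le> \<bar>LINT x:unit_cube|lborel. rescale (psi 1) t ?h x * g x\<bar>"
    unfolding \<sigma>_def by (auto simp: sgn_if)
  finally show ?thesis .
qed

text \<open>Hoelder functions are continuous and the inner cube is compact. An attained maximum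
  loses nothing against the supremum, so the height of the bump needs no approximation.\<close>

lemma holder_class_sup_attained:
  fixes g :: "real ^ 'n \<Rightarrow> real"
  assumes g: "g \<in> holder_class \<beta> L" and "0 < \<beta>" and \<delta>: "0 < \<delta>" "\<delta> \<le> 1/2" and b: "b \<le> sup_norm_on (inner_cube \<delta>) g"
  shows "\<exists>t\<in>inner_cube \<delta>. b \<le> \<bar>g t\<bar>"
proof -
  have eq: "inner_cube \<delta> = (cbox (\<chi> i. \<delta>) (\<chi> i. 1 - \<delta>) :: (real ^ 'n) set)" by (auto simp: inner_cube_def mem_box_cart)
  have sub: "inner_cube \<delta> \<subseteq> (unit_cube :: (real ^ 'n) set)"
  proof
    fix t :: "real ^ 'n" assume "t \<in> inner_cube \<delta>"
    then have "0 \<le> t $ i \<and> t $ i \<le> 1" for i using \<delta>(1) unfolding inner_cube_def by (smt (verit) mem_Collect_eq)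
    then show "t \<in> unit_cube" by (auto simp: mem_box_cart)
  qed
  have ne: "inner_cube \<delta> \<noteq> ({} :: (real ^ 'n) set)"
    unfolding eq using \<delta> by (auto simp: interval_ne_empty_cart)
  have "continuous_on (inner_cube \<delta>) g"
    unfolding continuous_on_def
  proof
    fix x assume x: "x \<in> (inner_cube \<delta> :: (real ^ 'n) set)"
    have "((\<lambda>y. L * norm (y - x) powr \<beta>) \<longlongrightarrow> L * norm (x - x) powr \<beta>) (at x within inner_cube \<delta>)"
      using \<open>0 < \<beta>\<close> by (intro tendsto_intros tendsto_powr2) auto
    then have "((\<lambda>y. L * norm (y - x) powr \<beta>) \<longlongrightarrow> 0) (at x within inner_cube \<delta>)" by simp
    moreover have "eventually (\<lambda>y. norm (g y - g x) \<le> L * norm (y - x) powr \<beta>) (at x within inner_cube \<delta>)"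
      using g sub x unfolding eventually_at_filter holder_class_def by (intro always_eventually) auto
    ultimately have "((\<lambda>y. g y - g x) \<longlongrightarrow> 0) (at x within inner_cube \<delta>)" by (rule Lim_null_comparison[rotated])
    then show "(g \<longlongrightarrow> g x) (at x within inner_cube \<delta>)" by (simp add: LIM_zero_iff)
  qed
  then have "continuous_on (inner_cube \<delta>) (\<lambda>t. \<bar>g t\<bar>)" by (intro continuous_intros)
  moreover have "compact (inner_cube \<delta> :: (real ^ 'n) set)" unfolding eq by (rule compact_cbox)
  ultimately obtain t where t: "t \<in> inner_cube \<delta>" "\<And>s. s \<in> inner_cube \<delta> \<Longrightarrow> \<bar>g s\<bar> \<le> \<bar>g t\<bar>"
    using continuous_attains_sup[of "inner_cube \<delta>" "\<lambda>t. \<bar>g t\<bar>"] ne by blast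
  have "sup_norm_on (inner_cube \<delta>) g \<le> \<bar>g t\<bar>"
    unfolding sup_norm_on_def using ne t(2) by (intro cSUP_least) auto
  then show ?thesis using b t(1) by (intro bexI[of _ t]) auto
qed

text \<open>A constant function of the critical height shows that the alternatives are not empty.
  Over the empty set an infimum of reals would say nothing about the power.\<close>

lemma const_in_holder_class:
  fixes \<delta> :: real
  assumes "0 < L" "0 \<le> a" "0 < \<delta>" "\<delta> \<le> 1/2"
  shows "(\<lambda>_. a) \<in> (holder_class \<beta> L :: (real ^ 'n \<Rightarrow> real) set)" "sup_norm_on (inner_cube \<delta> :: (real ^ 'n) set) (\<lambda>_. a) = a"
proof -
  show "(\<lambda>_. a) \<in> (holder_class \<beta> L :: (real ^ 'n \<Rightarrow> real) set)"
    unfolding holder_class_def set_integrable_def using assms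
    by (auto intro!: integrable_mult_left integrable_real_indicator simp: emeasure_bounded_finite[unfolded infinity_ennreal_def])
  have "(\<chi> i. 1/2) \<in> (inner_cube \<delta> :: (real ^ 'n) set)" using assms by (simp add: inner_cube_def)
  then have "(inner_cube \<delta> :: (real ^ 'n) set) \<noteq> {}" by blast
  then show "sup_norm_on (inner_cube \<delta> :: (real ^ 'n) set) (\<lambda>_. a) = a"
    unfolding sup_norm_on_def using assms by simp
qed

text \<open>\<open>y\<close> is the guaranteed mean at the maximiser, minus
  \<open>Gamma_corr r\<close> with \<open>r = (2 * \<delta>) ^ d\<close>, minus
  \<open>2 * c\<close>, which bounds \<open>c * D_corr r\<close>. The test can miss the signal only
  if the normalised noise at this one pair is at least \<open>y\<close> in absolute value.\<close>

lemma power_lower_bound: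
  fixes W :: "real ^ 'n \<Rightarrow> 'w \<Rightarrow> real" and n :: nat
  assumes bs: "brownian_sheet \<Omega> W" and cw: "continuous_wiener_version \<Omega> W (psi 1) Z"
    and g: "g \<in> holder_class \<beta> L" and "0 < \<beta>" "0 < L" and \<delta>: "0 < \<delta>" "\<delta> \<le> 1/2"
    and sup: "L * \<delta> powr \<beta> \<le> sup_norm_on (inner_cube \<delta>) g"
    and \<kappa>: "\<kappa> \<le> ereal c" "0 \<le> c"
  defines "y \<equiv> sqrt (real n) * L * \<delta> powr (\<beta> + real CARD('n) / 2) * l2_inner (psi 1) (psi \<beta> :: real ^ 'n \<Rightarrow> real)
      / l2_norm (psi 1 :: real ^ 'n \<Rightarrow> real) - sqrt (- 2 * real CARD('n) * ln (2 * \<delta>)) - 2 * c"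
  assumes y: "0 < y"
  shows "1 - 2 * exp (- y\<^sup>2 / 2) \<le> measure \<Omega> {\<omega> \<in> space \<Omega>. \<kappa> < data_stat (psi 1) n g Z \<omega>}"
proof -
  interpret prob_space \<Omega> using bs by (simp add: brownian_sheet_def)
  let ?d = "CARD('n)"
  define h where "h = (\<chi> i. \<delta> :: real ^ 'n)"
  obtain t where t: "t \<in> inner_cube \<delta>" and gt: "L * \<delta> powr \<beta> \<le> \<bar>g t\<bar>"
    using holder_class_sup_attained[OF g \<open>0 < \<beta>\<close> \<delta> sup] by blast
  have h: "h \<in> bandwidths" "t \<in> locations h" using \<delta> t by (auto simp: h_def bandwidths_def locations_def inner_cube_def)
  have prod: "(\<Prod>i\<in>UNIV. h $ i) = \<delta> ^ ?d" by (simp add: h_def)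
  have dpow: "\<delta> ^ ?d = \<delta> powr real ?d" using \<delta>(1) by (simp only: powr_realpow)
  define r where "r = 2 ^ ?d * (\<Prod>i\<in>UNIV. h $ i)"
  have r: "0 < r" "r \<le> 1" unfolding r_def by (rule bandwidth_volume[OF h(1)])+
  define S where "S = (LINT x:unit_cube|lborel. rescale (psi 1) t h x * g x)"
  define \<mu> where "\<mu> = sqrt (real n) * L * \<delta> powr (\<beta> + real ?d / 2) * l2_inner (psi 1) (psi \<beta> :: real ^ 'n \<Rightarrow> real) / l2_norm (psi 1 :: real ^ 'n \<Rightarrow> real)"
  have G: "Gamma_corr r = sqrt (- 2 * real ?d * ln (2 * \<delta>))"
  proof -
    have "r = (2 * \<delta>) ^ ?d" by (simp add: r_def prod power_mult_distrib)
    then have "ln r = real ?d * ln (2 * \<delta>)" using \<delta> by (simp only: ln_realpow)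
    then show ?thesis unfolding Gamma_corr_def ln_inverse_arg[OF r(1)] by simp
  qed
  have sn: "scale_norm h = \<delta> powr (- real ?d / 2) / l2_norm (psi 1 :: real ^ 'n \<Rightarrow> real)"
    unfolding scale_norm_def prod dpow powr_powr divide_inverse by simp
  have mean: "\<mu> \<le> scale_norm h * (sqrt (real n) * \<bar>S\<bar>)"
  proof -
    have "\<mu> = scale_norm h * (sqrt (real n) * (L * \<delta> powr \<beta> * \<delta> ^ ?d * l2_inner (psi 1) (psi \<beta> :: real ^ 'n \<Rightarrow> real)))"
    proof -
      have "\<delta> powr (\<beta> + real ?d / 2) = \<delta> powr (- real ?d / 2) * (\<delta> powr \<beta> * \<delta> ^ ?d)"
        unfolding dpow powr_add[symmetric] by (simp add: algebra_simps)
      then show ?thesis unfolding \<mu>_def sn by (simp only: divide_inverse ac_simps)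
    qed
    also have "\<dots> \<le> scale_norm h * (sqrt (real n) * \<bar>S\<bar>)"
      unfolding S_def h_def using scale_norm_pos[OF h(1)]
      by (intro mult_left_mono signal_lower_bound[OF g \<open>0 < \<beta>\<close> \<open>0 < L\<close> \<delta> t gt]) (simp_all add: h_def less_imp_le)
    finally show ?thesis .
  qed
  have y_eq: "y = \<mu> - Gamma_corr r - 2 * c" unfolding y_def \<mu>_def G ..
  have [measurable]: "Z t h \<in> borel_measurable \<Omega>"
    using cw h unfolding continuous_wiener_version_def is_wiener_integral_def by auto
  let ?A = "{\<omega> \<in> space \<Omega>. y \<le> \<bar>scale_norm h * Z t h \<omega>\<bar>}"
  have sub: "space \<Omega> - ?A \<subseteq> {\<omega> \<in> space \<Omega>. \<kappa> < data_stat (psi 1) n g Z \<omega>}"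
  proof
    fix \<omega> assume om: "\<omega> \<in> space \<Omega> - ?A"
    let ?O = "observation_integral n g (rescale (psi 1) t h) (Z t h \<omega>)"
    have "scale_norm h * ?O = scale_norm h * (sqrt (real n) * S) + scale_norm h * Z t h \<omega>"
      unfolding observation_integral_def S_def by (simp add: distrib_left)
    moreover have "\<bar>scale_norm h * (sqrt (real n) * S)\<bar> = scale_norm h * (sqrt (real n) * \<bar>S\<bar>)"
      using scale_norm_pos[OF h(1)] by (simp add: abs_mult)
    moreover have "\<bar>scale_norm h * Z t h \<omega>\<bar> < y" using om by auto
    ultimately have "\<mu> - y < \<bar>scale_norm h * ?O\<bar>" using mean by linarith
    moreover have "c * D_corr r \<le> c * 2" using D_corr_le_2[OF r] \<kappa>(2) by (intro mult_left_mono) auto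
    ultimately have "c * D_corr r < \<bar>scale_norm h * ?O\<bar> - Gamma_corr r" unfolding y_eq by linarith
    then have "c < (\<bar>scale_norm h * ?O\<bar> - Gamma_corr r) / D_corr r" using D_corr_pos[OF r] by (simp add: less_divide_eq)
    then have "\<kappa> < ereal ((\<bar>scale_norm h * ?O\<bar> - Gamma_corr r) / D_corr r)" using \<kappa>(1) by (simp add: le_less_trans)
    also have "\<dots> \<le> data_stat (psi 1) n g Z \<omega>"
      unfolding data_stat_def multiscale_stat_psi_1 r_def
      by (rule SUP_upper2[OF h(1)], rule SUP_upper2[OF h(2)]) simp
    finally show "\<omega> \<in> {\<omega> \<in> space \<Omega>. \<kappa> < data_stat (psi 1) n g Z \<omega>}" using om by simp
  qed
  have "1 - 2 * exp (- y\<^sup>2 / 2) \<le> 1 - prob ?A"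
    using wiener_version_tail[OF bs cw h y] by simp
  also have "\<dots> = prob (space \<Omega> - ?A)" by (intro prob_compl[symmetric]) measurable
  also have "\<dots> \<le> prob {\<omega> \<in> space \<Omega>. \<kappa> < data_stat (psi 1) n g Z \<omega>}"
    using g by (intro finite_measure_mono sub sets_data_stat_greater[OF cw]) (simp add: holder_class_def)
  finally show ?thesis .
qed

section \<open>Asymptotics of the rate and of the bandwidth\<close>

lemma
  fixes \<beta> L M :: real and d n :: nat
  assumes "0 < \<beta>" "0 < L" "0 < M" and n: "3 \<le> n"
  defines "\<delta> \<equiv> (M * rate d \<beta> n / L) powr (1 / \<beta>)"
  shows bandwidth_rate_eq: "\<delta> = (M / L) powr (1 / \<beta>) * (ln (real n) / real n) powr (1 / (2 * \<beta> + real d))"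
    and bandwidth_rate_pos: "0 < \<delta>"
    and bandwidth_rate_powr: "L * \<delta> powr \<beta> = M * rate d \<beta> n"
proof -
  let ?q = "ln (real n) / real n"
  have q: "0 < ?q" using n by simp
  have rate: "rate d \<beta> n = ?q powr (\<beta> / (2 * \<beta> + real d))" by (simp add: rate_def)
  have r: "0 < rate d \<beta> n" unfolding rate powr_gt_zero using q by linarith
  have s: "0 < 2 * \<beta> + real d" using assms by simp
  have "\<delta> = ((M / L) * rate d \<beta> n) powr (1 / \<beta>)" unfolding \<delta>_def by simp
  also have "\<dots> = (M / L) powr (1 / \<beta>) * rate d \<beta> n powr (1 / \<beta>)"
    using assms r by (intro powr_mult)
  also have "rate d \<beta> n powr (1 / \<beta>) = ?q powr (1 / (2 * \<beta> + real d))"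
    unfolding rate powr_powr using \<open>0 < \<beta>\<close> by simp
  finally show "\<delta> = (M / L) powr (1 / \<beta>) * ?q powr (1 / (2 * \<beta> + real d))" .
  have p: "0 < M * rate d \<beta> n / L" using r assms by simp
  then show "0 < \<delta>" unfolding \<delta>_def powr_gt_zero by linarith
  have "\<delta> powr \<beta> = M * rate d \<beta> n / L" unfolding \<delta>_def powr_powr using r assms by simp
  then show "L * \<delta> powr \<beta> = M * rate d \<beta> n" using \<open>0 < L\<close> by simp
qed

text \<open>The power \<open>\<beta> + d / 2\<close> is half of \<open>2 * \<beta> + d\<close>, so
  it turns the rate in the bandwidth into \<open>sqrt (ln n / n)\<close>, and \<open>sqrt n\<close>
  times this is \<open>sqrt (ln n)\<close>. In \<open>- ln (2 * \<delta>)\<close> the terms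
  \<open>ln 2\<close> and \<open>ln (ln n)\<close> have a favourable sign once
  \<open>n \<ge> 3\<close>; subadditivity of the root splits off the constant
  \<open>\<bar>ln a\<bar>\<close>.\<close>

lemma power_exponent_lower_bound:
  fixes \<beta> L M I N :: real and d n :: nat
  assumes "0 < \<beta>" "0 < L" "0 < M" and n: "3 \<le> n" and d: "0 < d"
  defines "\<delta> \<equiv> (M * rate d \<beta> n / L) powr (1 / \<beta>)"
    and "a \<equiv> (M / L) powr (1 / \<beta>)"
  shows "(L * a powr (\<beta> + real d / 2) * I / N - sqrt (2 * real d / (2 * \<beta> + real d))) * sqrt (ln (real n)) - sqrt (2 * real d * \<bar>ln a\<bar>)
    \<le> sqrt (real n) * L * \<delta> powr (\<beta> + real d / 2) * I / N - sqrt (- 2 * real d * ln (2 * \<delta>))"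
proof -
  let ?q = "ln (real n) / real n" and ?s = "2 * \<beta> + real d"
  have q: "0 < ?q" using n by simp
  have s: "0 < ?s" using assms by simp
  have \<delta>: "\<delta> = a * ?q powr (1 / ?s)" unfolding \<delta>_def a_def by (rule bandwidth_rate_eq[OF assms(1-4)])
  have a: "0 < a" unfolding a_def using assms by simp
  have qp: "0 < ?q powr (1 / ?s)" unfolding powr_gt_zero using q by linarith
  have "\<delta> powr (\<beta> + real d / 2) = a powr (\<beta> + real d / 2) * (?q powr (1 / ?s)) powr (\<beta> + real d / 2)"
    unfolding \<delta> using a qp by (intro powr_mult) 
  also have "(?q powr (1 / ?s)) powr (\<beta> + real d / 2) = sqrt ?q"
  proof -
    have "1 / ?s * (\<beta> + real d / 2) = 1 / 2" using s by (simp add: field_simps)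
    then show ?thesis unfolding powr_powr using q by (simp only: powr_half_sqrt less_imp_le)
  qed
  finally have dp: "\<delta> powr (\<beta> + real d / 2) = a powr (\<beta> + real d / 2) * sqrt ?q" .
  have nq: "sqrt (real n) * sqrt ?q = sqrt (ln (real n))"
    using n by (simp add: real_sqrt_mult[symmetric])
  have mean: "sqrt (real n) * L * \<delta> powr (\<beta> + real d / 2) * I / N = L * a powr (\<beta> + real d / 2) * I / N * sqrt (ln (real n))"
    unfolding dp nq[symmetric] by simp
  have "1 \<le> ln (real n)" using n by (intro ln_ge_1) simp
  then have lnn: "0 \<le> ln (ln (real n))" "0 \<le> ln (real n)" by auto
  have "ln (2 * \<delta>) = ln 2 + ln a + (ln (ln (real n)) - ln (real n)) / ?s"
  proof -
    have "ln \<delta> = ln a + ln (?q powr (1 / ?s))" unfolding \<delta> by (rule ln_mult_pos[OF a qp])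
    also have "ln (?q powr (1 / ?s)) = 1 / ?s * ln ?q" using q by (simp add: ln_powr)
    also have "ln ?q = ln (ln (real n)) - ln (real n)" using n \<open>1 \<le> ln (real n)\<close> by (subst ln_div) auto
    finally have "ln \<delta> = ln a + (ln (ln (real n)) - ln (real n)) / ?s" by simp
    moreover have "ln (2 * \<delta>) = ln 2 + ln \<delta>" using \<delta> a qp by (intro ln_mult_pos) auto
    ultimately show ?thesis by simp
  qed
  moreover have "- (ln (real n) / ?s) \<le> (ln (ln (real n)) - ln (real n)) / ?s"
    unfolding minus_divide_left using s lnn by (intro divide_right_mono) auto
  moreover have "0 \<le> ln (2 :: real)" by simp
  ultimately have "- ln (2 * \<delta>) \<le> ln (real n) / ?s + \<bar>ln a\<bar>" by linarith
  then have "2 * real d * (- ln (2 * \<delta>)) \<le> 2 * real d * (ln (real n) / ?s + \<bar>ln a\<bar>)"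
    by (intro mult_left_mono) auto
  then have "- 2 * real d * ln (2 * \<delta>) \<le> 2 * real d / ?s * ln (real n) + 2 * real d * \<bar>ln a\<bar>"
    by (simp add: distrib_left)
  then have "sqrt (- 2 * real d * ln (2 * \<delta>)) \<le> sqrt (2 * real d / ?s * ln (real n) + 2 * real d * \<bar>ln a\<bar>)"
    by (rule real_sqrt_le_mono)
  also have "\<dots> \<le> sqrt (2 * real d / ?s * ln (real n)) + sqrt (2 * real d * \<bar>ln a\<bar>)"
    using s lnn by (intro sqrt_add_le_add_sqrt) auto
  also have "sqrt (2 * real d / ?s * ln (real n)) = sqrt (2 * real d / ?s) * sqrt (ln (real n))"
    by (rule real_sqrt_mult)
  finally show ?thesis unfolding mean left_diff_distrib by linarith
qed

text \<open>The square of the right-hand side is \<open>M powr ((2 * \<beta> + d) / \<beta>)\<close>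
  times a constant free of \<open>M\<close>. Solving the squared inequality for \<open>M\<close>
  produces exactly the assumed lower bound.\<close>

lemma signal_beats_correction:
  fixes \<beta> L M I N :: real and d n :: nat
  assumes "0 < \<beta>" "0 < L" and d: "0 < d" and I: "0 < I" and N: "0 < N"
    and M: "M > (2 * real d * L powr (real d / \<beta>) * N\<^sup>2 / ((2 * \<beta> + real d) * I\<^sup>2)) powr (\<beta> / (2 * \<beta> + real d))"
  shows "sqrt (2 * real d / (2 * \<beta> + real d)) < L * ((M / L) powr (1 / \<beta>)) powr (\<beta> + real d / 2) * I / N"
proof -
  let ?s = "2 * \<beta> + real d"
  define Q where "Q = 2 * real d * L powr (real d / \<beta>) * N\<^sup>2 / (?s * I\<^sup>2)"
  have s: "0 < ?s" using assms by simp
  have Q: "0 < Q" unfolding Q_def using s d I N \<open>0 < L\<close> by simp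
  have M0: "0 < M" using M by (rule le_less_trans[OF powr_ge_zero])
  have "(Q powr (\<beta> / ?s)) powr (?s / \<beta>) < M powr (?s / \<beta>)"
    using M[folded Q_def] s \<open>0 < \<beta>\<close> by (intro powr_less_mono2) auto
  then have QM: "Q < M powr (?s / \<beta>)" unfolding powr_powr using Q s \<open>0 < \<beta>\<close> by simp
  define A where "A = L * ((M / L) powr (1 / \<beta>)) powr (\<beta> + real d / 2) * I / N"
  have A0: "0 \<le> A" unfolding A_def using assms by simp
  have e: "1 / \<beta> * (\<beta> + real d / 2) + 1 / \<beta> * (\<beta> + real d / 2) = ?s / \<beta>" by (simp add: field_simps)
  have "A\<^sup>2 = L\<^sup>2 * (((M / L) powr (1 / \<beta>)) powr (\<beta> + real d / 2))\<^sup>2 * I\<^sup>2 / N\<^sup>2"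
    unfolding A_def by (simp add: power_mult_distrib power_divide)
  also have "(((M / L) powr (1 / \<beta>)) powr (\<beta> + real d / 2))\<^sup>2 = (M / L) powr (?s / \<beta>)"
    unfolding powr_powr power2_eq_square powr_add[symmetric] e ..
  also have "(M / L) powr (?s / \<beta>) = M powr (?s / \<beta>) / L powr (?s / \<beta>)"
    using M0 \<open>0 < L\<close> by (intro powr_divide)
  also have "L powr (?s / \<beta>) = L\<^sup>2 * L powr (real d / \<beta>)"
  proof -
    have "?s / \<beta> = 2 + real d / \<beta>" using \<open>0 < \<beta>\<close> by (simp add: field_simps)
    then show ?thesis using \<open>0 < L\<close> by (simp add: powr_add)
  qed
  finally have A2: "A\<^sup>2 = M powr (?s / \<beta>) * (I\<^sup>2 / (N\<^sup>2 * L powr (real d / \<beta>)))"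
    using \<open>0 < L\<close> by simp
  have "2 * real d / ?s = Q * (I\<^sup>2 / (N\<^sup>2 * L powr (real d / \<beta>)))"
    unfolding Q_def using I N \<open>0 < L\<close> s by simp
  also have "\<dots> < A\<^sup>2" unfolding A2 using QM I N \<open>0 < L\<close> by (intro mult_strict_right_mono) auto
  finally have "sqrt (2 * real d / ?s) < sqrt (A\<^sup>2)" by (rule real_sqrt_less_mono)
  then show ?thesis using A0 unfolding A_def[symmetric] by simp
qed

lemma bandwidth_rate_tendsto_0:
  fixes \<beta> L M :: real and d n :: nat
  assumes "0 < \<beta>" "0 < L" "0 < M"
  shows "(\<lambda>n. (M * rate d \<beta> n / L) powr (1 / \<beta>)) \<longlonglongrightarrow> 0"
proof -
  have "(\<lambda>n. ln (real n) / real n) \<longlonglongrightarrow> 0" by (rule lim_ln_over_n)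
  moreover have s: "0 < 1 / (2 * \<beta> + real d)" using assms by simp
  moreover have "eventually (\<lambda>n. 0 \<le> ln (real n) / real n) sequentially"
    using eventually_ge_at_top[of 1] by eventually_elim simp
  ultimately have "(\<lambda>n. (ln (real n) / real n) powr (1 / (2 * \<beta> + real d))) \<longlonglongrightarrow> 0 powr (1 / (2 * \<beta> + real d))"
    by (intro tendsto_powr2[OF _ tendsto_const]) auto
  then have "(\<lambda>n. (ln (real n) / real n) powr (1 / (2 * \<beta> + real d))) \<longlonglongrightarrow> 0" by simp
  then have "(\<lambda>n. (M / L) powr (1 / \<beta>) * (ln (real n) / real n) powr (1 / (2 * \<beta> + real d))) \<longlonglongrightarrow> (M / L) powr (1 / \<beta>) * 0"
    by (intro tendsto_intros)
  moreover have "eventually (\<lambda>n. (M / L) powr (1 / \<beta>) * (ln (real n) / real n) powr (1 / (2 * \<beta> + real d)) = (M * rate d \<beta> n / L) powr (1 / \<beta>)) sequentially"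
    using eventually_ge_at_top[of 3] by eventually_elim (simp add: bandwidth_rate_eq assms)
  ultimately show ?thesis by (simp add: tendsto_cong)
qed

theorem proposition3p1:
  fixes \<Omega> :: "'w measure"
    and W :: "real ^ 'n \<Rightarrow> 'w \<Rightarrow> real"
    and Z :: "real ^ 'n \<Rightarrow> real ^ 'n \<Rightarrow> 'w \<Rightarrow> real"
    and \<beta> L \<alpha> M :: real
  assumes "brownian_sheet \<Omega> W"
    and "continuous_wiener_version \<Omega> W (psi 1) Z"
    and "0 < \<beta>" "\<beta> \<le> 1"
    and "0 < L"
    and "0 < \<alpha>" "\<alpha> < 1"
    and "M > (2 * real CARD('n) * L powr (real CARD('n) / \<beta>) * (l2_norm (psi 1 :: real ^ 'n \<Rightarrow> real))\<^sup>2 /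
              ((2 * \<beta> + real CARD('n)) * (l2_inner (psi 1) (psi \<beta> :: real ^ 'n \<Rightarrow> real))\<^sup>2))
             powr (\<beta> / (2 * \<beta> + real CARD('n)))"
  shows "(\<lambda>n. INF g\<in>{g \<in> holder_class \<beta> L.
             sup_norm_on (inner_cube ((M * rate CARD('n) \<beta> n / L) powr (1 / \<beta>))) g
               \<ge> M * rate CARD('n) \<beta> n}.
           measure \<Omega> {\<omega> \<in> space \<Omega>. data_stat (psi 1) n g Z \<omega> > critical_value \<Omega> (psi 1) Z \<alpha>})
         \<longlonglongrightarrow> 1"
proof -
  interpret prob_space \<Omega> using assms(1) by (simp add: brownian_sheet_def)
  let ?d = "CARD('n)" and ?\<kappa> = "critical_value \<Omega> (psi 1) Z \<alpha>"
  let ?I = "l2_inner (psi 1) (psi \<beta> :: real ^ 'n \<Rightarrow> real)" and ?N = "l2_norm (psi 1 :: real ^ 'n \<Rightarrow> real)"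
  define \<delta> where "\<delta> n = (M * rate ?d \<beta> n / L) powr (1 / \<beta>)" for n
  define G where "G n = {g \<in> holder_class \<beta> L. sup_norm_on (inner_cube (\<delta> n) :: (real ^ 'n) set) g \<ge> M * rate ?d \<beta> n}" for n
  define p where "p n g = prob {\<omega> \<in> space \<Omega>. data_stat (psi 1) n g Z \<omega> > ?\<kappa>}" for n g
  obtain c where c: "0 \<le> c" "?\<kappa> \<le> ereal c"
    using critical_value_bounded[OF assms(1,2,6)] by blast
  have M: "0 < M" using assms(8) by (rule le_less_trans[OF powr_ge_zero])
  have d: "0 < ?d" by simp
  define a where "a = (M / L) powr (1 / \<beta>)"
  define A where "A = L * a powr (\<beta> + real ?d / 2) * ?I / ?N - sqrt (2 * real ?d / (2 * \<beta> + real ?d))"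
  have A: "0 < A"
    using signal_beats_correction[OF assms(3,5) d l2_inner_psi_pos[OF assms(3)] l2_norm_psi_1(1) assms(8)]
    unfolding A_def a_def by simp
  \<comment> \<open>An explicit minorant of the quantity \<open>y\<close> in
    \<open>power_lower_bound\<close>, in terms of \<open>ln n\<close> alone. It is the same for all
    \<open>g\<close>, so the resulting bound passes to the infimum.\<close>
  define z where "z n = A * sqrt (ln (real n)) - sqrt (2 * real ?d * \<bar>ln a\<bar>) - 2 * c" for n
  have z: "filterlim z at_top sequentially"
  proof -
    have "filterlim (\<lambda>n. sqrt (ln (real n))) at_top sequentially"
      by (intro filterlim_compose[OF sqrt_at_top] filterlim_compose[OF ln_at_top] filterlim_real_sequentially)
    then have "filterlim (\<lambda>n. A * sqrt (ln (real n))) at_top sequentially"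
      by (rule filterlim_tendsto_pos_mult_at_top[OF tendsto_const A])
    then have "filterlim (\<lambda>n. - (sqrt (2 * real ?d * \<bar>ln a\<bar>) + 2 * c) + A * sqrt (ln (real n))) at_top sequentially"
      by (rule filterlim_tendsto_add_at_top[OF tendsto_const])
    then show ?thesis unfolding z_def[abs_def] by (simp add: algebra_simps)
  qed
  have "(\<lambda>n. exp (- (z n)\<^sup>2 / 2)) \<longlonglongrightarrow> 0"
  proof -
    have "filterlim (\<lambda>n. z n * z n) at_top sequentially" by (rule filterlim_at_top_mult_at_top[OF z z])
    then have "filterlim (\<lambda>n. (1/2) * (z n * z n)) at_top sequentially"
      by (intro filterlim_tendsto_pos_mult_at_top[OF tendsto_const]) auto
    then have "filterlim (\<lambda>n. - ((1/2) * (z n * z n))) at_bot sequentially"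
      by (simp add: filterlim_uminus_at_bot)
    then have "(\<lambda>n. exp (- ((1/2) * (z n * z n)))) \<longlonglongrightarrow> 0" by (rule filterlim_compose[OF exp_at_bot])
    then show ?thesis by (simp add: power2_eq_square)
  qed
  then have "(\<lambda>n. 1 - 2 * exp (- (z n)\<^sup>2 / 2)) \<longlonglongrightarrow> 1 - 2 * 0" by (intro tendsto_intros)
  then have lim: "(\<lambda>n. 1 - 2 * exp (- (z n)\<^sup>2 / 2)) \<longlonglongrightarrow> 1" by simp
  have "\<delta> \<longlonglongrightarrow> 0" unfolding \<delta>_def[abs_def] by (rule bandwidth_rate_tendsto_0[OF assms(3,5) M])
  then have "eventually (\<lambda>n. \<delta> n < 1/2) sequentially" by (rule order_tendstoD) simp
  moreover have "eventually (\<lambda>n. 0 < z n) sequentially" using z by (simp add: filterlim_at_top_dense)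
  \<comment> \<open>The three conditions serve the logarithms of n, the admissibility of the
    bandwidth together with a non-empty inner cube, and the monotonicity of the square in
    \<open>z n \<le> y\<close>.\<close>
  ultimately have ev: "eventually (\<lambda>n. 3 \<le> n \<and> \<delta> n \<le> 1/2 \<and> 0 < z n) sequentially"
    using eventually_ge_at_top[of 3] by eventually_elim simp
  have bounds: "1 - 2 * exp (- (z n)\<^sup>2 / 2) \<le> (INF g\<in>G n. p n g) \<and> (INF g\<in>G n. p n g) \<le> 1"
    if n: "3 \<le> n \<and> \<delta> n \<le> 1/2 \<and> 0 < z n" for n
  proof -
    have \<delta>: "0 < \<delta> n" "\<delta> n \<le> 1/2" "L * \<delta> n powr \<beta> = M * rate ?d \<beta> n"
      unfolding \<delta>_def using n bandwidth_rate_pos[OF assms(3,5) M] bandwidth_rate_powr[OF assms(3,5) M] by (auto simp: \<delta>_def)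
    have b0: "0 \<le> M * rate ?d \<beta> n" using \<delta>(3) assms(5) by (metis less_imp_le mult_nonneg_nonneg powr_ge_zero)
    have ne: "(\<lambda>_. M * rate ?d \<beta> n) \<in> G n"
      unfolding G_def using const_in_holder_class[where 'n='n, OF assms(5) b0 \<delta>(1,2)] by simp
    have "1 - 2 * exp (- (z n)\<^sup>2 / 2) \<le> p n g" if g: "g \<in> G n" for g
    proof -
      define y where "y = sqrt (real n) * L * \<delta> n powr (\<beta> + real ?d / 2) * ?I / ?N - sqrt (- 2 * real ?d * ln (2 * \<delta> n)) - 2 * c"
      have zy: "z n \<le> y"
        using power_exponent_lower_bound[OF assms(3,5) M _ d, of n ?I ?N] n
        unfolding z_def y_def A_def \<delta>_def a_def by simp
      have "1 - 2 * exp (- y\<^sup>2 / 2) \<le> p n g"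
        unfolding p_def y_def using g zy n \<delta>(3) unfolding G_def y_def
        by (intro power_lower_bound[OF assms(1,2) _ assms(3,5) \<delta>(1,2) _ c(2,1)]) auto
      moreover have "(z n)\<^sup>2 \<le> y\<^sup>2" using zy n by (intro power_mono) auto
      ultimately show ?thesis by (smt (verit) divide_right_mono exp_le_cancel_iff)
    qed
    moreover have "p n g \<le> 1" for g unfolding p_def by simp
    moreover have "bdd_below (p n ` G n)" by (rule bdd_belowI2[of _ 0]) (simp add: p_def)
    ultimately show ?thesis
      using ne by (auto intro!: cINF_greatest cINF_lower2[OF _ ne])
  qed
  have "(\<lambda>n. INF g\<in>G n. p n g) \<longlonglongrightarrow> 1"
  proof (rule tendsto_sandwich[OF _ _ lim tendsto_const])
    show "eventually (\<lambda>n. 1 - 2 * exp (- (z n)\<^sup>2 / 2) \<le> (INF g\<in>G n. p n g)) sequentially"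
      using ev by eventually_elim (use bounds in blast)
    show "eventually (\<lambda>n. (INF g\<in>G n. p n g) \<le> 1) sequentially"
      using ev by eventually_elim (use bounds in blast)
  qed
  then show ?thesis unfolding G_def p_def \<delta>_def .
qed

end
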